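(* Let $X$ be a 1-step one-dimensional shift of finite type, $Y$ a sofic shift and $\pi:X\to Y$ a 1-block factor code. Let $\nu$ be an invariant measure on $Y$, and let $\mu$ be an invariant measure on $X$ of relative maximal entropy over $\nu$. Then for every finite set $G\subseteq\mathbb{Z}$, the conditional distribution under $\mu$ of the configuration on $G$, given the image point $y=\pi(x)$ and the configuration on $G^c$, is $\mu$-a.s. uniform over all configurations on $G$ which extend the configuration on $\partial G^c$ and map to the same configuration in $Y$ under $\pi$. That is, for every configuration $\alpha$ of $X$ on $G$, for $\mu$-almost every $x\in X$, $$\mathbb{E}_\mu\big(1_{\alpha}\,\big|\,\pi^{-1}(\mathscr{B}_Y)\vee\sigma(X_{G^c})\big)(x)=\begin{cases}\dfrac{1}{L_{(x,G)}} & \text{if } \alpha \text{ extends } x_{\partial G^c} \text{ and } \alpha \text{ has the same image as } x_G \text{ under } \pi_{\mathrm b},\\[2mm] 0 & \text{otherwise,}\end{cases}$$ where $L_{(x,G)}$ is the number of configurations of $X$ on $G$ which extend $x_{\partial G^c}$ and have the same image as $x_G$ under $\pi_{\mathrm b}$.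
   Context: All shift spaces are two-sided over finite alphabets, with shift map $T$; the alphabet of $X$ is $\mathcal{A}(X)$. A shift of finite type $X$ is 1-step if it is determined by its allowed 2-blocks, i.e. $x\in X$ iff every $x_ix_{i+1}$ is a 2-block occurring in $X$. A factor code is a surjective continuous shift-commuting map; it is 1-block if it is induced by a symbol map $\pi_{\mathrm b}:\mathcal{A}(X)\to\mathcal{A}(Y)$, i.e. $\pi(x)_i=\pi_{\mathrm b}(x_i)$; $\pi_{\mathrm b}$ is applied coordinatewise to configurations. Measures are Borel probability measures; invariant means shift-invariant. A measure $\mu$ of relative maximal entropy over $\nu$ is an invariant measure on $X$ which projects to $\nu$ under $\pi$ and has maximal entropy among all invariant measures in the fibre $\pi^{-1}\{\nu\}$ (the set of invariant measures on $X$ projecting to $\nu$). For finite $G\subseteq\mathbb{Z}$, $G^c=\mathbb{Z}\setminus G$ and $\partial G^c=\{i\in G^c:\exists j\in G,\ |i-j|=1\}$. For $S\subseteq \mathbb{Z}$, $x_S$ is the configuration occurring in $x$ on $S$, and $\sigma(X_S)$ is the $\sigma$-algebra generated by the coordinates in $S$. $\mathscr{B}_Y$ is the $\sigma$-algebra of $Y$ generated by cylinder sets. $1_\alpha$ is the indicator function of $\{x\in X: x_G=\alpha\}$. A configuration $\alpha$ on $G$ extends $x_{\partial G^c}$ if $\alpha$ and $x_{\partial G^c}$ together form an allowed configuration of $X$ on $G\cup\partial G^c$; equivalently (as $X$ is 1-step), replacing $x_G$ by $\alpha$ in $x$ gives a point of $X$. *)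

theory Defs
  imports "HOL-Probability.Probability"
begin

section \<open>Two-sided shift spaces\<close>

definition alphabet :: "(int \<Rightarrow> 'a) set \<Rightarrow> 'a set" where
  "alphabet X = (\<Union>x\<in>X. range x)"

definition shift :: "(int \<Rightarrow> 'a) \<Rightarrow> (int \<Rightarrow> 'a)" where
  "shift x = (\<lambda>i. x (i + 1))"

definition shift_topology :: "(int \<Rightarrow> 'a) set \<Rightarrow> (int \<Rightarrow> 'a) topology" where
  "shift_topology X = subtopology (product_topology (\<lambda>_. discrete_topology UNIV) UNIV) X"

definition shift_space :: "(int \<Rightarrow> 'a) set \<Rightarrow> bool" where
  "shift_space X \<longleftrightarrow>
     finite (alphabet X) \<and> closedin (shift_topology UNIV) X \<and> shift ` X = X"

definition occurs_in :: "'a list \<Rightarrow> (int \<Rightarrow> 'a) \<Rightarrow> bool" where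
  "occurs_in w x \<longleftrightarrow> (\<exists>i. \<forall>k<length w. x (i + int k) = w ! k)"

definition sft :: "(int \<Rightarrow> 'a) set \<Rightarrow> bool" where
  "sft X \<longleftrightarrow> (\<exists>A F. finite A \<and> finite F \<and>
     X = {x. range x \<subseteq> A \<and> (\<forall>w\<in>F. \<not> occurs_in w x)})"

definition one_step_sft :: "(int \<Rightarrow> 'a) set \<Rightarrow> bool" where
  "one_step_sft X \<longleftrightarrow> sft X \<and>
     (\<forall>x. x \<in> X \<longleftrightarrow> (\<forall>i. \<exists>z\<in>X. occurs_in [x i, x (i + 1)] z))"

definition factor_code ::
  "(int \<Rightarrow> 'a) set \<Rightarrow> (int \<Rightarrow> 'b) set \<Rightarrow> ((int \<Rightarrow> 'a) \<Rightarrow> (int \<Rightarrow> 'b)) \<Rightarrow> bool" where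
  "factor_code X Y \<pi> \<longleftrightarrow>
     continuous_map (shift_topology X) (shift_topology Y) \<pi> \<and> \<pi> ` X = Y \<and>
     (\<forall>x\<in>X. \<pi> (shift x) = shift (\<pi> x))"

definition one_block_factor_code ::
  "(int \<Rightarrow> 'a) set \<Rightarrow> (int \<Rightarrow> 'b) set \<Rightarrow> ('a \<Rightarrow> 'b) \<Rightarrow> ((int \<Rightarrow> 'a) \<Rightarrow> (int \<Rightarrow> 'b)) \<Rightarrow> bool" where
  "one_block_factor_code X Y \<pi>\<^sub>b \<pi> \<longleftrightarrow>
     factor_code X Y \<pi> \<and> (\<forall>x\<in>X. \<forall>i. \<pi> x i = \<pi>\<^sub>b (x i))"

text \<open>Every finite alphabet can be renamed into the natural numbers, so it is no restriction to
  take the covering shift of finite type over them.\<close>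

definition sofic :: "(int \<Rightarrow> 'b) set \<Rightarrow> bool" where
  "sofic Y \<longleftrightarrow> shift_space Y \<and>
     (\<exists>(Z :: (int \<Rightarrow> nat) set) \<phi>. sft Z \<and> factor_code Z Y \<phi>)"

section \<open>Invariant measures and entropy\<close>

definition borel_shift :: "(int \<Rightarrow> 'a) set \<Rightarrow> (int \<Rightarrow> 'a) measure" where
  "borel_shift X = sigma X {U. openin (shift_topology X) U}"

definition invariant_measures :: "(int \<Rightarrow> 'a) set \<Rightarrow> (int \<Rightarrow> 'a) measure set" where
  "invariant_measures X =
     {\<mu>. prob_space \<mu> \<and> sets \<mu> = sets (borel_shift X) \<and> distr \<mu> \<mu> shift = \<mu>}"

definition itinerary :: "('x \<Rightarrow> 'x) \<Rightarrow> ('x \<Rightarrow> 'c) \<Rightarrow> nat \<Rightarrow> 'x \<Rightarrow> 'c list" where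
  "itinerary T f n x = map (\<lambda>i. f ((T ^^ i) x)) [0..<n]"

text \<open>Kolmogorov--Sinai entropy. A finite measurable partition is given by a simple function \<open>f\<close>
  labelling its cells; \<open>itinerary T f n\<close> then labels the cells of the join of the preimages of
  that partition under \<open>T ^^ 0, \<dots>, T ^^ (n - 1)\<close>. Logarithms are natural.\<close>

definition partition_entropy :: "'x measure \<Rightarrow> ('x \<Rightarrow> 'x) \<Rightarrow> ('x \<Rightarrow> nat) \<Rightarrow> real" where
  "partition_entropy M T f =
     lim (\<lambda>n. prob_space.entropy M (exp 1)
                 (count_space (itinerary T f n ` space M)) (itinerary T f n) / real n)"

definition ks_entropy :: "'x measure \<Rightarrow> ('x \<Rightarrow> 'x) \<Rightarrow> ereal" where
  "ks_entropy M T = (SUP f \<in> {f. simple_function M f}. ereal (partition_entropy M T f))"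

definition measure_fibre ::
  "(int \<Rightarrow> 'a) set \<Rightarrow> ((int \<Rightarrow> 'a) \<Rightarrow> (int \<Rightarrow> 'b)) \<Rightarrow> (int \<Rightarrow> 'b) measure \<Rightarrow> (int \<Rightarrow> 'a) measure set" where
  "measure_fibre X \<pi> \<nu> = {\<mu> \<in> invariant_measures X. distr \<mu> \<nu> \<pi> = \<nu>}"

definition relative_maximal_entropy ::
  "(int \<Rightarrow> 'a) set \<Rightarrow> ((int \<Rightarrow> 'a) \<Rightarrow> (int \<Rightarrow> 'b)) \<Rightarrow> (int \<Rightarrow> 'b) measure \<Rightarrow> (int \<Rightarrow> 'a) measure \<Rightarrow> bool" where
  "relative_maximal_entropy X \<pi> \<nu> \<mu> \<longleftrightarrow>
     \<mu> \<in> measure_fibre X \<pi> \<nu> \<and>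
     (\<forall>\<mu>'\<in>measure_fibre X \<pi> \<nu>. ks_entropy \<mu>' shift \<le> ks_entropy \<mu> shift)"

section \<open>Configurations and conditioning\<close>

text \<open>A configuration on \<open>S\<close> is represented by the function that is \<open>undefined\<close> outside \<open>S\<close>
  (see \<^const>\<open>restrict\<close>), so that distinct configurations are distinct functions.\<close>

definition configurations :: "(int \<Rightarrow> 'a) set \<Rightarrow> int set \<Rightarrow> (int \<Rightarrow> 'a) set" where
  "configurations X S = (\<lambda>x. restrict x S) ` X"

definition outer_boundary :: "int set \<Rightarrow> int set" where
  "outer_boundary G = {i \<in> - G. \<exists>j\<in>G. \<bar>i - j\<bar> = 1}"

definition extends_boundary ::
  "(int \<Rightarrow> 'a) set \<Rightarrow> int set \<Rightarrow> (int \<Rightarrow> 'a) \<Rightarrow> (int \<Rightarrow> 'a) \<Rightarrow> bool" where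
  "extends_boundary X G \<alpha> x \<longleftrightarrow>
     (\<lambda>i\<in>G \<union> outer_boundary G. if i \<in> G then \<alpha> i else x i)
       \<in> configurations X (G \<union> outer_boundary G)"

definition same_image_on :: "('a \<Rightarrow> 'b) \<Rightarrow> int set \<Rightarrow> (int \<Rightarrow> 'a) \<Rightarrow> (int \<Rightarrow> 'a) \<Rightarrow> bool" where
  "same_image_on \<pi>\<^sub>b G \<alpha> x \<longleftrightarrow> (\<forall>i\<in>G. \<pi>\<^sub>b (\<alpha> i) = \<pi>\<^sub>b (x i))"

definition num_extensions ::
  "(int \<Rightarrow> 'a) set \<Rightarrow> ('a \<Rightarrow> 'b) \<Rightarrow> int set \<Rightarrow> (int \<Rightarrow> 'a) \<Rightarrow> nat" where
  "num_extensions X \<pi>\<^sub>b G x =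
     card {\<beta> \<in> configurations X G. extends_boundary X G \<beta> x \<and> same_image_on \<pi>\<^sub>b G \<beta> x}"

definition cylinder_algebra :: "(int \<Rightarrow> 'b) set \<Rightarrow> (int \<Rightarrow> 'b) measure" where
  "cylinder_algebra Y =
     sigma Y {{y \<in> Y. \<forall>k<length w. y (i + int k) = w ! k} | i w. True}"

definition coordinate_algebra :: "(int \<Rightarrow> 'a) set \<Rightarrow> int set \<Rightarrow> (int \<Rightarrow> 'a) measure" where
  "coordinate_algebra X S = sigma X {{x \<in> X. x i = a} | i a. i \<in> S}"

text \<open>The join \<open>\<pi>\<^sup>-\<^sup>1(\<B>\<^sub>Y) \<or> \<sigma>(X\<^sub>S)\<close>. Only the underlying \<open>\<sigma>\<close>-algebra is used, since
  \<^const>\<open>real_cond_exp\<close> ignores the measure carried by its second argument.\<close>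

definition conditioning_algebra ::
  "(int \<Rightarrow> 'a) set \<Rightarrow> (int \<Rightarrow> 'b) set \<Rightarrow> ((int \<Rightarrow> 'a) \<Rightarrow> (int \<Rightarrow> 'b)) \<Rightarrow> int set \<Rightarrow> (int \<Rightarrow> 'a) measure" where
  "conditioning_algebra X Y \<pi> S =
     sigma X (sets (vimage_algebra X \<pi> (cylinder_algebra Y)) \<union> sets (coordinate_algebra X S))"

end

theory Submission
  imports Defs
begin

text \<open>The argument is variational. If the conditional distribution on \<open>G\<close> were not uniform, then
  resampling the configuration on widely spaced translates of \<open>G\<close> would produce an invariant measure
  over the same \<open>\<nu>\<close> with larger entropy.

  Fix a window \<open>{-r..r}\<close> with \<open>G\<close> in its interior, and call two words of \<open>X\<close> on the window equivalent if
  they agree off \<open>G\<close> and have the same image on \<open>G\<close>. As \<open>X\<close> is 1-step and the boundary of \<open>G\<close> lies in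
  the window, a point of \<open>X\<close> stays in \<open>X\<close>, with the same image, when its word on the window is replaced
  by an equivalent one (\<open>glue_in_X\<close>, \<open>image_glue\<close>). The translates of the window by multiples of
  \<open>N = 2r+1\<close> tile \<open>\<int>\<close>. Replacing all words of a \<open>\<mu>\<close>-random point at once, independently and uniformly
  within their classes, gives a measure invariant under the \<open>N\<close>-th power of the shift; the average of
  its \<open>N\<close> first translates is shift-invariant and still projects to \<open>\<nu>\<close> (\<open>averaged_in_fibre\<close>).

  Let \<open>V\<close> be the word on the window and \<open>c\<close> its class. Resampling keeps the law of the sequence
  \<open>c\<^sub>0, c\<^sub>1, \<dots>\<close> of classes. After resampling, \<open>m\<close> consecutive words have entropy at least
  \<open>H(c\<^sub>0, \<dots>, c\<^sub>m\<^sub>-\<^sub>1) + m \<cdot> E ln |c|\<close> (\<open>shannon_resampled_ge\<close>); under \<open>\<mu>\<close> they have entropy at most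
  \<open>H(c\<^sub>0, \<dots>, c\<^sub>m\<^sub>-\<^sub>1) + m (H(V) - H(c))\<close>, by strong subadditivity
  (\<open>shannon_itinerary_le_factor\<close>). So the averaged measure has at least the entropy of \<open>\<mu>\<close> plus
  \<open>(E ln |c| - (H(V) - H(c))) / N\<close>. By the Kolmogorov-Sinai theorem both entropies are finite and are
  attained by the partition into letters (\<open>ks_entropy_letter_code\<close>), so maximality of \<open>\<mu>\<close> forces
  \<open>E ln |c| \<le> H(V) - H(c)\<close>. This is the equality case of Gibbs' inequality: given its class, the
  word on the window is uniformly distributed (\<open>uniform_on_classes\<close>).

  As \<open>r\<close> grows, the events determined by the class on the window form an intersection-stable family
  that generates the conditioning algebra. On each of them uniformity gives the integral identity
  that characterises the conditional expectation, and Dynkin's lemma extends it to the whole algebra.\<close>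

section \<open>Entropy of finite-valued observables\<close>

definition mass_at :: "'x measure \<Rightarrow> ('x \<Rightarrow> 'v) \<Rightarrow> 'v \<Rightarrow> real" where
  "mass_at M f v = measure M (f -` {v} \<inter> space M)"

definition shannon :: "'x measure \<Rightarrow> ('x \<Rightarrow> 'v) \<Rightarrow> real" where
  "shannon M f = (\<Sum>v\<in>f ` space M. - (mass_at M f v * ln (mass_at M f v)))"

lemma mass_at_nonneg [simp]: "0 \<le> mass_at M f v"
  by (simp add: mass_at_def)

lemma mass_at_le_1: "prob_space M \<Longrightarrow> mass_at M f v \<le> 1"
  by (simp add: mass_at_def prob_space.prob_le_1)

lemma mass_at_eq_0: "v \<notin> f ` space M \<Longrightarrow> mass_at M f v = 0"
proof -
  assume "v \<notin> f ` space M"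
  then have "f -` {v} \<inter> space M = {}" by auto
  then show ?thesis by (simp add: mass_at_def)
qed

lemma shannon_superset:
  assumes "finite S" "f ` space M \<subseteq> S"
  shows "shannon M f = (\<Sum>v\<in>S. - (mass_at M f v * ln (mass_at M f v)))"
  unfolding shannon_def using assms
  by (intro sum.mono_neutral_left) (auto simp: mass_at_eq_0)

text \<open>The inequality \<open>ln t \<le> t - 1\<close>, with equality only at \<open>t = 1\<close>, taken at \<open>t = q / p\<close>. At \<open>p = 0\<close>
  the factor \<open>p\<close> hides the value of the logarithms.\<close>

lemma gibbs_pointwise:
  fixes p q :: real
  assumes "0 \<le> p" "0 \<le> q" "0 < p \<Longrightarrow> 0 < q"
  shows "p * ln q - p * ln p \<le> q - p"
    and "p * ln q - p * ln p = q - p \<Longrightarrow> p = q"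
proof -
  show "p * ln q - p * ln p \<le> q - p"
  proof (cases "p = 0")
    case False
    then have pos: "p > 0" "q > 0" using assms by auto
    have "ln (q / p) \<le> q / p - 1" using pos by (intro ln_le_minus_one) simp
    then have "p * ln (q / p) \<le> p * (q / p - 1)" using pos by (intro mult_left_mono) auto
    then show ?thesis using pos by (simp add: ln_div right_diff_distrib)
  qed (use assms in simp)
  assume eq: "p * ln q - p * ln p = q - p"
  show "p = q"
  proof (cases "p = 0")
    case False
    then have pos: "p > 0" "q > 0" using assms by auto
    then have "p * ln (q / p) = p * (q / p - 1)"
      using eq by (simp add: ln_div right_diff_distrib)
    then have "ln (q / p) = q / p - 1" using pos by simp
    then have "q / p = 1" using pos ln_eq_minus_one[of "q / p"] by simp
    then show ?thesis using pos by simp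
  qed (use eq in simp)
qed

lemma gibbs_inequality:
  fixes p q :: "'v \<Rightarrow> real"
  assumes "finite S"
    and "\<And>s. s \<in> S \<Longrightarrow> 0 \<le> p s" "\<And>s. s \<in> S \<Longrightarrow> 0 \<le> q s"
    and "\<And>s. s \<in> S \<Longrightarrow> 0 < p s \<Longrightarrow> 0 < q s"
    and "sum q S \<le> sum p S"
  shows "(\<Sum>s\<in>S. - (p s * ln (p s))) \<le> (\<Sum>s\<in>S. - (p s * ln (q s)))"
proof -
  have "(\<Sum>s\<in>S. p s * ln (q s) - p s * ln (p s)) \<le> (\<Sum>s\<in>S. q s - p s)"
    using assms by (intro sum_mono gibbs_pointwise) auto
  also have "\<dots> \<le> 0" using assms by (simp add: sum_subtractf)
  finally show ?thesis by (simp add: sum_subtractf sum_negf)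
qed

text \<open>The differences in \<open>gibbs_pointwise\<close> are nonnegative, and the hypotheses bound their sum by \<open>0\<close>;
  so each of them vanishes.\<close>

lemma gibbs_equality:
  fixes p q :: "'v \<Rightarrow> real"
  assumes "finite S"
    and "\<And>s. s \<in> S \<Longrightarrow> 0 \<le> p s" "\<And>s. s \<in> S \<Longrightarrow> 0 \<le> q s"
    and "\<And>s. s \<in> S \<Longrightarrow> 0 < p s \<Longrightarrow> 0 < q s"
    and "sum q S \<le> sum p S"
    and "(\<Sum>s\<in>S. - (p s * ln (q s))) \<le> (\<Sum>s\<in>S. - (p s * ln (p s)))"
    and "s \<in> S"
  shows "p s = q s"
proof -
  let ?d = "\<lambda>s. (q s - p s) - (p s * ln (q s) - p s * ln (p s))"
  have nn: "\<And>s. s \<in> S \<Longrightarrow> 0 \<le> ?d s"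
    using gibbs_pointwise(1) assms(2-4) by (metis diff_ge_0_iff_ge)
  have "sum ?d S \<le> 0" using assms(5,6) by (simp add: sum_subtractf sum_negf)
  then have "sum ?d S = 0" using sum_nonneg[of S ?d] nn by fastforce
  then have "?d s = 0" using sum_nonneg_eq_0_iff[of S ?d] nn assms(1,7) by fastforce
  then show ?thesis using gibbs_pointwise(2)[of "p s" "q s"] assms(2-4,7) by simp
qed

lemma measure_vimage_eq_sum:
  assumes "prob_space M" "simple_function M f" "finite S" "f ` space M \<subseteq> S"
  shows "measure M (f -` A \<inter> space M) = (\<Sum>v\<in>S \<inter> A. mass_at M f v)"
proof -
  interpret prob_space M by fact
  have "f -` A \<inter> space M = (\<Union>v\<in>S \<inter> A. f -` {v} \<inter> space M)" using assms by auto
  also have "measure M \<dots> = (\<Sum>v\<in>S \<inter> A. mass_at M f v)" unfolding mass_at_def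
    using assms simple_functionD(2)[OF assms(2)]
    by (intro finite_measure_finite_Union) (auto simp: disjoint_family_on_def)
  finally show ?thesis .
qed

lemma mass_at_compose:
  assumes "prob_space M" "simple_function M f" "finite S" "f ` space M \<subseteq> S"
  shows "mass_at M (\<lambda>x. \<phi> (f x)) u = (\<Sum>v\<in>{v\<in>S. \<phi> v = u}. mass_at M f v)"
proof -
  have "(\<lambda>x. \<phi> (f x)) -` {u} \<inter> space M = f -` (\<phi> -` {u}) \<inter> space M" by auto
  then show ?thesis
    using measure_vimage_eq_sum[OF assms, of "\<phi> -` {u}"]
    by (auto simp: mass_at_def intro!: sum.cong)
qed

lemma sum_mass_at:
  assumes "prob_space M" "simple_function M f" "finite S" "f ` space M \<subseteq> S"
  shows "(\<Sum>v\<in>S. mass_at M f v) = 1"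
  using measure_vimage_eq_sum[OF assms, of UNIV] prob_space.prob_space[OF assms(1)] by simp

lemma mass_at_le_compose:
  assumes "prob_space M" "simple_function M f"
  shows "mass_at M f v \<le> mass_at M (\<lambda>x. \<phi> (f x)) (\<phi> v)"
proof -
  interpret prob_space M by fact
  have "(\<lambda>x. \<phi> (f x)) -` {\<phi> v} \<inter> space M = f -` (\<phi> -` {\<phi> v}) \<inter> space M" by auto
  then show ?thesis unfolding mass_at_def
    using simple_functionD(2)[OF assms(2)] by (intro finite_measure_mono) auto
qed

text \<open>Change of variables: both sides are the expectation of \<open>k\<close> at the value of \<open>\<phi> \<circ> f\<close>.\<close>

lemma sum_mass_at_compose:
  assumes "prob_space M" "simple_function M f" "finite S" "f ` space M \<subseteq> S"
  shows "(\<Sum>v\<in>S. mass_at M f v * k (\<phi> v)) = (\<Sum>u\<in>\<phi> ` S. mass_at M (\<lambda>x. \<phi> (f x)) u * k u)"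
proof -
  have "(\<Sum>v\<in>S. mass_at M f v * k (\<phi> v)) = (\<Sum>u\<in>\<phi> ` S. \<Sum>v\<in>{v\<in>S. \<phi> v = u}. mass_at M f v * k (\<phi> v))"
    using assms by (intro sum.image_gen)
  also have "\<dots> = (\<Sum>u\<in>\<phi> ` S. mass_at M (\<lambda>x. \<phi> (f x)) u * k u)"
    by (intro sum.cong refl) (simp add: mass_at_compose[OF assms] sum_distrib_right)
  finally show ?thesis .
qed

text \<open>Written over the values of the finer observable \<open>f\<close>, the entropy of \<open>\<phi> \<circ> f\<close> can be compared term
  by term with entropies of other observables derived from \<open>f\<close>.\<close>

lemma shannon_compose:
  assumes "prob_space M" "simple_function M f" "finite S" "f ` space M \<subseteq> S"
  shows "shannon M (\<lambda>x. \<phi> (f x)) =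
    (\<Sum>v\<in>S. - (mass_at M f v * ln (mass_at M (\<lambda>x. \<phi> (f x)) (\<phi> v))))"
proof -
  have "shannon M (\<lambda>x. \<phi> (f x)) = (\<Sum>u\<in>\<phi> ` S. - (mass_at M (\<lambda>x. \<phi> (f x)) u * ln (mass_at M (\<lambda>x. \<phi> (f x)) u)))"
    using assms by (intro shannon_superset) auto
  then show ?thesis
    using sum_mass_at_compose[OF assms, of "\<lambda>u. ln (mass_at M (\<lambda>x. \<phi> (f x)) u)" \<phi>]
    by (simp add: sum_negf)
qed

lemma shannon_cong:
  assumes "\<And>x. x \<in> space M \<Longrightarrow> f x = g x"
  shows "shannon M f = shannon M g"
proof -
  have "mass_at M f = mass_at M g" unfolding mass_at_def
    using assms by (intro ext arg_cong[where f = "measure M"]) auto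
  moreover have "f ` space M = g ` space M" using assms by auto
  ultimately show ?thesis by (simp add: shannon_def)
qed

lemma factor_through:
  assumes "\<And>x y. x \<in> A \<Longrightarrow> y \<in> A \<Longrightarrow> f x = f y \<Longrightarrow> g x = g y"
  obtains \<phi> where "\<And>x. x \<in> A \<Longrightarrow> g x = \<phi> (f x)"
proof
  fix x assume x: "x \<in> A"
  have "(SOME y. y \<in> A \<and> f y = f x) \<in> A \<and> f (SOME y. y \<in> A \<and> f y = f x) = f x"
    by (rule someI[of _ x]) (use x in auto)
  then show "g x = (\<lambda>v. g (SOME y. y \<in> A \<and> f y = v)) (f x)"
    using assms x by metis
qed

text \<open>The coarser observable \<open>g\<close> gives each point at least the mass that \<open>f\<close> gives it. The hypothesis
  avoids naming the map that takes \<open>f\<close> to \<open>g\<close>.\<close>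

lemma shannon_mono:
  assumes "prob_space M" "simple_function M f"
    and "\<And>x y. x \<in> space M \<Longrightarrow> y \<in> space M \<Longrightarrow> f x = f y \<Longrightarrow> g x = g y"
  shows "shannon M g \<le> shannon M f"
proof -
  obtain \<phi> where \<phi>: "\<And>x. x \<in> space M \<Longrightarrow> g x = \<phi> (f x)"
    using factor_through[of "space M" f g] assms(3) by blast
  have fin: "finite (f ` space M)" using assms(2) by (rule simple_functionD)
  have "shannon M g = shannon M (\<lambda>x. \<phi> (f x))" by (rule shannon_cong) (use \<phi> in auto)
  also have "\<dots> = (\<Sum>v\<in>f ` space M. - (mass_at M f v * ln (mass_at M (\<lambda>x. \<phi> (f x)) (\<phi> v))))"
    using assms fin by (intro shannon_compose) auto
  also have "\<dots> \<le> shannon M f" unfolding shannon_def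
  proof (rule sum_mono)
    fix v
    have le: "mass_at M f v \<le> mass_at M (\<lambda>x. \<phi> (f x)) (\<phi> v)"
      using assms by (intro mass_at_le_compose)
    show "- (mass_at M f v * ln (mass_at M (\<lambda>x. \<phi> (f x)) (\<phi> v))) \<le> - (mass_at M f v * ln (mass_at M f v))"
    proof (cases "mass_at M f v = 0")
      case False
      then have "0 < mass_at M f v" using mass_at_nonneg[of M f v] by linarith
      then show ?thesis using le by (simp add: mult_left_mono)
    qed simp
  qed
  finally show ?thesis .
qed

lemma shannon_eqI:
  assumes "prob_space M" "simple_function M f" "simple_function M g"
    and "\<And>x y. x \<in> space M \<Longrightarrow> y \<in> space M \<Longrightarrow> f x = f y \<longleftrightarrow> g x = g y"
  shows "shannon M f = shannon M g"
  using assms by (intro antisym shannon_mono) auto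

text \<open>Conditioning on \<open>g\<close> leaves at most the uncertainty about \<open>f\<close> that conditioning on the coarser
  \<open>\<phi> \<circ> g\<close> leaves. This is Gibbs' inequality for the joint law of \<open>f\<close> and \<open>g\<close> against the law under which
  \<open>f\<close> and \<open>g\<close> are conditionally independent given \<open>\<phi> \<circ> g\<close>.\<close>

lemma shannon_strong_subadditive:
  assumes M: "prob_space M" and f: "simple_function M f" and g: "simple_function M g"
  shows "shannon M (\<lambda>x. (f x, g x)) + shannon M (\<lambda>x. \<phi> (g x))
    \<le> shannon M (\<lambda>x. (f x, \<phi> (g x))) + shannon M g"
proof -
  define A B S where "A = f ` space M" and "B = g ` space M" and "S = A \<times> B"
  have fin: "finite A" "finite B" "finite S"
    using simple_functionD(1)[OF f] simple_functionD(1)[OF g] by (auto simp: A_def B_def S_def)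
  have fg: "simple_function M (\<lambda>x. (f x, g x))" using f g by simp
  have sub: "(\<lambda>x. (f x, g x)) ` space M \<subseteq> S" by (auto simp: S_def A_def B_def)
  note * = M fg fin(3) sub
  define p where "p = mass_at M (\<lambda>x. (f x, g x))"
  define p1 where "p1 = (\<lambda>(a, b). mass_at M (\<lambda>x. (f x, \<phi> (g x))) (a, \<phi> b))"
  define p2 where "p2 = (\<lambda>(a::'b, b). mass_at M g b)"
  define p3 where "p3 = (\<lambda>(a::'b, b). mass_at M (\<lambda>x. \<phi> (g x)) (\<phi> b))"
  \<comment> \<open>The joint law under which \<open>f\<close> and \<open>g\<close> are conditionally independent given \<open>\<phi> \<circ> g\<close>.\<close>
  define q where "q = (\<lambda>s. p1 s * p2 s / p3 s)"
  have nn: "0 \<le> p1 s" "0 \<le> p2 s" "0 \<le> p3 s" "0 \<le> p s" for s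
    by (auto simp: p1_def p2_def p3_def p_def split: prod.splits)
  have le: "p s \<le> p1 s" "p s \<le> p2 s" "p s \<le> p3 s" for s
    using mass_at_le_compose[OF M fg, of s "\<lambda>(a, b). (a, \<phi> b)"]
      mass_at_le_compose[OF M fg, of s snd] mass_at_le_compose[OF M fg, of s "\<lambda>(a, b). \<phi> b"]
    by (auto simp: p1_def p2_def p3_def p_def split: prod.splits)
  have "sum q S \<le> 1"
  proof -
    have "sum q S = (\<Sum>b\<in>B. \<Sum>a\<in>A. q (a, b))"
      unfolding S_def using sum.cartesian_product[of "\<lambda>a b. q (a, b)" B A] by (simp add: sum.swap[of _ B A])
    also have "\<dots> \<le> (\<Sum>b\<in>B. mass_at M g b)"
    proof (rule sum_mono)
      fix b assume "b \<in> B"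
      let ?u = "mass_at M (\<lambda>x. \<phi> (g x)) (\<phi> b)"
      have f\<phi>: "simple_function M (\<lambda>x. (f x, \<phi> (g x)))"
        by (intro simple_function_Pair f simple_function_compose1[OF g])
      have "(\<Sum>a\<in>A. mass_at M (\<lambda>x. (f x, \<phi> (g x))) (a, \<phi> b))
          = (\<Sum>s\<in>{s\<in>A \<times> \<phi> ` B. snd s = \<phi> b}. mass_at M (\<lambda>x. (f x, \<phi> (g x))) s)"
        by (rule sum.reindex_bij_witness[where i = fst and j = "\<lambda>a. (a, \<phi> b)"])
          (use \<open>b \<in> B\<close> in auto)
      also have "\<dots> = ?u"
        using fin by (subst mass_at_compose[OF M f\<phi>, where \<phi> = snd and S = "A \<times> \<phi> ` B", symmetric])
          (auto simp: A_def B_def)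
      finally have eq: "(\<Sum>a\<in>A. mass_at M (\<lambda>x. (f x, \<phi> (g x))) (a, \<phi> b)) = ?u" .
      have "(\<Sum>a\<in>A. q (a, b)) = ?u * mass_at M g b / ?u"
        by (simp add: q_def p1_def p2_def p3_def flip: sum_distrib_right sum_divide_distrib eq)
      then show "(\<Sum>a\<in>A. q (a, b)) \<le> mass_at M g b" by simp
    qed
    also have "\<dots> = 1" using fin M g by (intro sum_mass_at) (auto simp: B_def)
    finally show ?thesis .
  qed
  moreover have "sum p S = 1" unfolding p_def by (rule sum_mass_at[OF *])
  moreover have "0 < q s" if "0 < p s" for s
    using le[of s] that by (auto simp: q_def intro!: divide_pos_pos mult_pos_pos)
  ultimately have "(\<Sum>s\<in>S. - (p s * ln (p s))) \<le> (\<Sum>s\<in>S. - (p s * ln (q s)))"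
    using fin nn by (intro gibbs_inequality) (auto simp: q_def)
  also have "\<dots> = (\<Sum>s\<in>S. - (p s * ln (p1 s)) + - (p s * ln (p2 s)) + p s * ln (p3 s))"
  proof (rule sum.cong)
    fix s
    show "- (p s * ln (q s)) = - (p s * ln (p1 s)) + - (p s * ln (p2 s)) + p s * ln (p3 s)"
    proof (cases "p s = 0")
      case False
      then have "0 < p s" using nn[of s] by simp
      then have "0 < p1 s" "0 < p2 s" "0 < p3 s" using le[of s] by auto
      then show ?thesis by (simp add: q_def ln_div ln_mult algebra_simps)
    qed simp
  qed simp
  also have "\<dots> = (\<Sum>s\<in>S. - (p s * ln (p1 s))) + (\<Sum>s\<in>S. - (p s * ln (p2 s))) - (\<Sum>s\<in>S. - (p s * ln (p3 s)))"
    by (simp add: sum.distrib sum_negf sum_subtractf)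
  also have "(\<Sum>s\<in>S. - (p s * ln (p1 s))) = shannon M (\<lambda>x. (f x, \<phi> (g x)))"
    using shannon_compose[OF *, of "\<lambda>(a, b). (a, \<phi> b)"]
    by (simp add: p_def p1_def split_def)
  also have "(\<Sum>s\<in>S. - (p s * ln (p2 s))) = shannon M g"
    using shannon_compose[OF *, of snd] by (simp add: p_def p2_def split_def)
  also have "(\<Sum>s\<in>S. - (p s * ln (p3 s))) = shannon M (\<lambda>x. \<phi> (g x))"
    using shannon_compose[OF *, of "\<lambda>(a, b). \<phi> b"] by (simp add: p_def p3_def split_def)
  also have "(\<Sum>s\<in>S. - (p s * ln (p s))) = shannon M (\<lambda>x. (f x, g x))"
    unfolding p_def using fin sub by (intro shannon_superset[symmetric])
  finally show ?thesis by simp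
qed

lemma shannon_const: "prob_space M \<Longrightarrow> shannon M (\<lambda>x. c) = 0"
proof -
  assume "prob_space M"
  then interpret prob_space M .
  have "(\<lambda>x. c) ` space M = {c}" using not_empty by auto
  then show ?thesis using prob_space by (simp add: shannon_def mass_at_def)
qed

lemma shannon_subadditive:
  assumes "prob_space M" "simple_function M f" "simple_function M g"
  shows "shannon M (\<lambda>x. (f x, g x)) \<le> shannon M f + shannon M g"
proof -
  have "shannon M (\<lambda>x. (f x, ())) = shannon M f"
    using assms by (intro shannon_eqI) auto
  then show ?thesis
    using shannon_strong_subadditive[OF assms, of "\<lambda>_. ()"] shannon_const[OF assms(1), of "()"] by linarith
qed

lemma shannon_nonneg:
  assumes "prob_space M"
  shows "0 \<le> shannon M f"
  unfolding shannon_def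
proof (rule sum_nonneg)
  fix v
  have "ln (mass_at M f v) \<le> 0"
    using mass_at_le_1[OF assms, of f v] mass_at_nonneg[of M f v]
    by (cases "mass_at M f v = 0") (auto simp: less_le)
  then show "0 \<le> - (mass_at M f v * ln (mass_at M f v))"
    by (simp add: mult_nonneg_nonpos)
qed

lemma shannon_distr:
  assumes "T \<in> measurable M K" "simple_function K f"
  shows "shannon (distr M K T) f = shannon M (\<lambda>x. f (T x))"
proof -
  have "mass_at (distr M K T) f v = mass_at M (\<lambda>x. f (T x)) v" for v
  proof -
    have "T -` (f -` {v} \<inter> space K) \<inter> space M = (\<lambda>x. f (T x)) -` {v} \<inter> space M"
      using measurable_space[OF assms(1)] by auto
    then show ?thesis
      using simple_functionD(2)[OF assms(2)] assms(1) by (simp add: mass_at_def measure_distr)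
  qed
  moreover have "shannon M (\<lambda>x. f (T x)) = (\<Sum>v\<in>f ` space K.
      - (mass_at M (\<lambda>x. f (T x)) v * ln (mass_at M (\<lambda>x. f (T x)) v)))"
    using simple_functionD(1)[OF assms(2)] measurable_space[OF assms(1)]
    by (intro shannon_superset) auto
  ultimately show ?thesis by (simp add: shannon_def)
qed

text \<open>By Gibbs' inequality the entropy under each \<open>\<mu> j\<close> is at most its cross entropy against the average,
  and the cross entropy is linear in its first argument.\<close>

lemma shannon_concave:
  assumes fin: "finite J" "J \<noteq> {}"
    and m: "\<And>j. j \<in> J \<Longrightarrow> prob_space (\<mu> j)" "\<And>j. j \<in> J \<Longrightarrow> sets (\<mu> j) = sets M"
    and M: "prob_space M"
    and avg: "\<And>A. A \<in> sets M \<Longrightarrow> measure M A = (\<Sum>j\<in>J. measure (\<mu> j) A) / card J"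
    and f: "simple_function M f"
  shows "(\<Sum>j\<in>J. shannon (\<mu> j) f) / card J \<le> shannon M f"
proof -
  have sp: "space (\<mu> j) = space M" if "j \<in> J" for j using m(2)[OF that] by (rule sets_eq_imp_space_eq)
  let ?S = "f ` space M"
  have finS: "finite ?S" using f by (rule simple_functionD)
  have fj: "simple_function (\<mu> j) f" if "j \<in> J" for j
    using f m(2)[OF that] sp[OF that] simple_function_cong_algebra by metis
  have c: "0 < real (card J)" using fin by (simp add: card_gt_0_iff)
  have p: "mass_at M f v = (\<Sum>j\<in>J. mass_at (\<mu> j) f v) / card J" for v
    using simple_functionD(2)[OF f] sp by (simp add: mass_at_def avg)
  have "shannon (\<mu> j) f \<le> (\<Sum>v\<in>?S. - (mass_at (\<mu> j) f v * ln (mass_at M f v)))" if "j \<in> J" for j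
  proof -
    have "0 < mass_at M f v" if "0 < mass_at (\<mu> j) f v" for v
    proof -
      have "mass_at (\<mu> j) f v \<le> (\<Sum>j\<in>J. mass_at (\<mu> j) f v)"
        using fin \<open>j \<in> J\<close> by (intro member_le_sum) auto
      then show ?thesis unfolding p using that c by simp
    qed
    moreover have "sum (mass_at M f) ?S = sum (mass_at (\<mu> j) f) ?S"
      using sum_mass_at[OF M f finS] sum_mass_at[OF m(1) fj finS] that sp by simp
    ultimately show ?thesis
      unfolding shannon_def using that sp finS by (simp, intro gibbs_inequality) auto
  qed
  then have "(\<Sum>j\<in>J. shannon (\<mu> j) f) \<le> (\<Sum>j\<in>J. \<Sum>v\<in>?S. - (mass_at (\<mu> j) f v * ln (mass_at M f v)))"
    by (rule sum_mono)
  also have "\<dots> = (\<Sum>v\<in>?S. - (card J * (mass_at M f v) * ln (mass_at M f v)))"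
    using c by (subst sum.swap) (simp add: p sum_negf sum_distrib_right)
  also have "\<dots> = card J * shannon M f"
    unfolding shannon_def by (simp add: sum_distrib_left algebra_simps sum_negf)
  finally show ?thesis using c by (simp add: field_simps)
qed

lemma (in prob_space) entropy_eq_shannon:
  assumes "simple_function M f"
  shows "entropy (exp 1) (count_space (f ` space M)) f = shannon M f"
proof -
  interpret information_space M "exp 1" by standard simp
  have "simple_distributed M f (mass_at M f)"
    using assms by (intro simple_distributedI) (auto simp: mass_at_def)
  then show ?thesis
    by (subst entropy_simple_distributed) (auto simp: shannon_def sum_negf log_def)
qed

section \<open>Entropy of measure-preserving maps\<close>

text \<open>The limit is the infimum \<open>L\<close> of the quotients: if \<open>a m / m\<close> is near \<open>L\<close>, division of \<open>n\<close> by \<open>m\<close>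
  with remainder bounds \<open>a n / n\<close> by \<open>a m / m\<close> up to a term of order \<open>1 / n\<close>.\<close>

lemma fekete:
  fixes a :: "nat \<Rightarrow> real"
  assumes sub: "\<And>m n. a (m + n) \<le> a m + a n" and nn: "\<And>n. 0 \<le> a n"
  shows "convergent (\<lambda>n. a n / n)"
proof -
  define L where "L = (INF n\<in>{1..}. a n / real n)"
  have bdd: "bdd_below ((\<lambda>n. a n / real n) ` {1..})"
    using nn by (intro bdd_belowI[of _ 0]) auto
  have mult: "a (q * m + r) \<le> q * a m + a r" for q m r
  proof (induction q)
    case (Suc q)
    then show ?case using sub[of m "q * m + r"] by (simp add: algebra_simps)
  qed simp
  have "(\<lambda>n. a n / n) \<longlonglongrightarrow> L"
  proof (rule LIMSEQ_I)
    fix e :: real assume "0 < e"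
    then have "L < L + e / 2" by simp
    then obtain m where m: "m \<ge> 1" "a m / m < L + e / 2"
      unfolding L_def using bdd by (subst (asm) cINF_less_iff) auto
    define C where "C = (\<Sum>r<m. a r)"
    have C: "a r \<le> C" if "r < m" for r
      unfolding C_def using that nn by (intro member_le_sum) auto
    obtain N :: nat where N: "2 * C / e < N" using reals_Archimedean2 by blast
    have "norm (a n / n - L) < e" if n: "n \<ge> max 1 N" for n
    proof -
      have pos: "0 < real n" "0 < real m" using n m by auto
      have "L \<le> a n / n" unfolding L_def using bdd n by (intro cINF_lower) auto
      moreover have "a n / n < L + e"
      proof -
        have "a n \<le> real (n div m) * a m + a (n mod m)"
          using mult[of "n div m" m "n mod m"] by simp
        also have "\<dots> \<le> (real n / m) * a m + C"
          using nn m C by (intro add_mono mult_right_mono) (auto simp: of_nat_div_le_of_nat)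
        finally have "a n / n \<le> ((real n / m) * a m + C) / n"
          using pos by (intro divide_right_mono) auto
        also have "\<dots> = a m / m + C / n" using pos by (simp add: field_simps)
        also have "C / n < e / 2"
        proof -
          have "2 * C / e < n" using N n by linarith
          then show ?thesis using pos \<open>0 < e\<close> by (simp add: field_simps)
        qed
        finally show ?thesis using m by simp
      qed
      ultimately show ?thesis by simp
    qed
    then show "\<exists>no. \<forall>n\<ge>no. norm (a n / n - L) < e" by blast
  qed
  then show ?thesis by (rule convergentI)
qed

lemma itinerary_eq_iff:
  "itinerary T f n x = itinerary T f n y \<longleftrightarrow> (\<forall>i<n. f ((T ^^ i) x) = f ((T ^^ i) y))"
  by (auto simp: itinerary_def)

lemma shannon_tuple_le:
  assumes M: "prob_space M" and "finite V" and h: "\<And>v. v \<in> V \<Longrightarrow> simple_function M (h v)"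
  shows "shannon M (\<lambda>x. \<lambda>v\<in>V. h v x) \<le> (\<Sum>v\<in>V. shannon M (h v)) \<and> simple_function M (\<lambda>x. \<lambda>v\<in>V. h v x)"
  using assms(2) h
proof (induction V)
  case empty
  then show ?case by (simp add: shannon_const[OF M])
next
  case (insert v V)
  let ?t = "\<lambda>x. \<lambda>u\<in>V. h u x"
  have IH: "shannon M ?t \<le> (\<Sum>u\<in>V. shannon M (h u))" "simple_function M ?t"
    using insert by blast+
  have v: "simple_function M (h v)" using insert.prems by simp
  have f: "simple_function M (\<lambda>x. (h v x, ?t x))"
    using v IH(2) by (rule simple_function_Pair)
  have ext: "(\<lambda>u\<in>insert v V. h u x) = (?t x)(v := h v x)" for x
    by (auto simp: fun_eq_iff)
  have "shannon M (\<lambda>x. \<lambda>u\<in>insert v V. h u x) \<le> shannon M (\<lambda>x. (h v x, ?t x))"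
    unfolding ext using M f by (rule shannon_mono) auto
  also have "\<dots> \<le> shannon M (h v) + shannon M ?t"
    using M v IH(2) by (rule shannon_subadditive)
  finally have "shannon M (\<lambda>x. \<lambda>u\<in>insert v V. h u x) \<le> (\<Sum>u\<in>insert v V. shannon M (h u))"
    using insert IH by simp
  moreover have "simple_function M (\<lambda>x. \<lambda>u\<in>insert v V. h u x)"
    unfolding ext by (rule simple_function_compose2[OF v IH(2)])
  ultimately show ?case by blast
qed

text \<open>The entropy of an event of small probability is small. Only the convergence to \<open>0\<close> matters;
  the square root comes from \<open>- ln d = 2 ln (1 / sqrt d)\<close> and \<open>ln t \<le> t - 1\<close>.\<close>

lemma shannon_event_le:
  assumes M: "prob_space M" and D: "D \<in> sets M"
  shows "shannon M (\<lambda>x. x \<in> D) \<le> 3 * sqrt (measure M D)"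
proof -
  interpret prob_space M by fact
  define d where "d = measure M D"
  have d: "0 \<le> d" "d \<le> 1" by (auto simp: d_def)
  have "(\<lambda>x. x \<in> D) -` {True} \<inter> space M = D" "(\<lambda>x. x \<in> D) -` {False} \<inter> space M = space M - D"
    using sets.sets_into_space[OF D] by auto
  then have eq: "shannon M (\<lambda>x. x \<in> D) = - (d * ln d) + - ((1 - d) * ln (1 - d))"
    using shannon_superset[of UNIV "\<lambda>x. x \<in> D" M, OF finite_class.finite_UNIV subset_UNIV] prob_compl[OF D]
    by (simp add: UNIV_bool mass_at_def d_def)
  have "- (d * ln d) \<le> 2 * sqrt d"
  proof (cases "d = 0")
    case False
    then have pos: "0 < sqrt d" "0 < d" using d by auto
    have "ln (1 / sqrt d) \<le> 1 / sqrt d" using pos ln_le_minus_one[of "1 / sqrt d"] by simp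
    then have "- ln d \<le> 2 / sqrt d" using pos by (simp add: ln_div ln_sqrt)
    then have "d * (- ln d) \<le> d * (2 / sqrt d)" using d by (intro mult_left_mono) auto
    also have "\<dots> = 2 * (d / sqrt d)" by simp
    also have "\<dots> = 2 * sqrt d" using d by (simp only: real_div_sqrt)
    finally show ?thesis by simp
  qed simp
  moreover have "- ((1 - d) * ln (1 - d)) \<le> d"
  proof (cases "d = 1")
    case False
    then have pos: "0 < 1 - d" using d by auto
    have "ln (1 / (1 - d)) \<le> 1 / (1 - d) - 1" using pos by (intro ln_le_minus_one) auto
    then have "- ln (1 - d) \<le> d / (1 - d)" using pos by (simp add: ln_div field_simps)
    then have "(1 - d) * (- ln (1 - d)) \<le> (1 - d) * (d / (1 - d))" using pos by (intro mult_left_mono) auto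
    then show ?thesis using pos by simp
  qed simp
  moreover have "d \<le> sqrt d"
  proof -
    have "sqrt d \<le> 1" using d by simp
    then have "sqrt d * sqrt d \<le> sqrt d * 1" using d by (intro mult_left_mono) auto
    then show ?thesis using d by simp
  qed
  ultimately show ?thesis unfolding eq by (simp flip: d_def)
qed

text \<open>The events that the algebra approximates are closed under complements and, by continuity of the
  measure along finite partial unions, under countable unions.\<close>

lemma approximate_by_algebra:
  assumes M: "prob_space M" and alg: "algebra (space M) \<A>" and sub: "\<A> \<subseteq> sets M"
    and A: "A \<in> sigma_sets (space M) \<A>"
  shows "\<forall>e>0. \<exists>B\<in>\<A>. measure M ((A - B) \<union> (B - A)) < e"
proof -
  interpret prob_space M by fact
  interpret alg: algebra "space M" \<A> by fact
  have in_M: "S \<in> sets M" if "S \<in> sigma_sets (space M) \<A>" for S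
    using that sub sets.sigma_sets_subset by blast
  from A show ?thesis
  proof (induction rule: sigma_sets.induct)
    case (Basic a)
    then show ?case by (intro allI impI bexI[of _ a]) auto
  next
    case Empty
    then show ?case by (intro allI impI bexI[of _ "{}"]) auto
  next
    case (Compl a)
    show ?case
    proof (intro allI impI)
      fix e :: real assume "0 < e"
      then obtain B where B: "B \<in> \<A>" "measure M ((a - B) \<union> (B - a)) < e" using Compl by blast
      have "(space M - a - (space M - B)) \<union> (space M - B - (space M - a)) = (a - B) \<union> (B - a)"
        using in_M[OF Compl(1), THEN sets.sets_into_space] B(1) alg.space_closed by auto
      then show "\<exists>B\<in>\<A>. measure M ((space M - a - B) \<union> (B - (space M - a))) < e"
        using B by (intro bexI[of _ "space M - B"]) auto
    qed
  next
    case (Union a)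
    have am: "a i \<in> sets M" for i using in_M Union by blast
    show ?case
    proof (intro allI impI)
      fix e :: real assume e: "0 < e"
      let ?U = "\<lambda>n. \<Union>i<n. a i"
      have "(\<lambda>n. measure M (?U n)) \<longlonglongrightarrow> measure M (\<Union>n. ?U n)"
        using am by (intro finite_Lim_measure_incseq) (auto simp: incseq_def, force)
      also have "(\<Union>n. ?U n) = (\<Union>i. a i)" by auto
      finally obtain n where n: "\<bar>measure M (?U n) - measure M (\<Union>i. a i)\<bar> < e / 2"
        using e LIMSEQ_D[of _ _ "e / 2"] by (metis half_gt_zero order_refl real_norm_def)
      have n2: "measure M ((\<Union>i. a i) - ?U n) < e / 2"
      proof -
        have "measure M ((\<Union>i. a i) - ?U n) = measure M (\<Union>i. a i) - measure M (?U n)"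
          using am by (intro finite_measure_Diff) auto
        then show ?thesis using n by argo
      qed
      define e' where "e' = e / (2 * (real n + 1))"
      have e': "0 < e'" "n * e' < e / 2" using e by (auto simp: e'_def field_simps)
      have "\<forall>i. \<exists>B\<in>\<A>. measure M ((a i - B) \<union> (B - a i)) < e'" using Union.IH e' by blast
      then obtain B where B: "\<And>i. B i \<in> \<A>" "\<And>i. measure M ((a i - B i) \<union> (B i - a i)) < e'" by metis
      have Bm: "B i \<in> sets M" for i using B sub by auto
      let ?B = "\<Union>i<n. B i"
      have "measure M (((\<Union>i. a i) - ?B) \<union> (?B - (\<Union>i. a i)))
          \<le> measure M (((\<Union>i. a i) - ?U n) \<union> (\<Union>i<n. (a i - B i) \<union> (B i - a i)))"
        using am Bm by (intro finite_measure_mono) auto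
      also have "\<dots> \<le> measure M ((\<Union>i. a i) - ?U n) + measure M (\<Union>i<n. (a i - B i) \<union> (B i - a i))"
        using am Bm by (intro measure_Un_le) auto
      also have "measure M (\<Union>i<n. (a i - B i) \<union> (B i - a i)) \<le> (\<Sum>i<n. measure M ((a i - B i) \<union> (B i - a i)))"
        using am Bm by (intro finite_measure_subadditive_finite) auto
      also have "\<dots> \<le> (\<Sum>i<n. e')" using B by (intro sum_mono less_imp_le) auto
      finally have "measure M (((\<Union>i. a i) - ?B) \<union> (?B - (\<Union>i. a i))) < e" using n2 e' by simp
      moreover have "?B \<in> \<A>" using B by (intro alg.finite_UN) auto
      ultimately show "\<exists>B\<in>\<A>. measure M (((\<Union>i. a i) - B) \<union> (B - (\<Union>i. a i))) < e" by blast
    qed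
  qed
qed

locale measure_preserving_map = prob_space M for M :: "'x measure" +
  fixes T :: "'x \<Rightarrow> 'x"
  assumes T_measurable: "T \<in> measurable M M" and T_invariant: "distr M M T = M"
begin

lemma prob_space_M: "prob_space M"
  by (rule prob_space_axioms)

lemma funpow_measurable: "T ^^ n \<in> measurable M M"
proof (induction n)
  case (Suc n)
  then show ?case using measurable_comp[OF Suc T_measurable] by (simp only: funpow.simps)
qed (simp add: id_def)

lemma funpow_space: "x \<in> space M \<Longrightarrow> (T ^^ n) x \<in> space M"
  using measurable_space[OF funpow_measurable] .

lemma funpow_invariant: "distr M M (T ^^ n) = M"
proof (induction n)
  case (Suc n)
  have "distr M M (T ^^ Suc n) = distr (distr M M (T ^^ n)) M T"
    using T_measurable funpow_measurable by (simp add: distr_distr)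
  then show ?case using Suc T_invariant by (simp only:)
qed (simp add: distr_id id_def)

lemma simple_function_funpow:
  assumes "simple_function M f"
  shows "simple_function M (\<lambda>x. f ((T ^^ n) x))"
  unfolding simple_function_eq_measurable
proof
  show "finite ((\<lambda>x. f ((T ^^ n) x)) ` space M)"
    using funpow_space by (intro finite_subset[OF _ simple_functionD(1)[OF assms]]) auto
  show "(\<lambda>x. f ((T ^^ n) x)) \<in> measurable M (count_space UNIV)"
    by (rule measurable_compose[OF funpow_measurable measurable_simple_function[OF assms]])
qed

lemma simple_function_itinerary:
  assumes "simple_function M f"
  shows "simple_function M (itinerary T f n)"
proof (induction n)
  case (Suc n)
  have "itinerary T f (Suc n) = (\<lambda>x. itinerary T f n x @ [f ((T ^^ n) x)])"
    by (auto simp: itinerary_def)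
  then show ?case
    using simple_function_compose2[OF Suc simple_function_funpow[OF assms], of "\<lambda>a b. a @ [b]"] by simp
qed (simp add: itinerary_def)

lemma shannon_funpow:
  assumes "simple_function M f"
  shows "shannon M (\<lambda>x. f ((T ^^ n) x)) = shannon M f"
  using shannon_distr[OF funpow_measurable assms, of n] by (simp add: funpow_invariant)

lemma shannon_itinerary_add:
  assumes f: "simple_function M f"
  shows "shannon M (itinerary T f (m + n)) \<le> shannon M (itinerary T f m) + shannon M (itinerary T f n)"
proof -
  note s = simple_function_itinerary[OF f]
  have "shannon M (itinerary T f (m + n)) \<le> shannon M (\<lambda>x. (itinerary T f m x, itinerary T f n ((T ^^ m) x)))"
  proof (rule shannon_mono[OF prob_space_M])
    show "simple_function M (\<lambda>x. (itinerary T f m x, itinerary T f n ((T ^^ m) x)))"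
      using s simple_function_funpow[OF s] by auto
    fix x y
    assume eq: "(itinerary T f m x, itinerary T f n ((T ^^ m) x)) = (itinerary T f m y, itinerary T f n ((T ^^ m) y))"
    show "itinerary T f (m + n) x = itinerary T f (m + n) y"
      unfolding itinerary_eq_iff
    proof (intro allI impI)
      fix i assume "i < m + n"
      show "f ((T ^^ i) x) = f ((T ^^ i) y)"
      proof (cases "i < m")
        case False
        then have "f ((T ^^ (i - m)) ((T ^^ m) x)) = f ((T ^^ (i - m)) ((T ^^ m) y))"
          using eq \<open>i < m + n\<close> by (auto simp: itinerary_eq_iff)
        then show ?thesis using False by (simp flip: funpow_add[THEN fun_cong, simplified])
      qed (use eq in \<open>auto simp: itinerary_eq_iff\<close>)
    qed
  qed
  also have "\<dots> \<le> shannon M (itinerary T f m) + shannon M (\<lambda>x. itinerary T f n ((T ^^ m) x))"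
    using prob_space_M s simple_function_funpow[OF s] by (intro shannon_subadditive) auto
  finally show ?thesis using shannon_funpow[OF s] by simp
qed

lemma shannon_itinerary_le:
  assumes f: "simple_function M f"
  shows "shannon M (itinerary T f n) \<le> n * shannon M f"
proof (induction n)
  case 0
  then show ?case by (simp add: itinerary_def shannon_const[OF prob_space_M])
next
  case (Suc n)
  have "shannon M (itinerary T f 1) = shannon M f"
    using prob_space_M simple_function_itinerary[OF f] f
    by (intro shannon_eqI) (auto simp: itinerary_def)
  then show ?case using Suc shannon_itinerary_add[OF f, of n 1] by (simp add: algebra_simps)
qed

text \<open>The definition takes a \<open>lim\<close>, which has a meaning only because the entropies of the joins are
  subadditive.\<close>

lemma partition_entropy_limit:
  assumes f: "simple_function M f"
  shows "(\<lambda>n. shannon M (itinerary T f n) / n) \<longlonglongrightarrow> partition_entropy M T f"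
proof -
  have "convergent (\<lambda>n. shannon M (itinerary T f n) / n)"
    using shannon_itinerary_add[OF f] shannon_nonneg[OF prob_space_M] by (intro fekete)
  then show ?thesis
    unfolding partition_entropy_def entropy_eq_shannon[OF simple_function_itinerary[OF f]]
    by (simp add: convergent_LIMSEQ_iff)
qed

text \<open>The \<open>f\<close>-itinerary of length \<open>n\<close> started at time \<open>k\<close> is determined by the \<open>g\<close>-itinerary of length
  \<open>n + d\<close> together with the \<open>h\<close>-itinerary of length \<open>n\<close>. The \<open>d\<close> additional observations disappear
  in the limit, and \<open>h\<close> costs at most its entropy per step.\<close>

lemma partition_entropy_le_approx:
  fixes h :: "'x \<Rightarrow> 'h"
  assumes f: "simple_function M f" and g: "simple_function M g" and h: "simple_function M h"
    and det: "\<And>x y. x \<in> space M \<Longrightarrow> y \<in> space M \<Longrightarrow> itinerary T g d x = itinerary T g d y \<Longrightarrow>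
      h x = h y \<Longrightarrow> f ((T ^^ k) x) = f ((T ^^ k) y)"
  shows "partition_entropy M T f \<le> partition_entropy M T g + shannon M h"
proof -
  let ?H = "shannon M"
  note s = simple_function_itinerary
  have *: "?H (itinerary T f n) \<le> ?H (itinerary T g n) + ?H (itinerary T g d) + n * ?H h" for n
  proof -
    have "?H (itinerary T f n) = ?H (\<lambda>x. itinerary T f n ((T ^^ k) x))"
      by (rule shannon_funpow[OF s[OF f], symmetric])
    also have "\<dots> \<le> ?H (\<lambda>x. (itinerary T g (n + d) x, itinerary T h n x))"
    proof (rule shannon_mono[OF prob_space_M])
      show "simple_function M (\<lambda>x. (itinerary T g (n + d) x, itinerary T h n x))"
        using s[OF g] s[OF h] by auto
      fix x y assume xy: "x \<in> space M" "y \<in> space M"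
        and eq: "(itinerary T g (n + d) x, itinerary T h n x) = (itinerary T g (n + d) y, itinerary T h n y)"
      show "itinerary T f n ((T ^^ k) x) = itinerary T f n ((T ^^ k) y)"
        unfolding itinerary_eq_iff
      proof (intro allI impI)
        fix i assume i: "i < n"
        have "itinerary T g d ((T ^^ i) x) = itinerary T g d ((T ^^ i) y)"
          unfolding itinerary_eq_iff
        proof (intro allI impI)
          fix j assume "j < d"
          then have "g ((T ^^ (j + i)) x) = g ((T ^^ (j + i)) y)"
            using eq i by (auto simp: itinerary_eq_iff)
          then show "g ((T ^^ j) ((T ^^ i) x)) = g ((T ^^ j) ((T ^^ i) y))"
            by (simp add: funpow_add)
        qed
        moreover have "h ((T ^^ i) x) = h ((T ^^ i) y)"
          using eq i by (auto simp: itinerary_eq_iff)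
        ultimately have "f ((T ^^ (k + i)) x) = f ((T ^^ (k + i)) y)"
          using det[OF funpow_space[OF xy(1)] funpow_space[OF xy(2)], of i i] by (simp add: funpow_add)
        then show "f ((T ^^ i) ((T ^^ k) x)) = f ((T ^^ i) ((T ^^ k) y))"
          by (simp add: add.commute[of k i] funpow_add)
      qed
    qed
    also have "\<dots> \<le> ?H (itinerary T g (n + d)) + ?H (itinerary T h n)"
      using prob_space_M s[OF g] s[OF h] by (rule shannon_subadditive)
    finally show ?thesis
      using shannon_itinerary_add[OF g, of n d] shannon_itinerary_le[OF h, of n] by linarith
  qed
  have "?H (itinerary T f n) / n \<le> ?H (itinerary T g n) / n + ?H (itinerary T g d) / n + ?H h"
    if "n > 0" for n
  proof -
    have "?H (itinerary T f n) / n \<le> (?H (itinerary T g n) + ?H (itinerary T g d) + n * ?H h) / n"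
      using * by (intro divide_right_mono) auto
    then show ?thesis using that by (simp add: add_divide_distrib)
  qed
  moreover have "(\<lambda>n. ?H (itinerary T g n) / n + ?H (itinerary T g d) / n + ?H h)
      \<longlonglongrightarrow> partition_entropy M T g + 0 + ?H h"
    by (intro tendsto_intros partition_entropy_limit[OF g] lim_const_over_n)
  ultimately show ?thesis
    using LIMSEQ_le[OF partition_entropy_limit[OF f], of _ "partition_entropy M T g + 0 + ?H h"]
    by (simp add: Suc_le_eq) (metis (no_types, lifting) Suc_le_eq)
qed

text \<open>The \<open>2k\<close> observations surround the time \<open>k\<close>, so that the past becomes visible without an inverse
  of \<open>T\<close>. Requiring the condition for all large \<open>k\<close> makes the family closed under unions.\<close>

definition observable_events :: "('x \<Rightarrow> 'c) \<Rightarrow> 'x set set" where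
  "observable_events g = {B \<in> sets M. \<forall>\<^sub>F k in sequentially. \<forall>x\<in>space M. \<forall>y\<in>space M.
     itinerary T g (2 * k) x = itinerary T g (2 * k) y \<longrightarrow> ((T ^^ k) x \<in> B \<longleftrightarrow> (T ^^ k) y \<in> B)}"

lemma algebra_observable_events: "algebra (space M) (observable_events g)"
  unfolding algebra_iff_Un
proof (intro conjI ballI)
  show "observable_events g \<subseteq> Pow (space M)"
    using sets.sets_into_space by (auto simp: observable_events_def)
  show "{} \<in> observable_events g" by (auto simp: observable_events_def)
  fix A assume A: "A \<in> observable_events g"
  then show "space M - A \<in> observable_events g"
    using funpow_space by (auto simp: observable_events_def elim: eventually_mono)
  fix B assume B: "B \<in> observable_events g"
  let ?det = "\<lambda>C k. \<forall>x\<in>space M. \<forall>y\<in>space M. itinerary T g (2 * k) x = itinerary T g (2 * k) y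
    \<longrightarrow> ((T ^^ k) x \<in> C \<longleftrightarrow> (T ^^ k) y \<in> C)"
  have "\<forall>\<^sub>F k in sequentially. ?det A k" "\<forall>\<^sub>F k in sequentially. ?det B k"
    using A B by (simp_all add: observable_events_def)
  then have "\<forall>\<^sub>F k in sequentially. ?det (A \<union> B) k"
    by eventually_elim blast
  then show "A \<union> B \<in> observable_events g"
    using A B unfolding observable_events_def by auto
qed

text \<open>Each cell of \<open>f\<close> is close to an observable event. The observable \<open>h\<close> records, for every cell,
  whether the point lies in the symmetric difference; it has small entropy, and together with finitely
  many observations of \<open>g\<close> it determines \<open>f\<close>.\<close>

theorem kolmogorov_sinai_generator:
  assumes f: "simple_function M f" and g: "simple_function M g"
    and gen: "sets M = sigma_sets (space M) (observable_events g)"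
  shows "partition_entropy M T f \<le> partition_entropy M T g"
proof (rule field_le_epsilon)
  fix e :: real assume e: "0 < e"
  let ?V = "f ` space M"
  let ?D = "\<lambda>v B. (f -` {v} \<inter> space M - B) \<union> (B - f -` {v} \<inter> space M)"
  have fin: "finite ?V" using f by (rule simple_functionD)
  \<comment> \<open>Chosen such that at most \<open>card ?V\<close> terms \<open>3 * sqrt e'\<close> add up to at most \<open>e\<close>.\<close>
  define e' where "e' = (e / (3 * (card ?V + 1)))\<^sup>2"
  have e': "0 < e'" using e by (auto simp: e'_def)
  have "\<exists>B\<in>observable_events g. measure M (?D v B) < e'" for v
  proof -
    have "f -` {v} \<inter> space M \<in> sigma_sets (space M) (observable_events g)"
      using f unfolding gen[symmetric] by (rule simple_functionD)
    then show ?thesis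
      using approximate_by_algebra[OF prob_space_M algebra_observable_events, of g] e'
      by (auto simp: observable_events_def)
  qed
  then obtain B where B: "\<And>v. B v \<in> observable_events g" "\<And>v. measure M (?D v (B v)) < e'" by metis
  have "\<forall>\<^sub>F k in sequentially. \<forall>v\<in>?V. \<forall>x\<in>space M. \<forall>y\<in>space M.
     itinerary T g (2 * k) x = itinerary T g (2 * k) y \<longrightarrow> ((T ^^ k) x \<in> B v \<longleftrightarrow> (T ^^ k) y \<in> B v)"
    using fin B(1) by (intro eventually_ball_finite) (auto simp: observable_events_def)
  then obtain k where k: "\<And>v x y. v \<in> ?V \<Longrightarrow> x \<in> space M \<Longrightarrow> y \<in> space M \<Longrightarrow>
      itinerary T g (2 * k) x = itinerary T g (2 * k) y \<Longrightarrow> ((T ^^ k) x \<in> B v \<longleftrightarrow> (T ^^ k) y \<in> B v)"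
    unfolding eventually_sequentially by blast
  define h where "h = (\<lambda>x. \<lambda>v\<in>?V. x \<in> ?D v (B v))"
  have Dm: "?D v (B v) \<in> sets M" for v
    using B(1) simple_functionD(2)[OF f] by (auto simp: observable_events_def)
  have ind: "simple_function M (\<lambda>x. x \<in> ?D v (B v))" for v
    unfolding simple_function_eq_measurable
    using pred_sets2[OF Dm measurable_ident] by (auto intro: finite_subset[OF subset_UNIV])
  have h: "shannon M h \<le> (\<Sum>v\<in>?V. shannon M (\<lambda>x. x \<in> ?D v (B v)))" "simple_function M h"
    using shannon_tuple_le[OF prob_space_M fin, of "\<lambda>v x. x \<in> ?D v (B v)"] ind by (auto simp: h_def)
  have "shannon M h \<le> (\<Sum>v\<in>?V. e / (card ?V + 1))"
  proof (rule order_trans[OF h(1)], rule sum_mono)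
    fix v
    have "shannon M (\<lambda>x. x \<in> ?D v (B v)) \<le> 3 * sqrt (measure M (?D v (B v)))"
      using prob_space_M Dm by (rule shannon_event_le)
    also have "\<dots> \<le> 3 * sqrt e'" using B(2)[of v] by simp
    also have "\<dots> = e / (card ?V + 1)" using e unfolding e'_def real_sqrt_abs by (simp add: field_simps)
    finally show "shannon M (\<lambda>x. x \<in> ?D v (B v)) \<le> e / (card ?V + 1)" .
  qed
  also have "\<dots> \<le> e" using e by (simp add: field_simps)
  finally have small: "shannon M h \<le> e" .
  have "partition_entropy M T f \<le> partition_entropy M T g + shannon M (\<lambda>x. h ((T ^^ k) x))"
  proof (rule partition_entropy_le_approx[OF f g simple_function_funpow[OF h(2)], of "2 * k" k k])
    fix x y assume xy: "x \<in> space M" "y \<in> space M"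
      and eq: "itinerary T g (2 * k) x = itinerary T g (2 * k) y" "h ((T ^^ k) x) = h ((T ^^ k) y)"
    let ?v = "f ((T ^^ k) x)"
    have v: "?v \<in> ?V" using funpow_space[OF xy(1)] by auto
    have "h ((T ^^ k) x) ?v = h ((T ^^ k) y) ?v" using eq by simp
    then have "(T ^^ k) x \<in> ?D ?v (B ?v) \<longleftrightarrow> (T ^^ k) y \<in> ?D ?v (B ?v)"
      unfolding h_def using v by simp
    then show "f ((T ^^ k) x) = f ((T ^^ k) y)"
      using k[OF v xy eq(1)] funpow_space[OF xy(1)] funpow_space[OF xy(2)] by auto
  qed
  then show "partition_entropy M T f \<le> partition_entropy M T g + e"
    using small shannon_funpow[OF h(2)] by simp
qed

end

section \<open>Invariant measures on shift spaces\<close>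

definition translate :: "int \<Rightarrow> (int \<Rightarrow> 'a) \<Rightarrow> (int \<Rightarrow> 'a)" where
  "translate j x = (\<lambda>i. x (i + j))"

lemma funpow_shift: "shift ^^ n = translate (int n)"
proof (induction n)
  case (Suc n)
  then show ?case by (simp add: translate_def shift_def fun_eq_iff algebra_simps)
qed (simp add: translate_def fun_eq_iff)

lemma topspace_shift_topology [simp]: "topspace (shift_topology X) = X"
  by (simp add: shift_topology_def)

lemma space_borel_shift [simp]: "space (borel_shift X) = X"
  unfolding borel_shift_def
  by (intro space_measure_of) (use openin_subset[of "shift_topology X"] in auto)

lemma finite_configurations:
  assumes "finite (alphabet X)" "finite S"
  shows "finite (configurations X S)"
  by (rule finite_subset[OF _ finite_PiE[of S "\<lambda>_. alphabet X"]])
    (use assms in \<open>auto simp: configurations_def alphabet_def\<close>)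

definition coordinate_events :: "(int \<Rightarrow> 'a) set \<Rightarrow> (int \<Rightarrow> 'a) set set" where
  "coordinate_events X = {{x \<in> X. x i = a} | i a. True}"

lemma cylinder_in_sigma_sets:
  assumes "finite S"
  shows "{x \<in> X. restrict x S = w} \<in> sigma_sets X (coordinate_events X)"
proof -
  interpret sigma_algebra X "sigma_sets X (coordinate_events X)"
    by (rule sigma_algebra_sigma_sets) (auto simp: coordinate_events_def)
  show ?thesis
  proof (cases "w \<in> extensional S")
    case True
    have "{x \<in> X. \<forall>i\<in>S. x i = w i} \<in> sigma_sets X (coordinate_events X)"
      using assms by (intro sets_Collect_finite_All) (auto simp: coordinate_events_def)
    moreover have "restrict x S = w \<longleftrightarrow> (\<forall>i\<in>S. x i = w i)" for x
      using True by (auto simp: fun_eq_iff extensional_def restrict_def)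
    ultimately show ?thesis by simp
  next
    case False
    then have "{x \<in> X. restrict x S = w} = {}" by auto
    then show ?thesis by (simp only: empty_sets)
  qed
qed

text \<open>An open set is the union, over \<open>n\<close>, of the cylinders on \<open>{-n..n}\<close> that it contains. For a finite
  alphabet there are finitely many of them for each \<open>n\<close>.\<close>

lemma sets_borel_shift:
  assumes fin: "finite (alphabet X)"
  shows "sets (borel_shift X) = sigma_sets X (coordinate_events X)"
proof -
  interpret sigma_algebra X "sigma_sets X (coordinate_events X)"
    by (rule sigma_algebra_sigma_sets) (auto simp: coordinate_events_def)
  let ?O = "{U. openin (shift_topology X) U}"
  have "coordinate_events X \<subseteq> ?O"
  proof
    fix A assume "A \<in> coordinate_events X"
    then obtain i a where A: "A = {x \<in> X. x i = a}" by (auto simp: coordinate_events_def)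
    have "openin (product_topology (\<lambda>_. discrete_topology UNIV) UNIV)
        {x \<in> topspace (product_topology (\<lambda>_::int. discrete_topology (UNIV :: 'a set)) UNIV). x i \<in> {a}}"
      by (rule openin_continuous_map_preimage[OF continuous_map_product_projection]) auto
    then show "A \<in> ?O"
      by (auto simp: shift_topology_def openin_subtopology A)
  qed
  moreover have "U \<in> sigma_sets X (coordinate_events X)" if U: "U \<in> ?O" for U
  proof -
    let ?W = "\<lambda>n::nat. {- int n..int n}"
    let ?cyl = "\<lambda>n w. {x \<in> X. restrict x (?W n) = w}"
    have UX: "U \<subseteq> X" using U openin_subset by fastforce
    obtain U' where U': "openin (product_topology (\<lambda>_::int. discrete_topology (UNIV :: 'a set)) UNIV) U'"
      "U = U' \<inter> X" using U by (auto simp: shift_topology_def openin_subtopology)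
    have ex: "\<exists>n. ?cyl n (restrict x (?W n)) \<subseteq> U" if x: "x \<in> U" for x
    proof -
      obtain B where B: "finite {i. B i \<noteq> (UNIV :: 'a set)}" "x \<in> Pi\<^sub>E UNIV B" "Pi\<^sub>E UNIV B \<subseteq> U'"
        using U' x unfolding openin_product_topology_alt by auto
      obtain n :: nat where n: "\<forall>i\<in>{i. B i \<noteq> UNIV}. \<bar>i\<bar> \<le> int n"
      proof -
        have "finite ((\<lambda>i. nat \<bar>i\<bar>) ` {i. B i \<noteq> UNIV})" using B by simp
        then obtain n where "\<forall>j\<in>(\<lambda>i. nat \<bar>i\<bar>) ` {i. B i \<noteq> UNIV}. j \<le> n"
          using finite_nat_set_iff_bounded_le by blast
        then show ?thesis by (intro that[of n]) auto
      qed
      have "z \<in> U" if z: "z \<in> X" "restrict z (?W n) = restrict x (?W n)" for z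
      proof -
        have "z i \<in> B i" for i
        proof (cases "B i = UNIV")
          case False
          then have "i \<in> ?W n" using n by auto
          then have "z i = x i" using z(2) by (metis restrict_apply')
          then show ?thesis using B by auto
        qed simp
        then show ?thesis using B U' z by auto
      qed
      then show ?thesis by blast
    qed
    have "U = (\<Union>n. \<Union>w\<in>{w \<in> configurations X (?W n). ?cyl n w \<subseteq> U}. ?cyl n w)"
    proof (intro equalityI subsetI)
      fix x assume x: "x \<in> U"
      then obtain n where "?cyl n (restrict x (?W n)) \<subseteq> U" using ex by blast
      then have "restrict x (?W n) \<in> {w \<in> configurations X (?W n). ?cyl n w \<subseteq> U}"
        using x UX by (auto simp: configurations_def)
      then show "x \<in> (\<Union>n. \<Union>w\<in>{w \<in> configurations X (?W n). ?cyl n w \<subseteq> U}. ?cyl n w)"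
        using x UX by (intro UN_I[of n] UN_I[of "restrict x (?W n)"]) auto
    qed (elim UN_E, use UX in blast)
    also have "\<dots> \<in> sigma_sets X (coordinate_events X)"
    proof (intro countable_UN subsetI)
      fix A assume "A \<in> range (\<lambda>n. \<Union>w\<in>{w \<in> configurations X (?W n). ?cyl n w \<subseteq> U}. ?cyl n w)"
      then obtain n where A: "A = (\<Union>w\<in>{w \<in> configurations X (?W n). ?cyl n w \<subseteq> U}. ?cyl n w)" by blast
      have "finite (configurations X (?W n))" using fin by (intro finite_configurations) auto
      then show "A \<in> sigma_sets X (coordinate_events X)"
        unfolding A by (intro finite_UN cylinder_in_sigma_sets) auto
    qed
    finally show ?thesis .
  qed
  ultimately have "sigma_sets X ?O = sigma_sets X (coordinate_events X)"
    by (intro sigma_sets_eqI) (auto intro: sigma_sets.Basic)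
  then show ?thesis
    unfolding borel_shift_def using openin_subset[of "shift_topology X"] by (subst sets_measure_of) auto
qed

lemma measurable_borel_shiftI:
  assumes "finite (alphabet X)" "\<And>\<omega>. \<omega> \<in> space N \<Longrightarrow> F \<omega> \<in> X"
    and "\<And>i a. {\<omega> \<in> space N. F \<omega> i = a} \<in> sets N"
  shows "F \<in> measurable N (borel_shift X)"
proof (rule measurable_sigma_sets[OF sets_borel_shift[OF assms(1)]])
  fix A assume "A \<in> coordinate_events X"
  then obtain i a where A: "A = {x \<in> X. x i = a}" by (auto simp: coordinate_events_def)
  have "F -` A \<inter> space N = {\<omega> \<in> space N. F \<omega> i = a}" using A assms(2) by auto
  then show "F -` A \<inter> space N \<in> sets N" using assms(3) by simp
qed (use assms in \<open>auto simp: coordinate_events_def\<close>)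

text \<open>Observables of finitely many coordinates. Almost every measurability question below is of this kind.\<close>

lemma simple_function_local:
  assumes fin: "finite (alphabet X)" and \<mu>: "sets \<mu> = sets (borel_shift X)" and S: "finite S"
    and loc: "\<And>x y. x \<in> X \<Longrightarrow> y \<in> X \<Longrightarrow> (\<And>i. i \<in> S \<Longrightarrow> x i = y i) \<Longrightarrow> f x = f y"
  shows "simple_function \<mu> f"
proof -
  have sp: "space \<mu> = X" using sets_eq_imp_space_eq[OF \<mu>] by simp
  have r: "simple_function \<mu> (\<lambda>x. restrict x S)"
    unfolding simple_function_def sp \<mu> sets_borel_shift[OF fin]
  proof (intro conjI ballI)
    show "finite ((\<lambda>x. restrict x S) ` X)"
      using finite_configurations[OF fin S] by (simp add: configurations_def)
    fix w
    have "(\<lambda>x. restrict x S) -` {w} \<inter> X = {x \<in> X. restrict x S = w}" by auto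
    then show "(\<lambda>x. restrict x S) -` {w} \<inter> X \<in> sigma_sets X (coordinate_events X)"
      using cylinder_in_sigma_sets[OF S, of X w] by simp
  qed
  have "f x = f y" if "x \<in> X" "y \<in> X" "restrict x S = restrict y S" for x y
    using that loc by (metis restrict_apply')
  then obtain \<phi> where "\<And>x. x \<in> X \<Longrightarrow> f x = \<phi> (restrict x S)"
    using factor_through[of X "\<lambda>x. restrict x S" f] by blast
  then show ?thesis
    using simple_function_compose1[OF r, of \<phi>] by (subst simple_function_cong[of \<mu> f "\<lambda>x. \<phi> (restrict x S)"]) (auto simp: sp)
qed

lemma shift_measurable:
  assumes "finite (alphabet X)" "shift ` X \<subseteq> X"
  shows "shift \<in> measurable (borel_shift X) (borel_shift X)"
proof (rule measurable_borel_shiftI)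
  fix i a
  have "{x \<in> X. x (i + 1) = a} \<in> coordinate_events X" by (auto simp: coordinate_events_def)
  then show "{\<omega> \<in> space (borel_shift X). shift \<omega> i = a} \<in> sets (borel_shift X)"
    unfolding sets_borel_shift[OF assms(1)] by (auto simp: shift_def)
qed (use assms in auto)

text \<open>The partition by the letter at \<open>0\<close>, with natural numbers as labels because \<open>partition_entropy\<close> asks
  for them.\<close>

definition letter_code :: "(int \<Rightarrow> 'a) set \<Rightarrow> (int \<Rightarrow> 'a) \<Rightarrow> nat" where
  "letter_code X x = to_nat_on (alphabet X) (x 0)"

lemma letter_code_eq_iff:
  assumes "finite (alphabet X)" "x \<in> X" "y \<in> X"
  shows "letter_code X x = letter_code X y \<longleftrightarrow> x 0 = y 0"
  using assms unfolding letter_code_def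
  by (intro to_nat_on_inj countable_finite) (auto simp: alphabet_def)

locale invariant_shift_measure =
  fixes X :: "(int \<Rightarrow> 'a) set" and \<mu> :: "(int \<Rightarrow> 'a) measure"
  assumes finite_alphabet: "finite (alphabet X)" and shift_closed: "shift ` X \<subseteq> X"
    and \<mu>_invariant: "\<mu> \<in> invariant_measures X"
begin

lemma sets_\<mu>: "sets \<mu> = sets (borel_shift X)"
  using \<mu>_invariant by (simp add: invariant_measures_def)

lemma space_\<mu> [simp]: "space \<mu> = X"
  using sets_eq_imp_space_eq[OF sets_\<mu>] by simp

sublocale measure_preserving_map \<mu> shift
proof -
  interpret prob_space \<mu> using \<mu>_invariant by (simp add: invariant_measures_def)
  have "shift \<in> measurable \<mu> \<mu>"
    using shift_measurable[OF finite_alphabet shift_closed] measurable_cong_sets[OF sets_\<mu> sets_\<mu>] by auto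
  then show "measure_preserving_map \<mu> shift"
    by unfold_locales (use \<mu>_invariant in \<open>auto simp: invariant_measures_def\<close>)
qed

lemmas simple_local = simple_function_local[OF finite_alphabet sets_\<mu>]

lemma simple_letter_code: "simple_function \<mu> (letter_code X)"
  by (rule simple_local[of "{0}"]) (auto simp: letter_code_def)

lemma translate_in_X: "x \<in> X \<Longrightarrow> translate (int n) x \<in> X"
  using funpow_space[of x n] by (simp add: funpow_shift)

lemma itinerary_letter_code_eq_iff:
  assumes "x \<in> X" "y \<in> X"
  shows "itinerary shift (letter_code X) n x = itinerary shift (letter_code X) n y \<longleftrightarrow>
    (\<forall>i\<in>{0..<int n}. x i = y i)"
proof -
  have "letter_code X ((shift ^^ i) x) = letter_code X ((shift ^^ i) y) \<longleftrightarrow> x (int i) = y (int i)" for i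
    unfolding funpow_shift using assms
    by (subst letter_code_eq_iff[OF finite_alphabet]) (auto simp: translate_in_X, auto simp: translate_def)
  then have "itinerary shift (letter_code X) n x = itinerary shift (letter_code X) n y
      \<longleftrightarrow> (\<forall>i<n. x (int i) = y (int i))"
    by (simp add: itinerary_eq_iff)
  also have "\<dots> \<longleftrightarrow> (\<forall>i\<in>{0..<int n}. x i = y i)"
    by (metis atLeastLessThan_iff nonneg_int_cases of_nat_0_le_iff of_nat_less_iff)
  finally show ?thesis .
qed

text \<open>The letters of a point at all integers determine it, so the letter partition is a generator. In
  particular the entropy is finite, and a gain in the entropy of letters is a strict gain.\<close>

lemma ks_entropy_letter_code:
  "ks_entropy \<mu> shift = ereal (partition_entropy \<mu> shift (letter_code X))"
proof (rule antisym)
  let ?E = "observable_events (letter_code X)"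
  have "coordinate_events X \<subseteq> ?E"
  proof
    fix A assume "A \<in> coordinate_events X"
    then obtain i a where A: "A = {x \<in> X. x i = a}" by (auto simp: coordinate_events_def)
    have "A \<in> sets \<mu>"
      unfolding sets_\<mu> sets_borel_shift[OF finite_alphabet] using \<open>A \<in> coordinate_events X\<close> by auto
    moreover have "\<forall>\<^sub>F k in sequentially. \<forall>x\<in>X. \<forall>y\<in>X.
      itinerary shift (letter_code X) (2 * k) x = itinerary shift (letter_code X) (2 * k) y \<longrightarrow>
      ((shift ^^ k) x \<in> A \<longleftrightarrow> (shift ^^ k) y \<in> A)"
      unfolding eventually_sequentially
    proof (intro exI allI impI ballI)
      fix k x y assume k: "nat (\<bar>i\<bar> + 1) \<le> k" and xy: "x \<in> X" "y \<in> X"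
        and eq: "itinerary shift (letter_code X) (2 * k) x = itinerary shift (letter_code X) (2 * k) y"
      have "i + int k \<in> {0..<int (2 * k)}" using k by auto
      then have "x (i + int k) = y (i + int k)"
        using eq itinerary_letter_code_eq_iff[OF xy] by blast
      then show "(shift ^^ k) x \<in> A \<longleftrightarrow> (shift ^^ k) y \<in> A"
        unfolding funpow_shift A using translate_in_X xy by (auto simp: translate_def)
    qed
    ultimately show "A \<in> ?E" by (simp add: observable_events_def)
  qed
  then have "sets \<mu> \<subseteq> sigma_sets X ?E"
    unfolding sets_\<mu> sets_borel_shift[OF finite_alphabet] by (rule sigma_sets_mono')
  moreover have "sigma_sets X ?E \<subseteq> sets \<mu>"
    using sets.sigma_sets_subset[of ?E \<mu>] by (auto simp: observable_events_def)
  ultimately have "sets \<mu> = sigma_sets (space \<mu>) ?E" by auto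
  then show "ks_entropy \<mu> shift \<le> ereal (partition_entropy \<mu> shift (letter_code X))"
    unfolding ks_entropy_def
    by (intro SUP_least) (auto intro: kolmogorov_sinai_generator simple_letter_code)
  show "ereal (partition_entropy \<mu> shift (letter_code X)) \<le> ks_entropy \<mu> shift"
    unfolding ks_entropy_def by (intro SUP_upper) (simp add: simple_letter_code)
qed

end

section \<open>Resampling the words on a tiling of the integers\<close>

lemma occurs_in_pair: "occurs_in [a, b] z \<longleftrightarrow> (\<exists>i. z i = a \<and> z (i + 1) = b)"
proof -
  have "(\<forall>k<length [a, b]. z (i + int k) = [a, b] ! k) \<longleftrightarrow> z i = a \<and> z (i + 1) = b" for i
    by (auto simp: less_Suc_eq_0_disj)
  then show ?thesis unfolding occurs_in_def by (simp only:)
qed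

locale one_step_shift =
  fixes X :: "(int \<Rightarrow> 'a) set"
  assumes finite_alphabet: "finite (alphabet X)"
    and one_step: "\<And>x. x \<in> X \<longleftrightarrow> (\<forall>i. \<exists>z\<in>X. occurs_in [x i, x (i + 1)] z)"
begin

definition allowed :: "'a \<Rightarrow> 'a \<Rightarrow> bool" where
  "allowed a b \<longleftrightarrow> (\<exists>z\<in>X. \<exists>i. z i = a \<and> z (i + 1) = b)"

lemma allowedI: "z \<in> X \<Longrightarrow> allowed (z i) (z (i + 1))"
  by (auto simp: allowed_def)

text \<open>Membership is decided by pairs of adjacent letters; every surgery on points below rests on this.\<close>

lemma mem_iff_allowed: "x \<in> X \<longleftrightarrow> (\<forall>i. allowed (x i) (x (i + 1)))"
  unfolding allowed_def using one_step[of x] by (simp add: occurs_in_pair)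

lemma translate_mem_iff: "translate j x \<in> X \<longleftrightarrow> x \<in> X"
proof -
  have "(\<forall>i. allowed (x (i + j)) (x (i + j + 1))) \<longleftrightarrow> (\<forall>i. allowed (x i) (x (i + 1)))"
    by (metis diff_add_cancel)
  then show ?thesis
    unfolding mem_iff_allowed[of x] mem_iff_allowed[of "translate j x"]
    by (simp add: translate_def algebra_simps)
qed

lemma shift_closed: "shift ` X \<subseteq> X"
proof
  fix y assume "y \<in> shift ` X"
  then obtain x where "x \<in> X" "y = translate 1 x" by (auto simp: shift_def translate_def)
  then show "y \<in> X" using translate_mem_iff by blast
qed

end

lemma one_step_shiftI:
  assumes "one_step_sft X"
  shows "one_step_shift X"
proof
  have sft: "sft X" and step: "\<forall>x. x \<in> X \<longleftrightarrow> (\<forall>i. \<exists>z\<in>X. occurs_in [x i, x (i + 1)] z)"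
    using assms unfolding one_step_sft_def by blast+
  obtain A where A: "finite A" "\<forall>x\<in>X. range x \<subseteq> A"
    using sft unfolding sft_def by blast
  have "alphabet X \<subseteq> A" using A(2) unfolding alphabet_def by blast
  then show "finite (alphabet X)" using A(1) by (rule finite_subset)
  show "x \<in> X \<longleftrightarrow> (\<forall>i. \<exists>z\<in>X. occurs_in [x i, x (i + 1)] z)" for x
    using step by (rule spec)
qed

text \<open>The end points of the window \<open>{-r..r}\<close> lie outside \<open>G\<close>, so the letters at the seams of the tiling are
  never altered, and neighbouring windows can be resampled independently of each other.\<close>

locale resampling = one_step_shift X for X :: "(int \<Rightarrow> 'a) set" +
  fixes \<pi>\<^sub>b :: "'a \<Rightarrow> 'b" and G :: "int set" and r :: nat
  assumes G_inner: "G \<subseteq> {- int r<..<int r}"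
begin

abbreviation window :: "int set" where "window \<equiv> {- int r..int r}"

definition period :: nat where "period = 2 * r + 1"

abbreviation words :: "(int \<Rightarrow> 'a) set" where "words \<equiv> configurations X window"

definition word_at :: "int \<Rightarrow> (int \<Rightarrow> 'a) \<Rightarrow> (int \<Rightarrow> 'a)" where
  "word_at k x = restrict (translate (k * int period) x) window"

definition fibre_class :: "(int \<Rightarrow> 'a) \<Rightarrow> (int \<Rightarrow> 'a) set" where
  "fibre_class v = {v' \<in> words. (\<forall>i\<in>window - G. v' i = v i) \<and> (\<forall>i\<in>G. \<pi>\<^sub>b (v' i) = \<pi>\<^sub>b (v i))}"

abbreviation classes :: "(int \<Rightarrow> 'a) set set" where "classes \<equiv> fibre_class ` words"

lemma period_pos: "0 < period" by (simp add: period_def)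

lemma word_at_in_words: "x \<in> X \<Longrightarrow> word_at k x \<in> words"
  unfolding word_at_def configurations_def by (rule imageI) (simp only: translate_mem_iff)

lemma word_at_apply: "j \<in> window \<Longrightarrow> word_at k x j = x (k * int period + j)"
  by (simp add: word_at_def translate_def add.commute)

lemma finite_words: "finite words"
  using finite_alphabet by (intro finite_configurations) auto

lemma fibre_class_subset: "fibre_class v \<subseteq> words"
  by (auto simp: fibre_class_def)

lemma finite_fibre_class: "finite (fibre_class v)"
  using finite_subset[OF fibre_class_subset finite_words] .

lemma fibre_class_refl: "v \<in> words \<Longrightarrow> v \<in> fibre_class v"
  by (simp add: fibre_class_def)

lemma fibre_class_eq: "v' \<in> fibre_class v \<Longrightarrow> fibre_class v' = fibre_class v"
  by (auto simp: fibre_class_def)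

lemma fibre_class_eq_iff:
  assumes "v' \<in> words"
  shows "fibre_class v' = fibre_class v \<longleftrightarrow> v' \<in> fibre_class v"
  using fibre_class_eq[of v' v] fibre_class_refl[OF assms] by blast

lemma block_decomposition:
  obtains k j where "i = k * int period + j" "j \<in> window"
proof
  let ?k = "(i + int r) div int period" and ?m = "(i + int r) mod int period"
  have m: "0 \<le> ?m" "?m < int period" using period_pos by auto
  have "?m \<le> 2 * int r" using m(2) by (simp add: period_def del: pos_mod_bound)
  then show "?m - int r \<in> window" using m(1) by simp
  show "i = ?k * int period + (?m - int r)"
    using div_mult_mod_eq[of "i + int r" "int period"] by linarith
qed

text \<open>The number of the window that contains \<open>i\<close>, and the position of \<open>i\<close> in it, are quotient and
  remainder after moving the left end \<open>-r\<close> to \<open>0\<close>.\<close>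

definition glue :: "(int \<Rightarrow> int \<Rightarrow> 'a) \<Rightarrow> (int \<Rightarrow> 'a)" where
  "glue u i = u ((i + int r) div int period) ((i + int r) mod int period - int r)"

lemma glue_apply:
  assumes "j \<in> window"
  shows "glue u (k * int period + j) = u k j"
proof -
  have j: "0 \<le> j + int r" "j + int r < int period" using assms by (auto simp: period_def)
  have "(k * int period + j + int r) div int period = k"
    using j period_pos by (simp add: add.assoc)
  moreover have "(k * int period + j + int r) mod int period = j + int r"
    using j by (simp add: add.assoc)
  ultimately show ?thesis by (simp add: glue_def)
qed

text \<open>A pair of adjacent letters inside one window is allowed because the window carries a word of \<open>X\<close>; at
  a seam between two windows the letters are those of \<open>x\<close>.\<close>

lemma glue_in_X:
  assumes x: "x \<in> X" and u: "\<And>k. u k \<in> fibre_class (word_at k x)"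
  shows "glue u \<in> X"
  unfolding mem_iff_allowed
proof
  fix i
  obtain k j where i: "i = k * int period + j" and j: "j \<in> window" by (rule block_decomposition)
  show "allowed (glue u i) (glue u (i + 1))"
  proof (cases "j = int r")
    case False
    then have j1: "j + 1 \<in> window" using j by auto
    obtain z where z: "z \<in> X" "u k = restrict z window"
      using u[of k] by (auto simp: fibre_class_def configurations_def)
    have "glue u i = z j" "glue u (i + 1) = z (j + 1)"
      using glue_apply[OF j, of u k] glue_apply[OF j1, of u k] j j1 by (simp_all add: i z(2) add.assoc)
    then show ?thesis using allowedI[OF z(1)] by simp
  next
    case True
    \<comment> \<open>The seam: \<open>i\<close> is the right end of window \<open>k\<close>, and \<open>i + 1\<close> the left end of window \<open>k + 1\<close>.\<close>
    have ends: "int r \<in> window - G" "- int r \<in> window - G" using G_inner by auto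
    have next_i: "i + 1 = (k + 1) * int period + - int r"
      by (simp add: i True period_def algebra_simps)
    have "glue u i = u k (int r)" using glue_apply[OF j, of u k] by (simp add: i True)
    also have "\<dots> = x i" using u[of k] ends word_at_apply[of "int r" k x] by (auto simp: fibre_class_def i True)
    finally have a: "glue u i = x i" .
    have "glue u (i + 1) = u (k + 1) (- int r)" using glue_apply[of "- int r" u "k + 1"] by (simp add: next_i)
    also have "\<dots> = x (i + 1)"
      using u[of "k + 1"] ends word_at_apply[of "- int r" "k + 1" x] by (auto simp: fibre_class_def next_i)
    finally show ?thesis using a allowedI[OF x] by simp
  qed
qed

lemma word_at_glue:
  assumes "u k \<in> words"
  shows "word_at k (glue u) = u k"
proof -
  have "u k \<in> extensional window" using assms by (auto simp: configurations_def)
  moreover have "word_at k (glue u) \<in> extensional window" by (auto simp: word_at_def)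
  ultimately show ?thesis
    by (intro extensionalityI[of _ window]) (auto simp: word_at_apply glue_apply)
qed

lemma image_glue:
  assumes u: "\<And>k. u k \<in> fibre_class (word_at k x)"
  shows "\<pi>\<^sub>b (glue u i) = \<pi>\<^sub>b (x i)"
proof -
  obtain k j where i: "i = k * int period + j" and j: "j \<in> window" by (rule block_decomposition)
  have "\<pi>\<^sub>b (u k j) = \<pi>\<^sub>b (word_at k x j)"
    using u[of k] j by (cases "j \<in> G") (auto simp: fibre_class_def)
  then show ?thesis using glue_apply[OF j] word_at_apply[OF j] by (simp add: i)
qed

text \<open>One uniform choice for each window and each class. The choices are indexed by the class, and not by
  the word that is present, so that an event about the chosen words is a product event once the classes
  are known.\<close>

definition choices :: "(int \<times> (int \<Rightarrow> 'a) set \<Rightarrow> (int \<Rightarrow> 'a)) measure" where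
  "choices = Pi\<^sub>M (UNIV \<times> classes) (\<lambda>i. uniform_count_measure (snd i))"

lemma prob_space_class:
  assumes "i \<in> UNIV \<times> classes"
  shows "prob_space (uniform_count_measure (snd i))"
proof (rule prob_space_uniform_count_measure)
  from assms obtain v where "snd i = fibre_class v" "v \<in> words" by auto
  then show "finite (snd i)" "snd i \<noteq> {}" using finite_fibre_class fibre_class_refl by auto
qed

lemma prob_space_choices: "prob_space choices"
  unfolding choices_def by (rule prob_space_PiM) (rule prob_space_class)

lemma choices_apply: "\<omega> \<in> space choices \<Longrightarrow> C \<in> classes \<Longrightarrow> \<omega> (k, C) \<in> C"
  by (auto simp: choices_def space_PiM PiE_iff space_uniform_count_measure)

definition resample :: "(int \<Rightarrow> 'a) \<Rightarrow> (int \<times> (int \<Rightarrow> 'a) set \<Rightarrow> (int \<Rightarrow> 'a)) \<Rightarrow> (int \<Rightarrow> 'a)" where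
  "resample x \<omega> = glue (\<lambda>k. \<omega> (k, fibre_class (word_at k x)))"

lemma resample_choice:
  assumes "x \<in> X" "\<omega> \<in> space choices"
  shows "\<omega> (k, fibre_class (word_at k x)) \<in> fibre_class (word_at k x)"
  by (rule choices_apply[OF assms(2)]) (use word_at_in_words[OF assms(1)] in auto)

lemma resample_in_X:
  assumes "x \<in> X" "\<omega> \<in> space choices"
  shows "resample x \<omega> \<in> X"
  unfolding resample_def using assms(1) resample_choice[OF assms] by (rule glue_in_X)

lemma word_at_resample:
  assumes "x \<in> X" "\<omega> \<in> space choices"
  shows "word_at k (resample x \<omega>) = \<omega> (k, fibre_class (word_at k x))"
  unfolding resample_def
  by (rule word_at_glue) (rule subsetD[OF fibre_class_subset resample_choice[OF assms]])

lemma fibre_class_resample: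
  assumes "x \<in> X" "\<omega> \<in> space choices"
  shows "fibre_class (word_at k (resample x \<omega>)) = fibre_class (word_at k x)"
  unfolding word_at_resample[OF assms] by (rule fibre_class_eq[OF resample_choice[OF assms]])

lemma image_resample:
  assumes "x \<in> X" "\<omega> \<in> space choices"
  shows "\<pi>\<^sub>b (resample x \<omega> i) = \<pi>\<^sub>b (x i)"
  unfolding resample_def using resample_choice[OF assms] by (rule image_glue)

definition shift_choices ::
  "(int \<times> (int \<Rightarrow> 'a) set \<Rightarrow> (int \<Rightarrow> 'a)) \<Rightarrow> (int \<times> (int \<Rightarrow> 'a) set \<Rightarrow> (int \<Rightarrow> 'a))" where
  "shift_choices \<omega> = (\<lambda>i\<in>UNIV \<times> classes. \<omega> (fst i + 1, snd i))"

lemma shift_choices_measurable: "shift_choices \<in> measurable choices choices"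
  unfolding shift_choices_def choices_def
proof (rule measurable_restrict)
  fix i assume i: "i \<in> (UNIV :: int set) \<times> classes"
  show "(\<lambda>\<omega>. \<omega> (fst i + 1, snd i)) \<in> measurable (Pi\<^sub>M (UNIV \<times> classes) (\<lambda>i. uniform_count_measure (snd i)))
      (uniform_count_measure (snd i))"
    using measurable_component_singleton[of "(fst i + 1, snd i)" "UNIV \<times> classes" "\<lambda>i. uniform_count_measure (snd i)"] i
    by auto
qed

lemma shift_choices_invariant: "distr choices choices shift_choices = choices"
proof -
  let ?I = "(UNIV :: int set) \<times> classes" and ?M = "\<lambda>i :: int \<times> (int \<Rightarrow> 'a) set. uniform_count_measure (snd i)"
  let ?f = "\<lambda>i :: int \<times> (int \<Rightarrow> 'a) set. (fst i + 1, snd i)"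
  have "distr (Pi\<^sub>M ?I ?M) (Pi\<^sub>M ?I (\<lambda>i. ?M (?f i))) (\<lambda>\<omega>. \<lambda>i\<in>?I. \<omega> (?f i)) = Pi\<^sub>M ?I (\<lambda>i. ?M (?f i))"
    by (rule distr_PiM_reindex[OF prob_space_class]) (auto simp: inj_on_def)
  then show ?thesis by (simp add: choices_def shift_choices_def[abs_def])
qed

text \<open>Moving the point by one period amounts to renumbering the windows, hence the choices.\<close>

lemma resample_equivariant:
  assumes x: "x \<in> X"
  shows "resample (translate (int period) x) (shift_choices \<omega>) = translate (int period) (resample x \<omega>)"
proof
  fix i
  obtain k j where i: "i = k * int period + j" and j: "j \<in> window" by (rule block_decomposition)
  have w: "word_at k (translate (int period) x) = word_at (k + 1) x"
    by (simp add: word_at_def translate_def algebra_simps)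
  have i': "i + int period = (k + 1) * int period + j" by (simp add: i algebra_simps)
  have "resample (translate (int period) x) (shift_choices \<omega>) i = \<omega> (k + 1, fibre_class (word_at (k + 1) x)) j"
    using word_at_in_words[OF x, of "k + 1"] unfolding resample_def i glue_apply[OF j]
    by (simp add: shift_choices_def w)
  also have "\<dots> = translate (int period) (resample x \<omega>) i"
    unfolding translate_def i' resample_def glue_apply[OF j] ..
  finally show "resample (translate (int period) x) (shift_choices \<omega>) i = translate (int period) (resample x \<omega>) i" .
qed

end

section \<open>The resampled measure\<close>

context measure_preserving_map
begin

text \<open>Given the factor observations, each observation of \<open>V\<close> adds at most its conditional entropy given
  its own factor value.\<close>

lemma shannon_itinerary_le_factor:
  fixes V :: "'x \<Rightarrow> 'v" and \<phi> :: "'v \<Rightarrow> 'd"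
  assumes V: "simple_function M V"
  shows "shannon M (itinerary T V m)
    \<le> shannon M (itinerary T (\<lambda>x. \<phi> (V x)) m) + m * (shannon M V - shannon M (\<lambda>x. \<phi> (V x)))"
proof -
  let ?c = "\<lambda>x. \<phi> (V x)"
  note s = simple_function_itinerary
  have c: "simple_function M ?c" by (rule simple_function_compose1[OF V])
  have "shannon M (\<lambda>x. (itinerary T V m x, B x))
    \<le> shannon M (\<lambda>x. (itinerary T ?c m x, B x)) + m * (shannon M V - shannon M ?c)"
    \<comment> \<open>The list \<open>B\<close> collects the later observations, already replaced by their factor values.\<close>
    if "simple_function M B" for B :: "'x \<Rightarrow> 'd list"
    using that
  proof (induction m arbitrary: B)
    case 0
    have "shannon M (\<lambda>x. (itinerary T V 0 x, B x)) \<le> shannon M (\<lambda>x. (itinerary T ?c 0 x, B x))"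
      by (rule shannon_mono[OF prob_space_M simple_function_Pair[OF s[OF c] 0]]) (simp add: itinerary_def)
    then show ?case by simp
  next
    case (Suc m)
    let ?g = "\<lambda>x. V ((T ^^ m) x)"
    have g: "simple_function M ?g" by (rule simple_function_funpow[OF V])
    have f: "simple_function M (\<lambda>x. (itinerary T V m x, B x))"
      using s[OF V] Suc.prems by (rule simple_function_Pair)
    have cB: "simple_function M (\<lambda>x. \<phi> (?g x) # B x)"
      using simple_function_compose1[OF g] Suc.prems by (rule simple_function_compose2)
    have eq: "itinerary T h (Suc m) x = itinerary T h m x @ [h ((T ^^ m) x)]" for h :: "'x \<Rightarrow> 'k" and x
      by (simp add: itinerary_def)
    have "shannon M (\<lambda>x. (itinerary T V (Suc m) x, B x)) = shannon M (\<lambda>x. ((itinerary T V m x, B x), ?g x))"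
      by (rule shannon_eqI[OF prob_space_M simple_function_Pair[OF s[OF V] Suc.prems] simple_function_Pair[OF f g]])
        (auto simp: eq)
    also have "\<dots> \<le> shannon M (\<lambda>x. ((itinerary T V m x, B x), \<phi> (?g x))) + (shannon M ?g - shannon M (\<lambda>x. \<phi> (?g x)))"
      using shannon_strong_subadditive[OF prob_space_M f g, of \<phi>] by simp
    also have "shannon M ?g = shannon M V" by (rule shannon_funpow[OF V])
    also have "shannon M (\<lambda>x. \<phi> (?g x)) = shannon M ?c" by (rule shannon_funpow[OF c])
    also have "shannon M (\<lambda>x. ((itinerary T V m x, B x), \<phi> (?g x)))
        = shannon M (\<lambda>x. (itinerary T V m x, \<phi> (?g x) # B x))"
      by (rule shannon_eqI[OF prob_space_M simple_function_Pair[OF f simple_function_compose1[OF g]]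
            simple_function_Pair[OF s[OF V] cB]]) auto
    also have "\<dots> \<le> shannon M (\<lambda>x. (itinerary T ?c m x, \<phi> (?g x) # B x)) + m * (shannon M V - shannon M ?c)"
      by (rule Suc.IH[OF cB])
    also have "shannon M (\<lambda>x. (itinerary T ?c m x, \<phi> (?g x) # B x)) = shannon M (\<lambda>x. (itinerary T ?c (Suc m) x, B x))"
      by (rule shannon_eqI[OF prob_space_M simple_function_Pair[OF s[OF c] cB]
            simple_function_Pair[OF s[OF c] Suc.prems]]) (auto simp: eq)
    finally show ?case by (simp add: algebra_simps)
  qed
  from this[of "\<lambda>_. []"]
  have "shannon M (\<lambda>x. (itinerary T V m x, [] :: 'd list))
    \<le> shannon M (\<lambda>x. (itinerary T ?c m x, [] :: 'd list)) + m * (shannon M V - shannon M ?c)" by simp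
  moreover have "shannon M (\<lambda>x. (itinerary T V m x, [] :: 'd list)) = shannon M (itinerary T V m)"
    using prob_space_M s[OF V] by (intro shannon_eqI) auto
  moreover have "shannon M (\<lambda>x. (itinerary T ?c m x, [] :: 'd list)) = shannon M (itinerary T ?c m)"
    using prob_space_M s[OF c] by (intro shannon_eqI) auto
  ultimately show ?thesis by simp
qed

end

locale resampled_measure = resampling X \<pi>\<^sub>b G r
  for X :: "(int \<Rightarrow> 'a) set" and \<pi>\<^sub>b :: "'a \<Rightarrow> 'b" and G :: "int set" and r :: nat +
  fixes \<mu> :: "(int \<Rightarrow> 'a) measure"
  assumes \<mu>_invariant: "\<mu> \<in> invariant_measures X"
begin

sublocale invariant_shift_measure X \<mu>
  by unfold_locales (use finite_alphabet shift_closed \<mu>_invariant in auto)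

sublocale block_shift: measure_preserving_map \<mu> "shift ^^ period"
  by unfold_locales (rule funpow_measurable funpow_invariant)+

lemma block_shift_funpow: "(shift ^^ period) ^^ k = translate (int k * int period)"
proof -
  have "(shift ^^ period) ^^ k = shift ^^ (period * k)" by (rule funpow_mult)
  also have "\<dots> = translate (int (period * k))" by (rule funpow_shift)
  also have "int (period * k) = int k * int period" by simp
  finally show ?thesis .
qed

lemma word_at_block_shift: "word_at 0 (((shift ^^ period) ^^ k) x) = word_at (int k) x"
  unfolding block_shift_funpow by (simp add: word_at_def translate_def add.commute)

lemma simple_word_at: "sets \<mu>' = sets (borel_shift X) \<Longrightarrow> simple_function \<mu>' (word_at k)"
  by (rule simple_function_local[OF finite_alphabet, of _ "(\<lambda>j. k * int period + j) ` window"])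
    (auto simp: fun_eq_iff word_at_def translate_def add.commute)

lemma simple_class_at:
  "sets \<mu>' = sets (borel_shift X) \<Longrightarrow> simple_function \<mu>' (\<lambda>x. fibre_class (word_at k x))"
  by (rule simple_function_compose1[OF simple_word_at])

lemma resample_measurable:
  "(\<lambda>(x, \<omega>). resample x \<omega>) \<in> measurable (\<mu> \<Otimes>\<^sub>M choices) (borel_shift X)"
proof (rule measurable_borel_shiftI[OF finite_alphabet])
  fix z assume "z \<in> space (\<mu> \<Otimes>\<^sub>M choices)"
  then show "(case z of (x, \<omega>) \<Rightarrow> resample x \<omega>) \<in> X"
    by (auto simp: space_pair_measure resample_in_X)
next
  fix i a
  obtain k j where i: "i = k * int period + j" and j: "j \<in> window" by (rule block_decomposition)
  let ?A = "\<lambda>C. (\<lambda>x. fibre_class (word_at k x)) -` {C} \<inter> space \<mu>"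
  let ?B = "\<lambda>C. (\<lambda>\<omega>. \<omega> (k, C)) -` {v \<in> C. v j = a} \<inter> space choices"
  have "{z \<in> space (\<mu> \<Otimes>\<^sub>M choices). (case z of (x, \<omega>) \<Rightarrow> resample x \<omega>) i = a} = (\<Union>C\<in>classes. ?A C \<times> ?B C)"
    (is "?L = ?R")
  proof (intro set_eqI)
    fix z :: "(int \<Rightarrow> 'a) \<times> (int \<times> (int \<Rightarrow> 'a) set \<Rightarrow> (int \<Rightarrow> 'a))"
    obtain x \<omega> where z: "z = (x, \<omega>)" by fastforce
    show "z \<in> ?L \<longleftrightarrow> z \<in> ?R"
    proof (cases "x \<in> X \<and> \<omega> \<in> space choices")
      case True
      then have "\<omega> (k, fibre_class (word_at k x)) \<in> fibre_class (word_at k x)"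
        by (intro resample_choice) simp_all
      moreover have "fibre_class (word_at k x) \<in> classes" using True word_at_in_words by simp
      moreover have "resample x \<omega> i = \<omega> (k, fibre_class (word_at k x)) j"
        unfolding resample_def i by (rule glue_apply[OF j])
      ultimately show ?thesis using True word_at_in_words[of x k]
        by (auto simp: z space_pair_measure intro!: bexI[of _ "word_at k x"])
    qed (auto simp: z space_pair_measure)
  qed
  also have "\<dots> \<in> sets (\<mu> \<Otimes>\<^sub>M choices)"
  proof (intro sets.finite_UN pair_measureI)
    fix C assume C: "C \<in> classes"
    show "?A C \<in> sets \<mu>" using simple_class_at[OF sets_\<mu>] by (rule simple_functionD)
    have "(\<lambda>\<omega>. \<omega> (k, C)) \<in> measurable choices (uniform_count_measure C)"
      unfolding choices_def using C
        measurable_component_singleton[of "(k, C)" "UNIV \<times> classes" "\<lambda>i. uniform_count_measure (snd i)"] by auto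
    then show "?B C \<in> sets choices" by (rule measurable_sets) (auto simp: sets_uniform_count_measure)
  qed (simp add: finite_words)
  finally show "{z \<in> space (\<mu> \<Otimes>\<^sub>M choices). (case z of (x, \<omega>) \<Rightarrow> resample x \<omega>) i = a} \<in> sets (\<mu> \<Otimes>\<^sub>M choices)" .
qed

sublocale choices: prob_space choices
  by (rule prob_space_choices)

sublocale joint: pair_prob_space \<mu> choices ..

definition resampled :: "(int \<Rightarrow> 'a) measure" where
  "resampled = distr (\<mu> \<Otimes>\<^sub>M choices) (borel_shift X) (\<lambda>(x, \<omega>). resample x \<omega>)"

lemma sets_resampled: "sets resampled = sets (borel_shift X)"
  by (simp add: resampled_def)

lemma space_resampled [simp]: "space resampled = X"
  by (simp add: resampled_def)

lemma prob_space_resampled: "prob_space resampled"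
  unfolding resampled_def by (rule joint.prob_space_distr[OF resample_measurable])

text \<open>The product of \<open>\<mu>\<close> with the law of the choices is invariant under the simultaneous translation of
  the point and renumbering of the choices, and resampling intertwines this map with the translation.\<close>

lemma resampled_invariant: "distr resampled resampled (shift ^^ period) = resampled"
proof -
  let ?P = "\<mu> \<Otimes>\<^sub>M choices" and ?B = "borel_shift X"
  let ?R = "\<lambda>(x, \<omega>). resample x \<omega>" and ?S = "\<lambda>(x, \<omega>). ((shift ^^ period) x, shift_choices \<omega>)"
  have S: "?S \<in> measurable ?P ?P"
    unfolding split_def
    by (intro measurable_Pair measurable_compose[OF measurable_fst funpow_measurable]
        measurable_compose[OF measurable_snd shift_choices_measurable])
  have shB: "shift ^^ period \<in> measurable ?B ?B"
    using funpow_measurable measurable_cong_sets[OF sets_\<mu> sets_\<mu>] by auto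
  have "distr resampled resampled (shift ^^ period) = distr resampled ?B (shift ^^ period)"
    by (rule distr_cong) (auto simp: sets_resampled)
  also have "\<dots> = distr ?P ?B ((shift ^^ period) \<circ> ?R)"
    unfolding resampled_def by (rule distr_distr[OF shB resample_measurable])
  also have "\<dots> = distr ?P ?B (?R \<circ> ?S)"
    by (rule distr_cong)
      (auto simp: space_pair_measure funpow_shift resample_equivariant)
  also have "\<dots> = distr (distr ?P ?P ?S) ?B ?R"
    by (rule distr_distr[OF resample_measurable S, symmetric])
  also have "distr ?P ?P ?S = distr \<mu> \<mu> (shift ^^ period) \<Otimes>\<^sub>M distr choices choices shift_choices"
    using funpow_measurable shift_choices_measurable prob_space_choices
    by (intro pair_measure_distr[symmetric]) (auto simp: shift_choices_invariant prob_space_imp_sigma_finite)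
  also have "\<dots> = ?P" by (simp add: shift_choices_invariant funpow_invariant)
  finally show ?thesis by (simp add: resampled_def)
qed

sublocale resampled: measure_preserving_map resampled "shift ^^ period"
proof -
  interpret R: prob_space resampled by (rule prob_space_resampled)
  have "shift ^^ period \<in> measurable resampled resampled"
    using funpow_measurable measurable_cong_sets[OF sets_\<mu> sets_\<mu>]
      measurable_cong_sets[OF sets_resampled sets_resampled] by auto
  then show "measure_preserving_map resampled (shift ^^ period)"
    by unfold_locales (auto simp: resampled_invariant)
qed

lemma emeasure_resampled:
  assumes "A \<in> sets \<mu>"
  shows "emeasure resampled A = emeasure (\<mu> \<Otimes>\<^sub>M choices) {(x, \<omega>) \<in> space (\<mu> \<Otimes>\<^sub>M choices). resample x \<omega> \<in> A}"
  using assms sets_\<mu> unfolding resampled_def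
  by (subst emeasure_distr[OF resample_measurable]) (auto intro!: arg_cong[where f = "emeasure _"])

text \<open>For events about the classes and about the image, which resampling does not affect.\<close>

lemma emeasure_resampled_fibre:
  assumes A: "A \<in> sets \<mu>" and inv: "\<And>x \<omega>. x \<in> X \<Longrightarrow> \<omega> \<in> space choices \<Longrightarrow> resample x \<omega> \<in> A \<longleftrightarrow> x \<in> A"
  shows "emeasure resampled A = emeasure \<mu> A"
proof -
  have "{(x, \<omega>) \<in> space (\<mu> \<Otimes>\<^sub>M choices). resample x \<omega> \<in> A} = A \<times> space choices"
    using inv sets.sets_into_space[OF A] by (auto simp: space_pair_measure)
  then show ?thesis
    using A by (simp add: emeasure_resampled choices.emeasure_pair_measure_Times choices.emeasure_space_1)
qed

lemma mass_at_resampled_fibre: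
  assumes f: "simple_function \<mu> f" and inv: "\<And>x \<omega>. x \<in> X \<Longrightarrow> \<omega> \<in> space choices \<Longrightarrow> f (resample x \<omega>) = f x"
  shows "mass_at resampled f u = mass_at \<mu> f u"
proof -
  have "emeasure resampled (f -` {u} \<inter> X) = emeasure \<mu> (f -` {u} \<inter> X)"
    using simple_functionD(2)[OF f, of "{u}"] inv by (intro emeasure_resampled_fibre) (auto simp: resample_in_X)
  then show ?thesis by (simp add: mass_at_def measure_def)
qed

lemma shannon_resampled_fibre:
  assumes f: "simple_function \<mu> f" and inv: "\<And>x \<omega>. x \<in> X \<Longrightarrow> \<omega> \<in> space choices \<Longrightarrow> f (resample x \<omega>) = f x"
  shows "shannon resampled f = shannon \<mu> f"
  using mass_at_resampled_fibre[OF assms] by (simp add: shannon_def)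

abbreviation block_class :: "(int \<Rightarrow> 'a) \<Rightarrow> (int \<Rightarrow> 'a) set" where
  "block_class x \<equiv> fibre_class (word_at 0 x)"

text \<open>To see the words \<open>w\<close>, the point must show their classes and the choices for these classes must be
  the entries of \<open>w\<close>. This event is a rectangle in the product space.\<close>

lemma mass_at_resampled_words:
  assumes w: "length w = m" "set w \<subseteq> words"
  shows "mass_at resampled (itinerary (shift ^^ period) (word_at 0) m) w
    \<le> mass_at \<mu> (itinerary (shift ^^ period) block_class m) (map fibre_class w)
      * (\<Prod>i<m. 1 / card (fibre_class (w ! i)))"
proof -
  let ?V = "itinerary (shift ^^ period) (word_at 0) m" and ?c = "itinerary (shift ^^ period) block_class m"
  let ?P = "\<mu> \<Otimes>\<^sub>M choices"
  have V_eq: "?V x = w \<longleftrightarrow> (\<forall>i<m. word_at (int i) x = w ! i)" for x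
    using w(1) by (auto simp: itinerary_def list_eq_iff_nth_eq word_at_block_shift)
  have c_eq: "?c x = map fibre_class w \<longleftrightarrow> (\<forall>i<m. fibre_class (word_at (int i) x) = fibre_class (w ! i))" for x
    using w(1) by (auto simp: itinerary_def list_eq_iff_nth_eq word_at_block_shift)
  have wi: "w ! i \<in> words" if "i < m" for i using w that by auto
  have A: "?V -` {w} \<inter> X \<in> sets \<mu>"
    using simple_functionD(2)[OF block_shift.simple_function_itinerary[OF simple_word_at[OF sets_\<mu>]], of 0 m "{w}"] by simp
  have E1: "?c -` {map fibre_class w} \<inter> X \<in> sets \<mu>" (is "?E1 \<in> _")
    using simple_functionD(2)[OF block_shift.simple_function_itinerary[OF simple_class_at[OF sets_\<mu>]],
        of 0 m "{map fibre_class w}"] by simp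
  define J where "J = (\<lambda>i. (int i, fibre_class (w ! i))) ` {..<m}"
  define E2 where "E2 = prod_emb (UNIV \<times> classes) (\<lambda>i. uniform_count_measure (snd i)) J (\<Pi>\<^sub>E p\<in>J. {w ! nat (fst p)})"
  have J: "J \<subseteq> UNIV \<times> classes" "finite J" using wi by (auto simp: J_def)
  have sing: "{w ! nat (fst p)} \<in> sets (uniform_count_measure (snd p))" if "p \<in> J" for p
    using that wi by (auto simp: J_def sets_uniform_count_measure fibre_class_refl)
  have E2: "E2 \<in> sets choices"
    unfolding E2_def choices_def using J sing by (intro sets_PiM_I) auto
  have "emeasure choices E2 = (\<Prod>p\<in>J. emeasure (uniform_count_measure (snd p)) {w ! nat (fst p)})"
    unfolding E2_def choices_def using J sing by (intro emeasure_PiM_emb prob_space_class) auto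
  also have "\<dots> = (\<Prod>i<m. emeasure (uniform_count_measure (fibre_class (w ! i))) {w ! i})"
    unfolding J_def by (subst prod.reindex) (auto simp: inj_on_def)
  also have "\<dots> = (\<Prod>i<m. ennreal (1 / card (fibre_class (w ! i))))"
    using wi finite_fibre_class fibre_class_refl
    by (intro prod.cong) (auto simp: emeasure_uniform_count_measure)
  also have "\<dots> = ennreal (\<Prod>i<m. 1 / card (fibre_class (w ! i)))" by (rule prod_ennreal) simp
  finally have P2: "emeasure choices E2 = ennreal (\<Prod>i<m. 1 / card (fibre_class (w ! i)))" .
  have sub: "{(x, \<omega>) \<in> space ?P. resample x \<omega> \<in> ?V -` {w} \<inter> X} \<subseteq> ?E1 \<times> E2"
  proof
    fix z assume "z \<in> {(x, \<omega>) \<in> space ?P. resample x \<omega> \<in> ?V -` {w} \<inter> X}"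
    then obtain x \<omega> where z: "z = (x, \<omega>)" and xo: "(x, \<omega>) \<in> space ?P" and V: "?V (resample x \<omega>) = w"
      by blast
    have x: "x \<in> X" and o: "\<omega> \<in> space choices" using xo by (auto simp: space_pair_measure)
    have *: "\<omega> (int i, fibre_class (word_at (int i) x)) = w ! i" if "i < m" for i
      using V that unfolding V_eq by (simp add: word_at_resample[OF x o])
    have cl: "fibre_class (word_at (int i) x) = fibre_class (w ! i)" if "i < m" for i
      using resample_choice[OF x o, of "int i"] *[OF that] fibre_class_eq by metis
    have "\<omega> p = w ! nat (fst p)" if "p \<in> J" for p
      using that * cl by (auto simp: J_def)
    then have "\<omega> \<in> E2" using o J unfolding E2_def choices_def
      by (auto simp: prod_emb_def space_PiM PiE_iff)
    moreover have "x \<in> ?E1" using cl x by (simp add: c_eq)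
    ultimately show "z \<in> ?E1 \<times> E2" by (simp add: z)
  qed
  have "emeasure resampled (?V -` {w} \<inter> X) \<le> emeasure ?P (?E1 \<times> E2)"
    unfolding emeasure_resampled[OF A] using sub E1 E2 by (intro emeasure_mono) auto
  also have "\<dots> = emeasure \<mu> ?E1 * emeasure choices E2"
    using E1 E2 by (rule choices.emeasure_pair_measure_Times)
  also have "\<dots> = ennreal (measure \<mu> ?E1 * (\<Prod>i<m. 1 / card (fibre_class (w ! i))))"
    unfolding P2 by (simp add: emeasure_eq_measure ennreal_mult prod_nonneg)
  finally show ?thesis
    unfolding resampled.emeasure_eq_measure mass_at_def space_resampled space_\<mu>
    by (subst (asm) ennreal_le_iff) (auto intro!: mult_nonneg_nonneg prod_nonneg)
qed

text \<open>The entropy per window of the uniform choice, given the class.\<close>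

definition mean_log_card :: real where
  "mean_log_card = (\<Sum>C\<in>classes. mass_at \<mu> block_class C * ln (card C))"

text \<open>Taking logarithms in \<open>mass_at_resampled_words\<close> and averaging over \<open>w\<close>. The class masses on the
  right are the same before and after resampling.\<close>

lemma shannon_resampled_ge:
  "shannon \<mu> (itinerary (shift ^^ period) block_class m) + m * mean_log_card
    \<le> shannon resampled (itinerary (shift ^^ period) (word_at 0) m)"
proof -
  let ?V = "itinerary (shift ^^ period) (word_at 0) m" and ?c = "itinerary (shift ^^ period) block_class m"
  let ?S = "{w. set w \<subseteq> words \<and> length w = m}"
  let ?p = "mass_at resampled ?V" and ?q = "mass_at \<mu> ?c"
  have fin: "finite ?S" using finite_words by (rule finite_lists_length_eq)
  have V: "simple_function resampled ?V"
    by (rule resampled.simple_function_itinerary[OF simple_word_at[OF sets_resampled]])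
  have c: "simple_function \<mu> ?c"
    by (rule block_shift.simple_function_itinerary[OF simple_class_at[OF sets_\<mu>]])
  have sub: "?V ` space resampled \<subseteq> ?S"
    using word_at_in_words by (auto simp: itinerary_def word_at_block_shift)
  note * = prob_space_resampled V fin sub
  have cV: "?c = (\<lambda>x. map fibre_class (?V x))" by (rule ext) (simp add: itinerary_def)
  have c_res: "?c (resample x \<omega>) = ?c x" if "x \<in> X" "\<omega> \<in> space choices" for x \<omega>
    using that by (simp add: itinerary_def word_at_block_shift fibre_class_resample)
  have mass_c: "mass_at resampled ?c u = ?q u" for u
    by (rule mass_at_resampled_fibre[OF c c_res])
  have mean: "(\<Sum>w\<in>?S. ?p w * ln (card (fibre_class (w ! i)))) = mean_log_card" if i: "i < m" for i
  proof -
    let ?ci = "\<lambda>x. fibre_class (word_at (int i) x)"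
    have ci: "(\<lambda>x. fibre_class (?V x ! i)) = ?ci"
      using i by (simp add: itinerary_def word_at_block_shift)
    have "mass_at resampled ?ci C = mass_at \<mu> ?ci C" for C
      by (rule mass_at_resampled_fibre[OF simple_class_at[OF sets_\<mu>] fibre_class_resample])
    also have "mass_at \<mu> ?ci C = mass_at \<mu> block_class C" for C
    proof -
      let ?T = "(shift ^^ period) ^^ i"
      have "?ci -` {C} \<inter> space \<mu> = ?T -` (block_class -` {C} \<inter> space \<mu>) \<inter> space \<mu>"
        using block_shift.funpow_space by (auto simp: word_at_block_shift)
      then have "mass_at \<mu> ?ci C = measure (distr \<mu> \<mu> ?T) (block_class -` {C} \<inter> space \<mu>)"
        unfolding mass_at_def
        using simple_functionD(2)[OF simple_class_at[OF sets_\<mu>]] block_shift.funpow_measurable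
        by (simp add: measure_distr)
      then show ?thesis by (simp add: block_shift.funpow_invariant mass_at_def)
    qed
    finally have mass_ci: "mass_at resampled ?ci C = mass_at \<mu> block_class C" for C .
    have "(\<Sum>w\<in>?S. ?p w * ln (card (fibre_class (w ! i))))
        = (\<Sum>C\<in>(\<lambda>w. fibre_class (w ! i)) ` ?S. mass_at \<mu> block_class C * ln (card C))"
      using sum_mass_at_compose[OF *, of "\<lambda>C. ln (real (card C))" "\<lambda>w. fibre_class (w ! i)"]
      unfolding ci mass_ci .
    also have "\<dots> = mean_log_card" unfolding mean_log_card_def
    proof (rule sum.mono_neutral_left)
      have "w ! i \<in> words" if "w \<in> ?S" for w using that i nth_mem[of i w] by blast
      then show "(\<lambda>w. fibre_class (w ! i)) ` ?S \<subseteq> classes" by blast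
      have "C \<in> (\<lambda>w. fibre_class (w ! i)) ` ?S" if C: "C \<in> classes" for C
      proof -
        obtain v where v: "v \<in> words" "C = fibre_class v" using C by blast
        have "replicate m v \<in> ?S" using v(1) by (simp add: set_replicate_conv_if)
        moreover have "fibre_class (replicate m v ! i) = C" using i v(2) by simp
        ultimately show ?thesis by blast
      qed
      then show "\<forall>C\<in>classes - (\<lambda>w. fibre_class (w ! i)) ` ?S. mass_at \<mu> block_class C * ln (card C) = 0" by blast
    qed (simp add: finite_words)
    finally show ?thesis .
  qed
  have "shannon \<mu> ?c = shannon resampled (\<lambda>x. map fibre_class (?V x))"
    using shannon_resampled_fibre[OF c c_res] by (simp add: cV)
  also have "\<dots> = (\<Sum>w\<in>?S. - (?p w * ln (?q (map fibre_class w))))"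
    using shannon_compose[OF *, of "map fibre_class"] mass_c by (simp add: cV)
  finally have "shannon \<mu> ?c + m * mean_log_card
      = (\<Sum>w\<in>?S. - (?p w * ln (?q (map fibre_class w)))) + (\<Sum>i<m. \<Sum>w\<in>?S. ?p w * ln (card (fibre_class (w ! i))))"
    using mean by simp
  also have "\<dots> = (\<Sum>w\<in>?S. - (?p w * ln (?q (map fibre_class w))) + (\<Sum>i<m. ?p w * ln (card (fibre_class (w ! i)))))"
    by (subst sum.swap) (rule sum.distrib[symmetric])
  also have "\<dots> \<le> (\<Sum>w\<in>?S. - (?p w * ln (?p w)))"
  proof (rule sum_mono)
    fix w assume w: "w \<in> ?S"
    let ?c = "\<lambda>i. real (card (fibre_class (w ! i)))"
    show "- (?p w * ln (?q (map fibre_class w))) + (\<Sum>i<m. ?p w * ln (?c i)) \<le> - (?p w * ln (?p w))"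
    proof (cases "?p w = 0")
      case False
      then have pos: "0 < ?p w" using mass_at_nonneg[of resampled ?V w] by linarith
      have le: "?p w \<le> ?q (map fibre_class w) * (\<Prod>i<m. 1 / ?c i)"
        using w by (intro mass_at_resampled_words) auto
      have c_pos: "0 < ?c i" if "i < m" for i
      proof -
        have "w ! i \<in> words" using w that nth_mem[of i w] by blast
        then show ?thesis using finite_fibre_class fibre_class_refl[of "w ! i"] by (auto simp: card_gt_0_iff)
      qed
      then have prod_pos: "0 < (\<Prod>i<m. 1 / ?c i)" by (intro prod_pos) auto
      have q_pos: "0 < ?q (map fibre_class w)"
        using less_le_trans[OF pos le] prod_pos by (simp add: zero_less_mult_iff)
      have "ln (?p w) \<le> ln (?q (map fibre_class w) * (\<Prod>i<m. 1 / ?c i))"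
        using le pos by simp
      also have "\<dots> = ln (?q (map fibre_class w)) + (\<Sum>i<m. ln (1 / ?c i))"
      proof -
        have "ln (\<Prod>i<m. 1 / ?c i) = (\<Sum>i<m. ln (1 / ?c i))"
          using c_pos by (intro ln_prod) (simp_all add: order_less_imp_not_eq2)
        then show ?thesis using ln_mult_pos[OF q_pos prod_pos] by simp
      qed
      also have "(\<Sum>i<m. ln (1 / ?c i)) = - (\<Sum>i<m. ln (?c i))"
        using c_pos by (simp add: ln_div flip: sum_negf)
      finally have "?p w * ln (?p w) \<le> ?p w * (ln (?q (map fibre_class w)) - (\<Sum>i<m. ln (?c i)))"
        using pos by (intro mult_left_mono) auto
      then show ?thesis by (simp add: right_diff_distrib flip: sum_distrib_left)
    qed simp
  qed
  also have "\<dots> = shannon resampled ?V" using fin sub by (rule shannon_superset[symmetric])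
  finally show ?thesis .
qed

end

section \<open>Averaging over a period and the entropy gain\<close>

context resampled_measure
begin

text \<open>The tiling has a fixed phase, so the resampled measure is invariant under a full period only.
  Averaging over the translates within a period restores invariance under the shift.\<close>

definition averaged :: "(int \<Rightarrow> 'a) measure" where
  "averaged = measure_pmf (pmf_of_set {..<period}) \<bind> (\<lambda>j. distr resampled (borel_shift X) (shift ^^ j))"

lemma shift_funpow_resampled: "shift ^^ j \<in> measurable resampled (borel_shift X)"
  using funpow_measurable[of j] measurable_cong_sets[OF sets_\<mu> sets_\<mu>]
    measurable_cong_sets[OF sets_resampled refl] by auto

lemma prob_space_shifted: "prob_space (distr resampled (borel_shift X) (shift ^^ j))"
  by (rule prob_space.prob_space_distr[OF prob_space_resampled shift_funpow_resampled])

lemma shifted_kernel: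
  "(\<lambda>j. distr resampled (borel_shift X) (shift ^^ j))
    \<in> measurable (measure_pmf (pmf_of_set {..<period})) (subprob_algebra (borel_shift X))"
  unfolding measurable_pmf_measure1
  by (auto simp: space_subprob_algebra intro: prob_space_imp_subprob_space prob_space_shifted)

lemma sets_averaged: "sets averaged = sets (borel_shift X)"
  unfolding averaged_def by (rule sets_bind) auto

lemma space_averaged [simp]: "space averaged = X"
  using sets_eq_imp_space_eq[OF sets_averaged] by simp

lemma emeasure_averaged:
  assumes A: "A \<in> sets (borel_shift X)"
  shows "emeasure averaged A = (\<Sum>j<period. emeasure resampled ((shift ^^ j) -` A \<inter> X)) / period"
proof -
  have "emeasure averaged A = (\<integral>\<^sup>+j. emeasure (distr resampled (borel_shift X) (shift ^^ j)) A \<partial>measure_pmf (pmf_of_set {..<period}))"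
    unfolding averaged_def by (rule emeasure_bind[OF _ shifted_kernel A]) simp
  also have "\<dots> = (\<Sum>j<period. emeasure (distr resampled (borel_shift X) (shift ^^ j)) A) / period"
    using period_pos by (subst nn_integral_pmf_of_set) auto
  finally show ?thesis
    using A by (simp add: emeasure_distr[OF shift_funpow_resampled])
qed

lemma prob_space_averaged: "prob_space averaged"
proof (rule prob_spaceI)
  have "(shift ^^ j) -` X \<inter> X = X" for j
    using funpow_space by auto
  moreover have "emeasure resampled X = 1"
    using prob_space.emeasure_space_1[OF prob_space_resampled] by simp
  moreover have "X \<in> sets (borel_shift X)" using sets.top[of "borel_shift X"] by simp
  ultimately show "emeasure averaged (space averaged) = 1"
    using period_pos by (simp add: emeasure_averaged ennreal_of_nat_eq_real_of_nat divide_ennreal)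
qed

text \<open>The shift permutes the translates of the resampled measure cyclically.\<close>

lemma averaged_invariant: "averaged \<in> invariant_measures X"
proof -
  have sh: "shift \<in> measurable averaged averaged"
    using T_measurable measurable_cong_sets[OF sets_\<mu> sets_\<mu>]
      measurable_cong_sets[OF sets_averaged sets_averaged] by auto
  have "distr averaged averaged shift = averaged"
  proof (rule measure_eqI)
    fix A assume "A \<in> sets (distr averaged averaged shift)"
    then have A: "A \<in> sets (borel_shift X)" by (simp add: sets_averaged)
    let ?g = "\<lambda>j. emeasure resampled ((shift ^^ j) -` A \<inter> X)"
    have pre: "shift -` A \<inter> X \<in> sets (borel_shift X)"
      using measurable_sets[OF sh, of A] A by (simp add: sets_averaged)
    have step: "(shift ^^ j) -` (shift -` A \<inter> X) \<inter> X = (shift ^^ Suc j) -` A \<inter> X" for j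
      using funpow_space by auto
    \<comment> \<open>Shifting drops the summand \<open>?g 0\<close> and adds \<open>?g period\<close>, which is the same number.\<close>
    have wrap: "?g period = ?g 0"
    proof -
      have "?g period = emeasure (distr resampled resampled (shift ^^ period)) A"
        using A resampled.T_measurable by (subst emeasure_distr) (auto simp: sets_resampled)
      also have "\<dots> = emeasure resampled A" by (simp add: resampled_invariant)
      also have "\<dots> = ?g 0" using sets.sets_into_space[OF A] by (intro arg_cong[where f = "emeasure resampled"]) auto
      finally show ?thesis .
    qed
    have "emeasure (distr averaged averaged shift) A = emeasure averaged (shift -` A \<inter> X)"
      using A sh by (subst emeasure_distr) (auto simp: sets_averaged)
    also have "\<dots> = (\<Sum>j<period. ?g (Suc j)) / period" by (simp only: emeasure_averaged[OF pre] step)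
    also have "(\<Sum>j<period. ?g (Suc j)) = (\<Sum>j<2 * r. ?g (Suc j)) + ?g period" by (simp add: period_def)
    also have "\<dots> = ?g 0 + (\<Sum>j<2 * r. ?g (Suc j))" by (simp only: wrap add.commute)
    also have "\<dots> = (\<Sum>j<period. ?g j)" unfolding period_def Suc_eq_plus1[symmetric] by (rule sum.lessThan_Suc_shift[symmetric])
    also have "\<dots> / period = emeasure averaged A" by (rule emeasure_averaged[OF A, symmetric])
    finally show "emeasure (distr averaged averaged shift) A = emeasure averaged A" .
  qed simp
  then show ?thesis by (simp add: invariant_measures_def prob_space_averaged sets_averaged)
qed

lemma emeasure_averaged_fibre:
  assumes A: "A \<in> sets \<mu>"
    and fib: "\<And>x y. x \<in> X \<Longrightarrow> y \<in> X \<Longrightarrow> (\<And>i. \<pi>\<^sub>b (x i) = \<pi>\<^sub>b (y i)) \<Longrightarrow> x \<in> A \<longleftrightarrow> y \<in> A"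
  shows "emeasure averaged A = emeasure \<mu> A"
proof -
  have "emeasure resampled ((shift ^^ j) -` A \<inter> X) = emeasure \<mu> A" for j
  proof -
    have Aj: "(shift ^^ j) -` A \<inter> X \<in> sets \<mu>"
      using measurable_sets[OF funpow_measurable A, of j] by simp
    have "emeasure resampled ((shift ^^ j) -` A \<inter> X) = emeasure \<mu> ((shift ^^ j) -` A \<inter> X)"
    proof (rule emeasure_resampled_fibre[OF Aj])
      fix x \<omega> assume x: "x \<in> X" and o: "\<omega> \<in> space choices"
      have "(shift ^^ j) (resample x \<omega>) \<in> A \<longleftrightarrow> (shift ^^ j) x \<in> A"
        unfolding funpow_shift
        by (rule fib) (use x resample_in_X[OF x o] translate_mem_iff in blast,
            use x translate_mem_iff in blast, simp add: translate_def image_resample[OF x o])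
      then show "resample x \<omega> \<in> (shift ^^ j) -` A \<inter> X \<longleftrightarrow> x \<in> (shift ^^ j) -` A \<inter> X"
        using x resample_in_X[OF x o] by simp
    qed
    also have "\<dots> = emeasure (distr \<mu> \<mu> (shift ^^ j)) A"
      using emeasure_distr[OF funpow_measurable A, of j] by simp
    finally show ?thesis by (simp add: funpow_invariant)
  qed
  then show ?thesis
    using A sets_\<mu> period_pos
    by (simp add: emeasure_averaged emeasure_eq_measure ennreal_of_nat_eq_real_of_nat divide_ennreal
        flip: ennreal_mult')
qed

text \<open>A stretch of \<open>m + 3\<close> periods that begins at \<open>j < period\<close> contains the windows number \<open>2\<close> to
  \<open>m + 1\<close>, whatever \<open>j\<close> is. Hence every translate of the resampled measure has at least the entropy of
  \<open>m\<close> words, and concavity passes this on to the average.\<close>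

lemma shannon_averaged_ge:
  "shannon resampled (itinerary (shift ^^ period) (word_at 0) m)
    \<le> shannon averaged (itinerary shift (letter_code X) ((m + 3) * period))"
proof -
  let ?L = "(m + 3) * period"
  let ?f = "itinerary shift (letter_code X) ?L" and ?V = "itinerary (shift ^^ period) (word_at 0) m"
  let ?\<mu> = "\<lambda>j. distr resampled (borel_shift X) (shift ^^ j)"
  have f: "simple_function \<mu>' ?f" if "sets \<mu>' = sets (borel_shift X)" for \<mu>'
  proof -
    have s: "sets \<mu>' = sets \<mu>" using that by (simp add: sets_\<mu>)
    show ?thesis
      using simple_function_itinerary[OF simple_letter_code, of ?L]
      by (rule simple_function_cong_algebra[OF s sets_eq_imp_space_eq[OF s], THEN iffD1])
  qed
  have V: "simple_function resampled ?V"
    by (rule resampled.simple_function_itinerary[OF simple_word_at[OF sets_resampled]])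
  have "shannon resampled ?V \<le> shannon (?\<mu> j) ?f" if j: "j < period" for j
  proof -
    have "shannon resampled ?V = shannon resampled (\<lambda>x. ?V (((shift ^^ period) ^^ 2) x))"
      by (rule resampled.shannon_funpow[OF V, symmetric])
    also have "\<dots> \<le> shannon resampled (\<lambda>x. ?f ((shift ^^ j) x))"
    proof (rule shannon_mono[OF prob_space_resampled])
      have "simple_function \<mu> (\<lambda>x. ?f ((shift ^^ j) x))"
        by (rule simple_function_funpow[OF f[OF sets_\<mu>]])
      then show "simple_function resampled (\<lambda>x. ?f ((shift ^^ j) x))"
        by (rule simple_function_cong_algebra[THEN iffD1, rotated 2]) (simp_all add: sets_\<mu> sets_resampled)
      fix x y assume x: "x \<in> space resampled" and y: "y \<in> space resampled"
        and eq: "?f ((shift ^^ j) x) = ?f ((shift ^^ j) y)"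
      have agree: "x i = y i" if "int j \<le> i" "i < int j + int ?L" for i
      proof -
        have "\<forall>i\<in>{0..<int ?L}. translate (int j) x i = translate (int j) y i"
          using eq itinerary_letter_code_eq_iff[of "translate (int j) x" "translate (int j) y" ?L] x y
          by (simp add: funpow_shift translate_mem_iff)
        then have "translate (int j) x (i - int j) = translate (int j) y (i - int j)" using that by simp
        then show ?thesis by (simp add: translate_def)
      qed
      have "word_at (int k + 2) x = word_at (int k + 2) y" if k: "k < m" for k
      proof -
        have "word_at (int k + 2) x i = word_at (int k + 2) y i" for i
        proof (cases "i \<in> window")
          case True
          have "int k * int period \<le> (int m - 1) * int period" using k by (intro mult_right_mono) auto
          then have "int k * int period \<le> int m * int period - int period" by (simp only: left_diff_distrib mult_1)
          moreover have "0 \<le> int k * int period" by simp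
          moreover have "int ?L = int m * int period + 3 * int period"
            by (simp only: of_nat_mult of_nat_add of_nat_numeral distrib_right)
          moreover have "(int k + 2) * int period = int k * int period + 2 * int period" by (rule distrib_right)
          moreover have "int j < int period" "- int r \<le> i" "i \<le> int r" "int period = 2 * int r + 1"
            using True j by (auto simp: period_def)
          ultimately have "int j \<le> (int k + 2) * int period + i" "(int k + 2) * int period + i < int j + int ?L"
            by linarith+
          then show ?thesis using True agree by (simp add: word_at_apply)
        qed (auto simp: word_at_def)
        then show ?thesis by (rule ext)
      qed
      moreover have "word_at 0 (((shift ^^ period) ^^ k) (((shift ^^ period) ^^ 2) z)) = word_at (int k + 2) z" for k z
        using word_at_block_shift[of "k + 2" z] by (simp only: funpow_add comp_def) (simp add: add.commute)
      ultimately show "?V (((shift ^^ period) ^^ 2) x) = ?V (((shift ^^ period) ^^ 2) y)"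
        unfolding itinerary_eq_iff by simp
    qed
    also have "\<dots> = shannon (?\<mu> j) ?f"
      by (rule shannon_distr[OF shift_funpow_resampled f[OF refl], symmetric])
    finally show ?thesis .
  qed
  then have "(\<Sum>j<period. shannon resampled ?V) \<le> (\<Sum>j<period. shannon (?\<mu> j) ?f)"
    by (intro sum_mono) auto
  then have "shannon resampled ?V \<le> (\<Sum>j<period. shannon (?\<mu> j) ?f) / card {..<period}"
    using period_pos by (simp add: field_simps)
  also have "\<dots> \<le> shannon averaged ?f"
  proof (rule shannon_concave)
    fix A assume A: "A \<in> sets averaged"
    then have A': "A \<in> sets (borel_shift X)" by (simp add: sets_averaged)
    interpret av: prob_space averaged by (rule prob_space_averaged)
    have "ennreal (measure averaged A) = (\<Sum>j<period. emeasure resampled ((shift ^^ j) -` A \<inter> X)) / period"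
      using emeasure_averaged[OF A'] by (simp add: av.emeasure_eq_measure)
    also have "\<dots> = (\<Sum>j<period. ennreal (measure (?\<mu> j) A)) / period"
      using A' by (simp add: measure_distr[OF shift_funpow_resampled] resampled.emeasure_eq_measure)
    also have "\<dots> = ennreal ((\<Sum>j<period. measure (?\<mu> j) A) / period)"
      using period_pos by (simp add: ennreal_of_nat_eq_real_of_nat divide_ennreal sum_nonneg)
    finally show "measure averaged A = (\<Sum>j\<in>{..<period}. measure (?\<mu> j) A) / card {..<period}"
      by (subst (asm) ennreal_inj) (auto simp: sum_nonneg)
  qed (use period_pos prob_space_shifted prob_space_averaged f[OF sets_averaged] in \<open>auto simp: sets_averaged\<close>)
  finally show ?thesis .
qed

text \<open>Each window begins \<open>r\<close> places before a multiple of the period, so one window more than the number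
  of periods is needed to cover \<open>{0..<m * period}\<close>.\<close>

lemma shannon_letters_le_words:
  "shannon \<mu> (itinerary shift (letter_code X) (m * period))
    \<le> shannon \<mu> (itinerary (shift ^^ period) (word_at 0) (m + 1))"
proof (rule shannon_mono[OF prob_space_M])
  show "simple_function \<mu> (itinerary (shift ^^ period) (word_at 0) (m + 1))"
    by (rule block_shift.simple_function_itinerary[OF simple_word_at[OF sets_\<mu>]])
  fix x y assume x: "x \<in> space \<mu>" and y: "y \<in> space \<mu>"
    and eq: "itinerary (shift ^^ period) (word_at 0) (m + 1) x = itinerary (shift ^^ period) (word_at 0) (m + 1) y"
  have words_eq: "word_at (int k) x = word_at (int k) y" if "k < m + 1" for k
    using eq that by (simp add: itinerary_eq_iff word_at_block_shift)
  have "x i = y i" if i: "0 \<le> i" "i < int (m * period)" for i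
  proof -
    obtain k j where kj: "i = k * int period + j" "j \<in> window" by (rule block_decomposition)
    have "(- 1) * int period < k * int period" using kj i by (auto simp: period_def algebra_simps)
    then have "-1 < k" using period_pos by (subst (asm) mult_less_cancel_right) auto
    moreover have "k * int period < (int m + 1) * int period"
      using kj i by (auto simp: period_def algebra_simps)
    then have "k < int m + 1" using period_pos by (subst (asm) mult_less_cancel_right) auto
    ultimately have "word_at k x = word_at k y" using words_eq[of "nat k"] by simp
    then have "word_at k x j = word_at k y j" by simp
    then show ?thesis using kj by (simp add: word_at_apply)
  qed
  then show "itinerary shift (letter_code X) (m * period) x = itinerary shift (letter_code X) (m * period) y"
    using x y by (subst itinerary_letter_code_eq_iff) auto
qed

text \<open>The bracket is the conditional entropy under \<open>\<mu>\<close> of the word given its class.\<close>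

definition entropy_gain :: real where
  "entropy_gain = mean_log_card - (shannon \<mu> (word_at 0) - shannon \<mu> block_class)"

lemma shannon_averaged_gain:
  "shannon \<mu> (itinerary shift (letter_code X) (m * period)) + real (m + 1) * entropy_gain
    \<le> shannon averaged (itinerary shift (letter_code X) ((m + 4) * period))"
proof -
  let ?S = "shift ^^ period"
  have "shannon \<mu> (itinerary shift (letter_code X) (m * period))
      \<le> shannon \<mu> (itinerary ?S (word_at 0) (m + 1))"
    by (rule shannon_letters_le_words)
  also have "\<dots> \<le> shannon \<mu> (itinerary ?S block_class (m + 1))
      + real (m + 1) * (shannon \<mu> (word_at 0) - shannon \<mu> block_class)"
    using block_shift.shannon_itinerary_le_factor[OF simple_word_at[OF sets_\<mu>], of 0 "m + 1" fibre_class] by simp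
  finally have "shannon \<mu> (itinerary shift (letter_code X) (m * period)) + real (m + 1) * entropy_gain
      \<le> shannon \<mu> (itinerary ?S block_class (m + 1)) + real (m + 1) * mean_log_card"
    by (simp add: entropy_gain_def algebra_simps)
  also have "\<dots> \<le> shannon resampled (itinerary ?S (word_at 0) (m + 1))"
    using shannon_resampled_ge[of "m + 1"] by simp
  also have "\<dots> \<le> shannon averaged (itinerary shift (letter_code X) ((m + 1 + 3) * period))"
    by (rule shannon_averaged_ge)
  also have "m + 1 + 3 = m + 4" by simp
  finally show ?thesis .
qed

text \<open>Division of \<open>shannon_averaged_gain\<close> by the length of the stretch; the four additional periods do
  not matter in the limit.\<close>

lemma partition_entropy_averaged_ge:
  "partition_entropy \<mu> shift (letter_code X) + entropy_gain / period
    \<le> partition_entropy averaged shift (letter_code X)"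
proof -
  interpret av: invariant_shift_measure X averaged
    by unfold_locales (use finite_alphabet shift_closed averaged_invariant in auto)
  let ?a = "\<lambda>n. shannon \<mu> (itinerary shift (letter_code X) n) / real n"
  let ?b = "\<lambda>n. shannon averaged (itinerary shift (letter_code X) n) / real n"
  have N: "0 < real period" using period_pos by simp
  have "?a (m * period) + (1 + 1 / m) * (entropy_gain / period) \<le> ?b ((m + 4) * period) * (1 + 4 / m)"
    if m: "1 \<le> m" for m :: nat
  proof -
    define A where "A = shannon \<mu> (itinerary shift (letter_code X) (m * period))"
    define B where "B = shannon averaged (itinerary shift (letter_code X) ((m + 4) * period))"
    have "0 < real m" using m by simp
    have "(A + (real m + 1) * entropy_gain) / (real m * period) \<le> B / (real m * period)"
      using shannon_averaged_gain[of m] unfolding A_def B_def by (intro divide_right_mono) (auto simp: add.commute)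
    moreover have "A / real (m * period) + (1 + 1 / real m) * (entropy_gain / period)
        = (A + (real m + 1) * entropy_gain) / (real m * period)"
      using \<open>0 < real m\<close> N by (simp add: field_simps)
    moreover have "B / real ((m + 4) * period) * (1 + 4 / real m) = B / (real m * period)"
    proof -
      have "1 + 4 / real m = (real m + 4) / real m" using \<open>0 < real m\<close> by (simp add: field_simps)
      then show ?thesis using \<open>0 < real m\<close> N by (simp add: mult.commute)
    qed
    ultimately show ?thesis by (simp only: A_def B_def)
  qed
  moreover have "(\<lambda>m. ?a (m * period) + (1 + 1 / real m) * (entropy_gain / period))
      \<longlonglongrightarrow> partition_entropy \<mu> shift (letter_code X) + (1 + 0) * (entropy_gain / period)"
  proof (intro tendsto_intros lim_const_over_n)
    show "(\<lambda>m. ?a (m * period)) \<longlonglongrightarrow> partition_entropy \<mu> shift (letter_code X)"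
      using period_pos
      by (intro filterlim_compose[OF partition_entropy_limit[OF simple_letter_code]] mult_nat_right_at_top)
  qed
  moreover have "(\<lambda>m. ?b ((m + 4) * period) * (1 + 4 / real m))
      \<longlonglongrightarrow> partition_entropy averaged shift (letter_code X) * (1 + 0)"
  proof (intro tendsto_intros lim_const_over_n)
    have "(\<lambda>m. ?b (m * period)) \<longlonglongrightarrow> partition_entropy averaged shift (letter_code X)"
      using period_pos
      by (intro filterlim_compose[OF av.partition_entropy_limit[OF av.simple_letter_code]] mult_nat_right_at_top)
    then show "(\<lambda>m. ?b ((m + 4) * period)) \<longlonglongrightarrow> partition_entropy averaged shift (letter_code X)"
      by (rule LIMSEQ_ignore_initial_segment)
  qed
  ultimately have "partition_entropy \<mu> shift (letter_code X) + (1 + 0) * (entropy_gain / period)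
      \<le> partition_entropy averaged shift (letter_code X) * (1 + 0)"
    by (intro LIMSEQ_le) blast+
  then show ?thesis by simp
qed

lemma entropy_gain_nonpos:
  assumes "ks_entropy averaged shift \<le> ks_entropy \<mu> shift"
  shows "entropy_gain \<le> 0"
proof -
  interpret av: invariant_shift_measure X averaged
    by unfold_locales (use finite_alphabet shift_closed averaged_invariant in auto)
  have "partition_entropy averaged shift (letter_code X) \<le> partition_entropy \<mu> shift (letter_code X)"
    using assms unfolding ks_entropy_letter_code av.ks_entropy_letter_code by simp
  then have "entropy_gain / period \<le> 0" using partition_entropy_averaged_ge by linarith
  then show ?thesis using period_pos by (simp add: divide_le_0_iff)
qed

text \<open>The right-hand side, as a function of \<open>v\<close>, is a probability distribution on words, and the cross
  entropy of the law of the word against it is \<open>H(c) + E ln |c|\<close>. If the gain is not positive, then this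
  is at most \<open>H(V)\<close>, and Gibbs' inequality is an equality.\<close>

lemma uniform_on_classes:
  assumes max: "ks_entropy averaged shift \<le> ks_entropy \<mu> shift" and v: "v \<in> words"
  shows "mass_at \<mu> (word_at 0) v = mass_at \<mu> block_class (fibre_class v) / card (fibre_class v)"
proof -
  let ?p = "mass_at \<mu> (word_at 0)" and ?P = "mass_at \<mu> block_class"
  let ?q = "\<lambda>v. ?P (fibre_class v) / card (fibre_class v)"
  have V: "simple_function \<mu> (word_at 0)" by (rule simple_word_at[OF sets_\<mu>])
  have sub: "word_at 0 ` space \<mu> \<subseteq> words" using word_at_in_words by auto
  note * = prob_space_M V finite_words sub
  have card_pos: "0 < real (card (fibre_class v))" if "v \<in> words" for v
    using finite_fibre_class fibre_class_refl[OF that] by (auto simp: card_gt_0_iff)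
  have q_sum: "sum ?q words = 1"
  proof -
    have "sum ?q words = (\<Sum>C\<in>classes. \<Sum>v\<in>{v \<in> words. fibre_class v = C}. ?q v)"
      using finite_words by (rule sum.image_gen)
    also have "\<dots> = (\<Sum>C\<in>classes. ?P C)"
    proof (rule sum.cong[OF refl])
      fix C assume "C \<in> classes"
      then obtain u where u: "u \<in> words" "C = fibre_class u" by blast
      have "{v \<in> words. fibre_class v = C} = C"
        using fibre_class_eq_iff[of _ u] fibre_class_subset[of u] unfolding u(2) by blast
      moreover have "(\<Sum>v\<in>{v \<in> words. fibre_class v = C}. ?q v) = (\<Sum>v\<in>{v \<in> words. fibre_class v = C}. ?P C / card C)"
        by (rule sum.cong) auto
      ultimately show "(\<Sum>v\<in>{v \<in> words. fibre_class v = C}. ?q v) = ?P C"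
        using card_pos[OF u(1)] by (simp add: u(2))
    qed
    also have "\<dots> = 1"
      using sub by (intro sum_mass_at[OF prob_space_M simple_class_at[OF sets_\<mu>]]) (auto simp: finite_words)
    finally show ?thesis .
  qed
  have le: "?p v \<le> ?P (fibre_class v)" for v
    by (rule mass_at_le_compose[OF prob_space_M V])
  have "(\<Sum>v\<in>words. - (?p v * ln (?q v)))
      = (\<Sum>v\<in>words. - (?p v * ln (?P (fibre_class v))) + ?p v * ln (card (fibre_class v)))"
  proof (rule sum.cong[OF refl])
    fix v assume v: "v \<in> words"
    show "- (?p v * ln (?q v)) = - (?p v * ln (?P (fibre_class v))) + ?p v * ln (card (fibre_class v))"
    proof (cases "?p v = 0")
      case False
      then have "0 < ?P (fibre_class v)" using le[of v] mass_at_nonneg[of \<mu> "word_at 0" v] by linarith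
      then show ?thesis using card_pos[OF v] by (simp add: ln_div algebra_simps)
    qed simp
  qed
  also have "\<dots> = shannon \<mu> block_class + mean_log_card"
    unfolding sum.distrib mean_log_card_def
    using shannon_compose[OF *, of fibre_class] sum_mass_at_compose[OF *, of "\<lambda>C. ln (real (card C))" fibre_class]
    by simp
  also have "\<dots> \<le> shannon \<mu> (word_at 0)"
    using entropy_gain_nonpos[OF max] by (simp add: entropy_gain_def)
  also have "\<dots> = (\<Sum>v\<in>words. - (?p v * ln (?p v)))"
    using finite_words sub by (rule shannon_superset)
  finally have le_p: "(\<Sum>v\<in>words. - (?p v * ln (?q v))) \<le> (\<Sum>v\<in>words. - (?p v * ln (?p v)))" .
  have sum_le: "sum ?q words \<le> sum ?p words" using q_sum sum_mass_at[OF *] by simp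
  show ?thesis
  proof (rule gibbs_equality[OF finite_words _ _ _ sum_le le_p v])
    fix s assume "s \<in> words" "0 < ?p s"
    then show "0 < ?q s" using le[of s] card_pos[of s] by (intro divide_pos_pos) auto
  qed auto
qed

end

section \<open>Fibre classes and extensions of configurations\<close>

lemma integral_compose_simple:
  fixes k :: "'v \<Rightarrow> real"
  assumes M: "prob_space M" and f: "simple_function M f" and S: "finite S" "f ` space M \<subseteq> S"
  shows "(\<integral>x. k (f x) \<partial>M) = (\<Sum>v\<in>S. mass_at M f v * k v)"
    and "integrable M (\<lambda>x. k (f x))"
proof -
  interpret prob_space M by fact
  let ?E = "\<lambda>v. f -` {v} \<inter> space M"
  have E: "?E v \<in> sets M" for v using f by (rule simple_functionD)
  have eq: "k (f x) = (\<Sum>v\<in>S. k v * indicator (?E v) x)" if "x \<in> space M" for x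
  proof -
    have "(\<Sum>v\<in>S. k v * indicator (?E v) x) = (\<Sum>v\<in>S. if f x = v then k v else 0)"
      using that by (intro sum.cong) (auto simp: indicator_def)
    then show ?thesis using that S by auto
  qed
  have int: "integrable M (\<lambda>x. k v * indicator (?E v) x)" for v
    using E by (intro integrable_mult_right integrable_real_indicator) (auto simp: emeasure_eq_measure)
  have "(\<integral>x. k (f x) \<partial>M) = (\<integral>x. (\<Sum>v\<in>S. k v * indicator (?E v) x) \<partial>M)"
    by (rule Bochner_Integration.integral_cong[OF refl eq])
  also have "\<dots> = (\<Sum>v\<in>S. \<integral>x. k v * indicator (?E v) x \<partial>M)"
    using int by (rule Bochner_Integration.integral_sum)
  also have "\<dots> = (\<Sum>v\<in>S. mass_at M f v * k v)"
    using E by (intro sum.cong refl) (simp add: mass_at_def mult.commute)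
  finally show "(\<integral>x. k (f x) \<partial>M) = (\<Sum>v\<in>S. mass_at M f v * k v)" .
  have "integrable M (\<lambda>x. \<Sum>v\<in>S. k v * indicator (?E v) x)"
    using int by (rule Bochner_Integration.integrable_sum)
  moreover have "integrable M (\<lambda>x. k (f x)) \<longleftrightarrow> integrable M (\<lambda>x. \<Sum>v\<in>S. k v * indicator (?E v) x)"
    by (rule Bochner_Integration.integrable_cong[OF refl eq])
  ultimately show "integrable M (\<lambda>x. k (f x))" by blast
qed

definition agree_outside ::
  "('a \<Rightarrow> 'b) \<Rightarrow> int set \<Rightarrow> nat \<Rightarrow> (int \<Rightarrow> 'a) \<Rightarrow> (int \<Rightarrow> 'a) \<Rightarrow> bool" where
  "agree_outside \<pi>\<^sub>b G r x y \<longleftrightarrow>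
    (\<forall>i\<in>{- int r..int r} - G. x i = y i) \<and> (\<forall>i\<in>G. \<pi>\<^sub>b (x i) = \<pi>\<^sub>b (y i))"

context one_step_shift
begin

definition overlay :: "int set \<Rightarrow> (int \<Rightarrow> 'a) \<Rightarrow> (int \<Rightarrow> 'a) \<Rightarrow> (int \<Rightarrow> 'a)" where
  "overlay G \<alpha> x = (\<lambda>i. if i \<in> G then \<alpha> i else x i)"

text \<open>Every pair of adjacent positions either lies in \<open>G \<union> outer_boundary G\<close>, where the new point looks
  like \<open>z\<close>, or misses \<open>G\<close>, where it looks like \<open>x\<close>.\<close>

lemma overlay_in_X:
  assumes x: "x \<in> X" and z: "z \<in> X"
    and near: "\<And>i. i \<in> G \<union> outer_boundary G \<Longrightarrow> overlay G \<alpha> x i = z i"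
  shows "overlay G \<alpha> x \<in> X"
  unfolding mem_iff_allowed
proof
  fix i
  show "allowed (overlay G \<alpha> x i) (overlay G \<alpha> x (i + 1))"
  proof (cases "i \<in> G \<or> i + 1 \<in> G")
    case True
    then have "i \<in> G \<union> outer_boundary G" "i + 1 \<in> G \<union> outer_boundary G"
      by (auto simp: outer_boundary_def intro: bexI[of _ i] bexI[of _ "i + 1"])
    then show ?thesis using near allowedI[OF z, of i] by simp
  next
    case False
    then show ?thesis using allowedI[OF x, of i] by (simp add: overlay_def)
  qed
qed

lemma extends_boundary_iff:
  assumes x: "x \<in> X"
  shows "extends_boundary X G \<alpha> x \<longleftrightarrow> overlay G \<alpha> x \<in> X"
proof
  let ?H = "G \<union> outer_boundary G"
  assume "extends_boundary X G \<alpha> x"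
  then obtain z where z: "z \<in> X" "restrict (overlay G \<alpha> x) ?H = restrict z ?H"
    by (auto simp: extends_boundary_def configurations_def overlay_def)
  show "overlay G \<alpha> x \<in> X"
  proof (rule overlay_in_X[OF x z(1)])
    fix i assume "i \<in> ?H"
    then show "overlay G \<alpha> x i = z i" using z(2) by (metis restrict_apply')
  qed
next
  assume "overlay G \<alpha> x \<in> X"
  then show "extends_boundary X G \<alpha> x"
    unfolding extends_boundary_def configurations_def
    by (rule rev_image_eqI) (simp add: overlay_def)
qed

end

context resampling
begin

lemma word_at_0: "word_at 0 x = restrict x window"
  by (simp add: word_at_def translate_def)

lemma G_window: "G \<union> outer_boundary G \<subseteq> window" "G \<subseteq> window"
proof -
  show "G \<subseteq> window" using G_inner by auto
  have "i \<in> window" if i: "i \<in> outer_boundary G" for i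
  proof -
    obtain j where "j \<in> G" "\<bar>i - j\<bar> = 1" using i by (auto simp: outer_boundary_def)
    then show ?thesis using subsetD[OF G_inner, of j] by auto
  qed
  then show "G \<union> outer_boundary G \<subseteq> window" using \<open>G \<subseteq> window\<close> by blast
qed

lemma finite_G: "finite G"
  using finite_subset[OF G_window(2)] by simp

lemma mem_fibre_class_word_at:
  "v \<in> fibre_class (word_at 0 x) \<longleftrightarrow> v \<in> words \<and> agree_outside \<pi>\<^sub>b G r v x"
  using G_window by (auto simp: fibre_class_def agree_outside_def word_at_0)

lemma block_class_eq_iff:
  assumes "x \<in> X" "y \<in> X"
  shows "fibre_class (word_at 0 x) = fibre_class (word_at 0 y) \<longleftrightarrow> agree_outside \<pi>\<^sub>b G r x y"
proof -
  have "word_at 0 x \<in> words" using assms(1) by (rule word_at_in_words)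
  then have "fibre_class (word_at 0 x) = fibre_class (word_at 0 y) \<longleftrightarrow> agree_outside \<pi>\<^sub>b G r (word_at 0 x) y"
    using fibre_class_eq_iff mem_fibre_class_word_at by blast
  also have "\<dots> \<longleftrightarrow> agree_outside \<pi>\<^sub>b G r x y"
    using G_window(2) by (auto simp: agree_outside_def word_at_0)
  finally show ?thesis .
qed

definition extensions :: "(int \<Rightarrow> 'a) \<Rightarrow> (int \<Rightarrow> 'a) set" where
  "extensions x = {\<beta> \<in> configurations X G. extends_boundary X G \<beta> x \<and> same_image_on \<pi>\<^sub>b G \<beta> x}"

text \<open>A word in the class of \<open>x\<close> is determined by its letters on \<open>G\<close>, since off \<open>G\<close> it carries those of \<open>x\<close>.
  This identifies the class with the set counted by \<open>num_extensions\<close>.\<close>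

lemma extensions_bij:
  assumes x: "x \<in> X"
  shows "bij_betw (\<lambda>v. restrict v G) (fibre_class (word_at 0 x)) (extensions x)"
proof (rule bij_betw_byWitness[where f' = "\<lambda>\<beta>. restrict (overlay G \<beta> x) window"])
  let ?C = "fibre_class (word_at 0 x)"
  have on_window: "overlay G (restrict v G) x i = v i" if "v \<in> ?C" "i \<in> window" for v i
    using that by (auto simp: mem_fibre_class_word_at agree_outside_def overlay_def)
  show "\<forall>v\<in>?C. restrict (overlay G (restrict v G) x) window = v"
  proof
    fix v assume v: "v \<in> ?C"
    then have "v \<in> extensional window" by (auto simp: fibre_class_def configurations_def)
    then show "restrict (overlay G (restrict v G) x) window = v"
      using on_window[OF v] by (intro extensionalityI[of _ window]) auto
  qed
  show "\<forall>\<beta>\<in>extensions x. restrict (restrict (overlay G \<beta> x) window) G = \<beta>"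
  proof
    fix \<beta> assume "\<beta> \<in> extensions x"
    then have "\<beta> \<in> extensional G" by (auto simp: extensions_def configurations_def)
    then show "restrict (restrict (overlay G \<beta> x) window) G = \<beta>"
      using G_window(2) by (intro extensionalityI[of _ G]) (auto simp: overlay_def)
  qed
  show "(\<lambda>v. restrict v G) ` ?C \<subseteq> extensions x"
  proof (rule image_subsetI)
    fix v assume v: "v \<in> ?C"
    then obtain z where z: "z \<in> X" "v = restrict z window"
      by (auto simp: fibre_class_def configurations_def)
    have "restrict v G = restrict z G" using G_window(2) by (auto simp: z(2) fun_eq_iff)
    then have "restrict v G \<in> configurations X G" using z(1) by (auto simp: configurations_def)
    moreover have "overlay G (restrict v G) x \<in> X"
    proof (rule overlay_in_X[OF x z(1)])
      fix i assume "i \<in> G \<union> outer_boundary G"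
      then have "i \<in> window" using G_window(1) by blast
      then show "overlay G (restrict v G) x i = z i" using on_window[OF v, of i] by (simp add: z(2))
    qed
    moreover have "same_image_on \<pi>\<^sub>b G (restrict v G) x"
      using v by (auto simp: same_image_on_def mem_fibre_class_word_at agree_outside_def)
    ultimately show "restrict v G \<in> extensions x"
      by (simp add: extensions_def extends_boundary_iff[OF x])
  qed
  show "(\<lambda>\<beta>. restrict (overlay G \<beta> x) window) ` extensions x \<subseteq> ?C"
  proof (rule image_subsetI)
    fix \<beta> assume \<beta>: "\<beta> \<in> extensions x"
    then have "overlay G \<beta> x \<in> X" by (simp add: extensions_def extends_boundary_iff[OF x])
    then have "restrict (overlay G \<beta> x) window \<in> words" by (simp add: configurations_def)
    moreover have "agree_outside \<pi>\<^sub>b G r (restrict (overlay G \<beta> x) window) x"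
      using \<beta> G_window(2) by (auto simp: agree_outside_def overlay_def extensions_def same_image_on_def)
    ultimately show "restrict (overlay G \<beta> x) window \<in> ?C" by (simp add: mem_fibre_class_word_at)
  qed
qed

lemma num_extensions_eq_card: "x \<in> X \<Longrightarrow> num_extensions X \<pi>\<^sub>b G x = card (fibre_class (word_at 0 x))"
  using bij_betw_same_card[OF extensions_bij] by (simp add: num_extensions_def extensions_def)

text \<open>The probability of \<open>\<alpha>\<close> on \<open>G\<close> under the uniform distribution on the class \<open>C\<close>; the words of a fibre
  class agree off \<open>G\<close>, so the numerator is then \<open>0\<close> or \<open>1\<close>.\<close>

definition class_weight :: "(int \<Rightarrow> 'a) \<Rightarrow> (int \<Rightarrow> 'a) set \<Rightarrow> real" where
  "class_weight \<alpha> C = card {v \<in> C. restrict v G = \<alpha>} / card C"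

lemma class_weight_word_at:
  assumes x: "x \<in> X" and \<alpha>: "\<alpha> \<in> configurations X G"
  shows "class_weight \<alpha> (fibre_class (word_at 0 x)) =
    (if extends_boundary X G \<alpha> x \<and> same_image_on \<pi>\<^sub>b G \<alpha> x then 1 / real (num_extensions X \<pi>\<^sub>b G x) else 0)"
proof -
  let ?C = "fibre_class (word_at 0 x)" and ?S = "{v \<in> fibre_class (word_at 0 x). restrict v G = \<alpha>}"
  have inj: "inj_on (\<lambda>v. restrict v G) ?C" and im: "(\<lambda>v. restrict v G) ` ?C = extensions x"
    using extensions_bij[OF x] by (auto simp: bij_betw_def)
  have cond: "extends_boundary X G \<alpha> x \<and> same_image_on \<pi>\<^sub>b G \<alpha> x \<longleftrightarrow> \<alpha> \<in> extensions x"
    using \<alpha> by (simp add: extensions_def)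
  show ?thesis
  proof (cases "\<alpha> \<in> extensions x")
    case True
    then have "\<alpha> \<in> (\<lambda>v. restrict v G) ` ?C" by (simp only: im)
    then obtain v where v: "v \<in> ?C" "restrict v G = \<alpha>" by (rule imageE) simp
    have "w = v" if "w \<in> ?S" for w
      using inj_onD[OF inj, of w v] that v by simp
    then have "?S = {v}" using v by blast
    then have "class_weight \<alpha> ?C = 1 / real (card ?C)" by (simp only: class_weight_def) simp
    then show ?thesis using True unfolding cond by (simp only: num_extensions_eq_card[OF x]) simp
  next
    case False
    have "restrict v G \<noteq> \<alpha>" if "v \<in> ?C" for v
      using imageI[OF that, of "\<lambda>v. restrict v G"] False unfolding im by metis
    then have "?S = {}" by blast
    then have "class_weight \<alpha> ?C = 0" by (simp only: class_weight_def) simp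
    then show ?thesis using False unfolding cond by simp
  qed
qed

end

context resampled_measure
begin

lemma integral_block_class:
  fixes k :: "(int \<Rightarrow> 'a) set \<Rightarrow> real"
  shows "(\<integral>x. k (block_class x) \<partial>\<mu>) = (\<Sum>C\<in>classes. mass_at \<mu> block_class C * k C)"
    and "integrable \<mu> (\<lambda>x. k (block_class x))"
proof -
  have "finite classes" "block_class ` space \<mu> \<subseteq> classes"
    using finite_words word_at_in_words by auto
  note * = integral_compose_simple[OF prob_space_M simple_class_at[OF sets_\<mu>] this]
  show "(\<integral>x. k (block_class x) \<partial>\<mu>) = (\<Sum>C\<in>classes. mass_at \<mu> block_class C * k C)" by (rule *(1))
  show "integrable \<mu> (\<lambda>x. k (block_class x))" by (rule *(2))
qed

text \<open>Both integrals are finite sums over words; by \<open>uniform_on_classes\<close> the mass of a class spreads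
  evenly over its words.\<close>

lemma cylinder_mass_on_class_event:
  assumes max: "ks_entropy averaged shift \<le> ks_entropy \<mu> shift"
  shows "(\<integral>x. indicator {x \<in> X. block_class x \<in> U} x * indicator {x \<in> X. restrict x G = \<alpha>} x \<partial>\<mu>)
    = (\<integral>x. indicator {x \<in> X. block_class x \<in> U} x * class_weight \<alpha> (block_class x) \<partial>\<mu>)"
proof -
  let ?h = "\<lambda>v. indicator U (fibre_class v) * (if restrict v G = \<alpha> then 1 else 0 :: real)"
  let ?P = "mass_at \<mu> block_class"
  have rest: "restrict (word_at 0 x) G = restrict x G" for x
    using G_window(2) by (auto simp: word_at_0 fun_eq_iff)
  have "(\<integral>x. indicator {x \<in> X. block_class x \<in> U} x * indicator {x \<in> X. restrict x G = \<alpha>} x \<partial>\<mu>)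
      = (\<integral>x. ?h (word_at 0 x) \<partial>\<mu>)"
    by (rule Bochner_Integration.integral_cong) (auto simp: indicator_def rest)
  also have "\<dots> = (\<Sum>v\<in>words. mass_at \<mu> (word_at 0) v * ?h v)"
    using word_at_in_words finite_words
    by (intro integral_compose_simple[OF prob_space_M simple_word_at[OF sets_\<mu>]]) auto
  also have "\<dots> = (\<Sum>v\<in>words. ?P (fibre_class v) / card (fibre_class v) * ?h v)"
    by (intro sum.cong refl) (simp only: uniform_on_classes[OF max])
  also have "\<dots> = (\<Sum>C\<in>classes. \<Sum>v\<in>{v \<in> words. fibre_class v = C}. ?P (fibre_class v) / card (fibre_class v) * ?h v)"
    using finite_words by (rule sum.image_gen)
  also have "\<dots> = (\<Sum>C\<in>classes. ?P C * (indicator U C * class_weight \<alpha> C))"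
  proof (rule sum.cong[OF refl])
    fix C assume "C \<in> classes"
    then obtain u where u: "u \<in> words" "C = fibre_class u" by blast
    have C: "{v \<in> words. fibre_class v = C} = C"
      using fibre_class_eq_iff[of _ u] fibre_class_subset[of u] unfolding u(2) by blast
    have "(\<Sum>v\<in>{v \<in> words. fibre_class v = C}. ?P (fibre_class v) / card (fibre_class v) * ?h v)
        = (\<Sum>v\<in>{v \<in> words. fibre_class v = C}. ?P C / card C * indicator U C * (if restrict v G = \<alpha> then 1 else 0))"
      by (rule sum.cong) auto
    also have "\<dots> = ?P C / card C * indicator U C * (\<Sum>v\<in>C. if restrict v G = \<alpha> then 1 else 0)"
      unfolding C by (rule sum_distrib_left[symmetric])
    also have "(\<Sum>v\<in>C. if restrict v G = \<alpha> then 1 else 0) = real (card {v \<in> C. restrict v G = \<alpha>})"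
      using finite_fibre_class[of u] by (simp add: u(2) sum.If_cases Int_def)
    finally show "(\<Sum>v\<in>{v \<in> words. fibre_class v = C}. ?P (fibre_class v) / card (fibre_class v) * ?h v)
        = ?P C * (indicator U C * class_weight \<alpha> C)"
      by (simp only: class_weight_def) simp
  qed
  also have "\<dots> = (\<integral>x. indicator U (block_class x) * class_weight \<alpha> (block_class x) \<partial>\<mu>)"
    by (rule integral_block_class(1)[symmetric])
  also have "\<dots> = (\<integral>x. indicator {x \<in> X. block_class x \<in> U} x * class_weight \<alpha> (block_class x) \<partial>\<mu>)"
    by (rule Bochner_Integration.integral_cong) (auto simp: indicator_def)
  finally show ?thesis .
qed

end

text \<open>Events that depend only on the coordinates near \<open>0\<close> outside \<open>G\<close> and on the image on \<open>G\<close>. Relations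
  for larger \<open>r\<close> are finer, so asking for all large \<open>r\<close> loses nothing and makes the family closed under
  intersections.\<close>

definition fibre_events :: "(int \<Rightarrow> 'a) set \<Rightarrow> ('a \<Rightarrow> 'b) \<Rightarrow> int set \<Rightarrow> (int \<Rightarrow> 'a) set set" where
  "fibre_events X \<pi>\<^sub>b G = {A. A \<subseteq> X \<and>
    (\<forall>\<^sub>F r in sequentially. \<forall>x\<in>X. \<forall>y\<in>X. agree_outside \<pi>\<^sub>b G r x y \<longrightarrow> (x \<in> A \<longleftrightarrow> y \<in> A))}"

lemma fibre_events_subset: "fibre_events X \<pi>\<^sub>b G \<subseteq> Pow X"
  by (auto simp: fibre_events_def)

lemma Int_stable_fibre_events: "Int_stable (fibre_events X \<pi>\<^sub>b G)"
proof (rule Int_stableI)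
  fix A B assume A: "A \<in> fibre_events X \<pi>\<^sub>b G" and B: "B \<in> fibre_events X \<pi>\<^sub>b G"
  let ?sat = "\<lambda>C r. \<forall>x\<in>X. \<forall>y\<in>X. agree_outside \<pi>\<^sub>b G r x y \<longrightarrow> (x \<in> C \<longleftrightarrow> y \<in> C)"
  have "\<forall>\<^sub>F r in sequentially. ?sat A r" "\<forall>\<^sub>F r in sequentially. ?sat B r"
    using A B by (simp_all add: fibre_events_def)
  then have "\<forall>\<^sub>F r in sequentially. ?sat (A \<inter> B) r"
    by eventually_elim blast
  moreover have "A \<inter> B \<subseteq> X" using A by (auto simp: fibre_events_def)
  ultimately show "A \<inter> B \<in> fibre_events X \<pi>\<^sub>b G"
    unfolding fibre_events_def by (intro CollectI conjI)
qed

lemma fibre_eventsI: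
  assumes "A \<subseteq> X"
    and "\<And>r x y. R \<le> r \<Longrightarrow> x \<in> X \<Longrightarrow> y \<in> X \<Longrightarrow> agree_outside \<pi>\<^sub>b G r x y \<Longrightarrow> x \<in> A \<Longrightarrow> y \<in> A"
  shows "A \<in> fibre_events X \<pi>\<^sub>b G"
proof -
  have "agree_outside \<pi>\<^sub>b G r x y \<longleftrightarrow> agree_outside \<pi>\<^sub>b G r y x" for r x y
    by (auto simp: agree_outside_def)
  then show ?thesis
    unfolding fibre_events_def eventually_sequentially using assms by blast
qed

section \<open>Conditioning on the image and on the outside configuration\<close>

definition conditioning_events ::
  "(int \<Rightarrow> 'a) set \<Rightarrow> ((int \<Rightarrow> 'a) \<Rightarrow> (int \<Rightarrow> 'b)) \<Rightarrow> int set \<Rightarrow> (int \<Rightarrow> 'a) set set" where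
  "conditioning_events X \<pi> S =
    {{x \<in> X. \<forall>k<length w. \<pi> x (i + int k) = w ! k} | i w. True} \<union> {{x \<in> X. x i = a} | i a. i \<in> S}"

lemma sets_conditioning_algebra:
  fixes \<pi> :: "(int \<Rightarrow> 'a) \<Rightarrow> (int \<Rightarrow> 'b)"
  assumes \<pi>: "\<pi> ` X \<subseteq> Y"
  shows "sets (conditioning_algebra X Y \<pi> S) = sigma_sets X (conditioning_events X \<pi> S)"
    and "space (conditioning_algebra X Y \<pi> S) = X"
proof -
  let ?cyl = "{{y \<in> Y. \<forall>k<length w. y (i + int k) = w ! k} | i w. True}"
  let ?V = "vimage_algebra X \<pi> (cylinder_algebra Y)"
  let ?A = "{{x \<in> X. \<forall>k<length w. \<pi> x (i + int k) = w ! k} | i w. True}"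
  let ?B = "{{x \<in> X. x i = a} | i a. i \<in> S}"
  have \<pi>Y: "\<pi> \<in> X \<rightarrow> Y" using \<pi> by blast
  have cyl: "?cyl \<subseteq> Pow Y" by blast
  have sp: "space (cylinder_algebra Y) = Y" and st: "sets (cylinder_algebra Y) = sigma_sets Y ?cyl"
    unfolding cylinder_algebra_def using cyl by (rule space_measure_of, rule sets_measure_of)
  have "sets ?V = {\<pi> -` A \<inter> X | A. A \<in> sets (cylinder_algebra Y)}"
    by (rule sets_vimage_algebra2) (use \<pi>Y sp in blast)
  also have "\<dots> = sigma_sets X {\<pi> -` A \<inter> X | A. A \<in> ?cyl}"
    unfolding st using \<pi>Y by (rule sigma_sets_vimage_commute)
  also have "{\<pi> -` A \<inter> X | A. A \<in> ?cyl} = ?A"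
  proof -
    have "\<pi> -` {y \<in> Y. \<forall>k<length w. y (i + int k) = w ! k} \<inter> X
        = {x \<in> X. \<forall>k<length w. \<pi> x (i + int k) = w ! k}" for i and w :: "'b list"
      using \<pi> by blast
    note eq = this
    have "{\<pi> -` A \<inter> X | A. A \<in> ?cyl} = {\<pi> -` {y \<in> Y. \<forall>k<length w. y (i + int k) = w ! k} \<inter> X | i w. True}"
      by blast
    then show ?thesis unfolding eq .
  qed
  finally have V: "sets ?V = sigma_sets X ?A" .
  have B: "?B \<subseteq> Pow X" by blast
  have C: "sets (coordinate_algebra X S) = sigma_sets X ?B"
    unfolding coordinate_algebra_def using B by (rule sets_measure_of)
  have Pow: "sets ?V \<union> sets (coordinate_algebra X S) \<subseteq> Pow X"
    unfolding V C using sigma_sets_into_sp[of ?A X] sigma_sets_into_sp[OF B] by blast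
  have "sigma_sets X (sigma_sets X ?A \<union> sigma_sets X ?B) = sigma_sets X (?A \<union> ?B)"
  proof (rule sigma_sets_eqI)
    show "a \<in> sigma_sets X (?A \<union> ?B)" if "a \<in> sigma_sets X ?A \<union> sigma_sets X ?B" for a
      using that sigma_sets_mono'[of ?A "?A \<union> ?B" X] sigma_sets_mono'[of ?B "?A \<union> ?B" X] by blast
    show "b \<in> sigma_sets X (sigma_sets X ?A \<union> sigma_sets X ?B)" if "b \<in> ?A \<union> ?B" for b
      using that by (blast intro: sigma_sets.Basic)
  qed
  then show "sets (conditioning_algebra X Y \<pi> S) = sigma_sets X (conditioning_events X \<pi> S)"
    unfolding conditioning_algebra_def sets_measure_of[OF Pow] unfolding V C conditioning_events_def .
  show "space (conditioning_algebra X Y \<pi> S) = X"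
    unfolding conditioning_algebra_def using Pow by (rule space_measure_of)
qed

text \<open>The image at a site outside \<open>G\<close> is a function of the letter there, so the generators
  reduce to the letters outside \<open>G\<close> and the image on \<open>G\<close>.\<close>

lemma conditioning_events_subset_fibre_events:
  assumes \<pi>: "\<forall>x\<in>X. \<forall>i. \<pi> x i = \<pi>\<^sub>b (x i)"
  shows "conditioning_events X \<pi> (- G) \<subseteq> fibre_events X \<pi>\<^sub>b G"
proof
  fix A assume A: "A \<in> conditioning_events X \<pi> (- G)"
  then consider (image) i and w :: "'b list" where "A = {x \<in> X. \<forall>k<length w. \<pi> x (i + int k) = w ! k}"
    | (letter) i a where "A = {x \<in> X. x i = a}" "i \<notin> G"
    unfolding conditioning_events_def by blast
  then show "A \<in> fibre_events X \<pi>\<^sub>b G"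
  proof cases
    case image
    show ?thesis
    proof (rule fibre_eventsI[where R = "nat \<bar>i\<bar> + length w"])
      fix r x y assume r: "nat \<bar>i\<bar> + length w \<le> r" and X: "x \<in> X" "y \<in> X"
        and xy: "agree_outside \<pi>\<^sub>b G r x y" and x: "x \<in> A"
      have "\<pi>\<^sub>b (y (i + int k)) = \<pi>\<^sub>b (x (i + int k))" if "k < length w" for k
      proof -
        have "i + int k \<in> {- int r..int r}" using that r by auto
        then show ?thesis using xy by (cases "i + int k \<in> G") (auto simp: agree_outside_def)
      qed
      then show "y \<in> A" using x X \<pi> by (simp add: image)
    qed (simp add: image)
  next
    case letter
    show ?thesis
    proof (rule fibre_eventsI[where R = "nat \<bar>i\<bar>"])
      fix r x y assume r: "nat \<bar>i\<bar> \<le> r" and y: "y \<in> X" and xy: "agree_outside \<pi>\<^sub>b G r x y" and x: "x \<in> A"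
      have "i \<in> {- int r..int r} - G" using r letter(2) by auto
      then have "x i = y i" using xy unfolding agree_outside_def by blast
      then show "y \<in> A" using x y by (simp add: letter)
    qed (simp add: letter)
  qed
qed

lemma conditioning_algebra_generators:
  assumes \<pi>: "\<pi> ` X \<subseteq> Y" "\<forall>x\<in>X. \<forall>i. \<pi> x i = \<pi>\<^sub>b (x i)"
  shows "i \<in> S \<Longrightarrow> {x \<in> X. x i = a} \<in> sets (conditioning_algebra X Y \<pi> S)"
    and "{x \<in> X. \<pi>\<^sub>b (x i) = b} \<in> sets (conditioning_algebra X Y \<pi> S)"
proof -
  note sets = sets_conditioning_algebra(1)[OF \<pi>(1)]
  show "{x \<in> X. x i = a} \<in> sets (conditioning_algebra X Y \<pi> S)" if "i \<in> S"
    unfolding sets using that unfolding conditioning_events_def by blast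
  have "{x \<in> X. \<forall>k<length [b]. \<pi> x (i + int k) = [b] ! k} \<in> conditioning_events X \<pi> S"
    unfolding conditioning_events_def by blast
  moreover have "{x \<in> X. \<forall>k<length [b]. \<pi> x (i + int k) = [b] ! k} = {x \<in> X. \<pi>\<^sub>b (x i) = b}"
    using \<pi>(2) by auto
  ultimately show "{x \<in> X. \<pi>\<^sub>b (x i) = b} \<in> sets (conditioning_algebra X Y \<pi> S)"
    unfolding sets by (simp add: sigma_sets.Basic)
qed

context resampled_measure
begin

lemma averaged_in_fibre:
  assumes \<pi>: "\<pi> ` X \<subseteq> Y" "\<forall>x\<in>X. \<forall>i. \<pi> x i = \<pi>\<^sub>b (x i)"
    and Y: "finite (alphabet Y)" and \<nu>: "sets \<nu> = sets (borel_shift Y)" and \<mu>: "distr \<mu> \<nu> \<pi> = \<nu>"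
  shows "averaged \<in> measure_fibre X \<pi> \<nu>"
proof -
  have meas: "\<pi> \<in> measurable \<mu>' \<nu>" if \<mu>': "sets \<mu>' = sets (borel_shift X)" for \<mu>'
  proof -
    have sp: "space \<mu>' = X" using sets_eq_imp_space_eq[OF \<mu>'] by simp
    have "\<pi> \<in> measurable \<mu>' (borel_shift Y)"
    proof (rule measurable_borel_shiftI[OF Y])
      fix i b
      have "simple_function \<mu>' (\<lambda>x. \<pi> x i)"
        by (rule simple_function_local[OF finite_alphabet \<mu>', of "{i}"]) (use \<pi>(2) in auto)
      then have "(\<lambda>x. \<pi> x i) -` {b} \<inter> space \<mu>' \<in> sets \<mu>'" by (rule simple_functionD)
      moreover have "(\<lambda>x. \<pi> x i) -` {b} \<inter> space \<mu>' = {x \<in> space \<mu>'. \<pi> x i = b}" by auto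
      ultimately show "{x \<in> space \<mu>'. \<pi> x i = b} \<in> sets \<mu>'" by simp
    qed (use \<pi>(1) in \<open>auto simp: sp\<close>)
    then show ?thesis using measurable_cong_sets[OF refl \<nu>] by blast
  qed
  have "distr averaged \<nu> \<pi> = \<nu>"
  proof (rule measure_eqI)
    fix B assume "B \<in> sets (distr averaged \<nu> \<pi>)"
    then have B: "B \<in> sets \<nu>" by simp
    have pre: "\<pi> -` B \<inter> X \<in> sets \<mu>"
      using measurable_sets[OF meas[OF sets_\<mu>] B] by simp
    have "emeasure (distr averaged \<nu> \<pi>) B = emeasure averaged (\<pi> -` B \<inter> X)"
      using emeasure_distr[OF meas[OF sets_averaged] B] by simp
    also have "\<dots> = emeasure \<mu> (\<pi> -` B \<inter> X)"
    proof (rule emeasure_averaged_fibre[OF pre])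
      fix x y assume "x \<in> X" "y \<in> X" "\<And>i. \<pi>\<^sub>b (x i) = \<pi>\<^sub>b (y i)"
      then show "x \<in> \<pi> -` B \<inter> X \<longleftrightarrow> y \<in> \<pi> -` B \<inter> X"
        using \<pi>(2) by (metis IntD1 IntI ext vimageD vimageI2)
    qed
    also have "\<dots> = emeasure (distr \<mu> \<nu> \<pi>) B"
      using emeasure_distr[OF meas[OF sets_\<mu>] B] by simp
    finally show "emeasure (distr averaged \<nu> \<pi>) B = emeasure \<nu> B" by (simp add: \<mu>)
  qed simp
  then show ?thesis using averaged_invariant by (simp add: measure_fibre_def)
qed

lemma block_class_measurable:
  assumes \<pi>: "\<pi> ` X \<subseteq> Y" "\<forall>x\<in>X. \<forall>i. \<pi> x i = \<pi>\<^sub>b (x i)"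
  shows "simple_function (conditioning_algebra X Y \<pi> (- G)) block_class"
  unfolding simple_function_def sets_conditioning_algebra(2)[OF \<pi>(1)]
proof (intro conjI ballI)
  let ?F = "conditioning_algebra X Y \<pi> (- G)"
  show "finite (block_class ` X)"
    by (rule finite_subset[of _ classes]) (use word_at_in_words finite_words in auto)
  fix C assume "C \<in> block_class ` X"
  then obtain x where x: "x \<in> X" "C = block_class x" by blast
  have sp: "space ?F = X" by (rule sets_conditioning_algebra(2)[OF \<pi>(1)])
  have "{z \<in> space ?F. \<forall>i\<in>window - G. z i = x i} \<in> sets ?F"
    using conditioning_algebra_generators(1)[OF \<pi>, where S = "- G"]
    by (intro sets.sets_Collect_finite_All) (auto simp: sp)
  moreover have "{z \<in> space ?F. \<forall>i\<in>G. \<pi>\<^sub>b (z i) = \<pi>\<^sub>b (x i)} \<in> sets ?F"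
    using conditioning_algebra_generators(2)[OF \<pi>, where S = "- G"] finite_G
    by (intro sets.sets_Collect_finite_All) (auto simp: sp)
  ultimately have "{z \<in> space ?F. (\<forall>i\<in>window - G. z i = x i) \<and> (\<forall>i\<in>G. \<pi>\<^sub>b (z i) = \<pi>\<^sub>b (x i))} \<in> sets ?F"
    by - (rule sets.sets_Collect_conj; assumption)
  then have "{z \<in> X. agree_outside \<pi>\<^sub>b G r z x} \<in> sets ?F"
    by (simp only: sp agree_outside_def)
  moreover have "block_class -` {C} \<inter> X = {z \<in> X. agree_outside \<pi>\<^sub>b G r z x}"
    using block_class_eq_iff[OF _ x(1)] x(2) by blast
  ultimately show "block_class -` {C} \<inter> X \<in> sets ?F" by simp
qed

end

theorem theorem3p3:
  fixes X :: "(int \<Rightarrow> 'a) set" and Y :: "(int \<Rightarrow> 'b) set"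
    and \<pi> :: "(int \<Rightarrow> 'a) \<Rightarrow> (int \<Rightarrow> 'b)" and \<pi>\<^sub>b :: "'a \<Rightarrow> 'b"
    and \<nu> :: "(int \<Rightarrow> 'b) measure" and \<mu> :: "(int \<Rightarrow> 'a) measure"
    and G :: "int set" and \<alpha> :: "int \<Rightarrow> 'a"
  assumes "one_step_sft X" and "sofic Y"
    and "one_block_factor_code X Y \<pi>\<^sub>b \<pi>"
    and "\<nu> \<in> invariant_measures Y"
    and "relative_maximal_entropy X \<pi> \<nu> \<mu>"
    and "finite G"
    and "\<alpha> \<in> configurations X G"
  shows "AE x in \<mu>.
    real_cond_exp \<mu> (conditioning_algebra X Y \<pi> (- G))
        (indicator {z \<in> X. restrict z G = \<alpha>}) x =
      (if extends_boundary X G \<alpha> x \<and> same_image_on \<pi>\<^sub>b G \<alpha> x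
       then 1 / real (num_extensions X \<pi>\<^sub>b G x) else 0)"
proof -
  interpret one_step_shift X using assms(1) by (rule one_step_shiftI)
  have \<pi>: "\<pi> ` X \<subseteq> Y" "\<forall>x\<in>X. \<forall>i. \<pi> x i = \<pi>\<^sub>b (x i)"
    using assms(3) by (auto simp: one_block_factor_code_def factor_code_def)
  have fibre: "\<mu> \<in> measure_fibre X \<pi> \<nu>"
    and max: "\<And>\<mu>'. \<mu>' \<in> measure_fibre X \<pi> \<nu> \<Longrightarrow> ks_entropy \<mu>' shift \<le> ks_entropy \<mu> shift"
    using assms(5) by (auto simp: relative_maximal_entropy_def)
  have inv: "\<mu> \<in> invariant_measures X" and proj: "distr \<mu> \<nu> \<pi> = \<nu>"
    using fibre by (auto simp: measure_fibre_def)
  have \<nu>: "sets \<nu> = sets (borel_shift Y)" using assms(4) by (simp add: invariant_measures_def)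
  have finY: "finite (alphabet Y)" using assms(2) by (simp add: sofic_def shift_space_def)
  interpret invariant_shift_measure X \<mu>
    by unfold_locales (use finite_alphabet shift_closed inv in auto)
  let ?F = "conditioning_algebra X Y \<pi> (- G)"
  let ?S = "{z \<in> X. restrict z G = \<alpha>}"
  let ?u = "\<lambda>x. if extends_boundary X G \<alpha> x \<and> same_image_on \<pi>\<^sub>b G \<alpha> x
    then 1 / real (num_extensions X \<pi>\<^sub>b G x) else 0"
  \<comment> \<open>From \<open>R\<close> on, the window contains \<open>G\<close> in its interior.\<close>
  obtain R :: nat where R: "\<And>i. i \<in> G \<Longrightarrow> nat \<bar>i\<bar> < R"
    using finite_imageI[OF assms(6), of "\<lambda>i. nat \<bar>i\<bar>"] finite_nat_set_iff_bounded by auto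
  have window: "resampled_measure X G r \<mu>" if "R \<le> r" for r
  proof
    show "G \<subseteq> {- int r<..<int r}"
    proof
      fix i assume "i \<in> G"
      then show "i \<in> {- int r<..<int r}" using R[of i] that by auto
    qed
  qed (rule inv)
  interpret RM: resampled_measure X \<pi>\<^sub>b G R \<mu> by (rule window) simp
  have u_class: "?u x = RM.class_weight \<alpha> (RM.block_class x)" if "x \<in> X" for x
    using RM.class_weight_word_at[OF that assms(7)] by simp
  have sp_F: "space ?F = X"
    by (rule sets_conditioning_algebra(2)[OF \<pi>(1)])
  have S: "?S \<in> sets \<mu>"
    unfolding sets_\<mu> sets_borel_shift[OF finite_alphabet] by (rule cylinder_in_sigma_sets[OF assms(6)])
  have int_S: "integrable \<mu> (indicator ?S :: _ \<Rightarrow> real)"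
    using S by (intro integrable_real_indicator) (auto simp: emeasure_eq_measure)
  have int_u: "integrable \<mu> ?u"
    using RM.integral_block_class(2)[of "RM.class_weight \<alpha>"]
    by (rule Bochner_Integration.integrable_cong[OF refl, THEN iffD2, rotated]) (use u_class in auto)
  have meas_u: "?u \<in> borel_measurable ?F"
  proof -
    have "simple_function ?F (\<lambda>x. RM.class_weight \<alpha> (RM.block_class x))"
      by (rule simple_function_compose1[OF RM.block_class_measurable[OF \<pi>]])
    then have "(\<lambda>x. RM.class_weight \<alpha> (RM.block_class x)) \<in> borel_measurable ?F"
      by (rule borel_measurable_simple_function)
    then show ?thesis
      by (rule measurable_cong[THEN iffD2, rotated]) (use u_class in \<open>auto simp: sp_F\<close>)
  qed
  \<comment> \<open>Given \<open>A\<close>, a large enough window makes \<open>A\<close> a union of class events, where uniformity applies.\<close>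
  have \<mu>_gen: "A \<in> sets \<mu>" "(\<integral>x. indicator A x * indicator ?S x \<partial>\<mu>) = (\<integral>x. indicator A x * ?u x \<partial>\<mu>)"
    if A: "A \<in> fibre_events X \<pi>\<^sub>b G" for A
  proof -
    obtain r where r: "R \<le> r" and sat: "\<And>x y. x \<in> X \<Longrightarrow> y \<in> X \<Longrightarrow> agree_outside \<pi>\<^sub>b G r x y \<Longrightarrow> x \<in> A \<longleftrightarrow> y \<in> A"
    proof -
      obtain N where "\<forall>r\<ge>N. \<forall>x\<in>X. \<forall>y\<in>X. agree_outside \<pi>\<^sub>b G r x y \<longrightarrow> (x \<in> A \<longleftrightarrow> y \<in> A)"
        using A unfolding fibre_events_def eventually_sequentially by blast
      then have "x \<in> A \<longleftrightarrow> y \<in> A" if "x \<in> X" "y \<in> X" "agree_outside \<pi>\<^sub>b G (max R N) x y" for x y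
        using that max.cobounded2[of N R] by blast
      then show thesis by (intro that[of "max R N"]) auto
    qed
    interpret Rr: resampled_measure X \<pi>\<^sub>b G r \<mu> using r by (rule window)
    have "A \<subseteq> X" using A by (simp add: fibre_events_def)
    then have A_eq: "A = {x \<in> X. Rr.block_class x \<in> Rr.block_class ` A}"
      using Rr.block_class_eq_iff sat by blast
    have "ks_entropy Rr.averaged shift \<le> ks_entropy \<mu> shift"
      by (rule max[OF Rr.averaged_in_fibre[OF \<pi> finY \<nu> proj]])
    then have "(\<integral>x. indicator A x * indicator ?S x \<partial>\<mu>)
        = (\<integral>x. indicator A x * Rr.class_weight \<alpha> (Rr.block_class x) \<partial>\<mu>)"
      by (subst (1 2) A_eq) (rule Rr.cylinder_mass_on_class_event)
    also have "\<dots> = (\<integral>x. indicator A x * ?u x \<partial>\<mu>)"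
      using Rr.class_weight_word_at[OF _ assms(7)] by (intro Bochner_Integration.integral_cong) auto
    finally show "(\<integral>x. indicator A x * indicator ?S x \<partial>\<mu>) = (\<integral>x. indicator A x * ?u x \<partial>\<mu>)" .
    have "Rr.block_class -` (Rr.block_class ` A) \<inter> space \<mu> \<in> sets \<mu>"
      using Rr.simple_class_at[OF sets_\<mu>] by (rule simple_functionD)
    moreover have "Rr.block_class -` (Rr.block_class ` A) \<inter> space \<mu> = A" by (subst (2) A_eq) auto
    ultimately show "A \<in> sets \<mu>" by simp
  qed
  have F_sub: "sets ?F \<subseteq> sigma_sets X (fibre_events X \<pi>\<^sub>b G)"
    unfolding sets_conditioning_algebra(1)[OF \<pi>(1)]
    by (rule sigma_sets_mono'[OF conditioning_events_subset_fibre_events[OF \<pi>(2)]])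
  have in_\<mu>: "B \<in> sets \<mu>" if "B \<in> sigma_sets X (fibre_events X \<pi>\<^sub>b G)" for B
    using sets.sigma_sets_subset[of "fibre_events X \<pi>\<^sub>b G" \<mu>] \<mu>_gen(1) that by auto
  interpret finite_measure_subalgebra \<mu> ?F
    by unfold_locales (use F_sub in_\<mu> in \<open>auto simp: subalgebra_def sp_F\<close>)
  \<comment> \<open>Dynkin's lemma, with the fibre events as intersection-stable generator.\<close>
  have "(LINT x:A|\<mu>. indicator ?S x) = (LINT x:A|\<mu>. ?u x)" if "A \<in> sigma_sets X (fibre_events X \<pi>\<^sub>b G)" for A
  proof -
    have set_int: "set_integrable \<mu> B (indicator ?S :: _ \<Rightarrow> real)" "set_integrable \<mu> B ?u" if "B \<in> sets \<mu>" for B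
      unfolding set_integrable_def using integrable_mult_indicator[OF that int_S] integrable_mult_indicator[OF that int_u]
      by auto
    have whole: "(LINT x:X|\<mu>. indicator ?S x) = (LINT x:X|\<mu>. ?u x)"
    proof -
      have "X \<in> fibre_events X \<pi>\<^sub>b G" by (rule fibre_eventsI) auto
      then show ?thesis unfolding set_lebesgue_integral_def real_scaleR_def by (rule \<mu>_gen(2))
    qed
    from Int_stable_fibre_events fibre_events_subset that show ?thesis
    proof (induction rule: sigma_sets_induct_disjoint)
      case (basic A)
      then show ?case unfolding set_lebesgue_integral_def real_scaleR_def by (rule \<mu>_gen(2))
    next
      case empty
      show ?case by (simp add: set_lebesgue_integral_def)
    next
      case (compl A)
      have A: "A \<in> sets \<mu>" "X - A \<in> sets \<mu>" "A \<union> (X - A) = X"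
        using in_\<mu>[OF compl(1)] sets.sets_into_space[of A \<mu>] sets.compl_sets[of A \<mu>] by auto
      have split: "(LINT x:X|\<mu>. f x) = (LINT x:A|\<mu>. f x) + (LINT x:X - A|\<mu>. f x)"
        if "set_integrable \<mu> A f" "set_integrable \<mu> (X - A) f" for f :: "_ \<Rightarrow> real"
        using set_integral_Un[OF _ that] A(3) by simp
      show ?case
        using split[OF set_int(1)[OF A(1)] set_int(1)[OF A(2)]] split[OF set_int(2)[OF A(1)] set_int(2)[OF A(2)]]
          compl(2) whole by linarith
    next
      case (union A)
      have A: "A i \<in> sets \<mu>" for i using in_\<mu> union(2) by blast
      have add: "(LINT x:(\<Union>i. A i)|\<mu>. f x) = (\<Sum>i. LINT x:A i|\<mu>. f x)"
        if "set_integrable \<mu> (\<Union>i. A i) f" for f :: "_ \<Rightarrow> real"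
        using union(1) A that by (intro lebesgue_integral_countable_add) (auto simp: disjoint_family_on_def)
      have "(\<Union>i. A i) \<in> sets \<mu>" using A by blast
      from add[OF set_int(1)[OF this]] add[OF set_int(2)[OF this]] show ?case by (simp only: union(3))
    qed
  qed
  then have "(LINT x:A|\<mu>. indicator ?S x) = (LINT x:A|\<mu>. ?u x)" if "A \<in> sets ?F" for A
    using F_sub that by blast
  then show ?thesis
    using int_S int_u meas_u by (rule real_cond_exp_charact)
qed

end
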